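(* Assume that $g$ and $f$ satisfy all the hypotheses listed in the context (with the number $\alpha$ introduced there), and let $u_0\in W_0^{s,G_{x,y}}(\Omega)$. Assume further that $E(u_0)<d$ and $I(u_0)<0$. Then the strong solution $u$ of the problem $$u_t+(-\Delta)^s_{g_{x,y}}u=f(x,u)\ \text{in }\Omega\times(0,\infty),\qquad u=0\ \text{in }(\mathbb{R}^N\setminus\Omega)\times(0,\infty),\qquad u(x,0)=u_0(x)\ \text{in }\Omega,$$ exhibits blow-up in the sense that $$\lim_{t\to T^*}\int_0^t\|u(\cdot,\tau)\|^2_{L^2(\Omega)}\,d\tau=+\infty,\qquad\text{where}\qquad T^*:=\frac{4\|u_0\|^2_{L^2(\Omega)}(\alpha-1)}{\alpha(\alpha-2)^2(d-E(u_0))}.$$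
   Context: Setting. Let $s\in(0,1)$ and let $\Omega\subset\mathbb{R}^N$ be a bounded domain with smooth boundary. Let $g:\mathbb{R}^N\times\mathbb{R}^N\times[0,\infty)\to[0,\infty)$, $g_{x,y}(t)=g(x,y,t)$, be measurable in $(x,y)$ and extended to $t<0$ by $g_{x,y}(-t)=-g_{x,y}(t)$. Put $G_{x,y}(t)=\int_0^{|t|}g_{x,y}(\tau)\,d\tau$ and $\widehat G_x=G_{x,x}$. A prime on $g$ or $f$ denotes the derivative in $t$. Hypotheses on $g$ (for all $x,y$): (1) $\lim_{t\to0^+}g_{x,y}(t)=0$, $\lim_{t\to\infty}g_{x,y}(t)=\infty$. (2) $t\mapsto g_{x,y}(t)$ is $C^1$ and increasing on $(0,\infty)$. (3) There are constants $g^-,g^+\in(1,\infty)$ with $1<g^-\le\frac{g_{x,y}(t)t}{G_{x,y}(t)}\le g^+<g^-_{*,s}$ and $g^--1\le\frac{g_{x,y}'(t)t}{g_{x,y}(t)}\le g^+-1$ for all $t>0$, where $g^-_{*,s}=\frac{Ng^-}{N-sg^-}$ if $N>sg^-$ and $g^-_{*,s}=+\infty$ if $N\le sg^-$; moreover $N\ge sg^-$. (4) For all $x\in\Omega$: $\int_0^1\widehat G_x^{-1}(\tau)\tau^{-\frac{N+s}{N}}d\tau<\infty$ and $\int_1^\infty\widehat G_x^{-1}(\tau)\tau^{-\frac{N+s}{N}}d\tau=\infty$. The function $\widehat G_x^*$ is defined by $(\widehat G_x^* )^{-1}(t)=\int_0^t\widehat G_x^{-1}(\tau)\tau^{-\frac{N+s}{N}}d\tau$,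 $t\ge0$. Hypotheses on $f:\Omega\times\mathbb{R}\to\mathbb{R}$ (Carath\'eodory), with $F(x,t)=\int_0^tf(x,\tau)d\tau$: (a) For all $x\in\Omega$, $f(x,\cdot)\in C^1(\mathbb{R})$, $f(x,0)=f'(x,0)=0$, and there is a constant $B>0$ with $\min\{F(x,1),F(x,-1)\}\ge B$ for all $x\in\Omega$. (b) For all $x\in\Omega$, $f(x,\cdot)$ is convex for $t>0$ and concave for $t<0$. (c) There are measurable, bounded functions $h_1,h_2:\Omega\to(1,\infty)$ with $h_1(x)F(x,t)\le tf(x,t)\le h_2(x)F(x,t)$ for all $(x,t)\in\Omega\times\mathbb{R}$; and, with $\Phi(x,t)=t^{h_2(x)}$, one has $\Phi\prec\prec\widehat G_x^*$, i.e. for every $k>0$, $\lim_{t\to\infty}\Phi(x,kt)/\widehat G_x^*(t)=0$ uniformly in $x\in\Omega$. (d) $t\,(f'(x,t)t-(\alpha-1)f(x,t))>0$ for all $x\in\Omega$, $t\ne0$, where $\alpha=g^+$ if $g^+>2$, and $\alpha$ is some number $>2$ if $g^+\le2$. Put $h_i^-=\inf_\Omega h_i$, $h_i^+=\sup_\Omega h_i$. Further hypotheses: $\max\{2,g^+\}<\min\{h_1^-,h_2^-\}$ and $h_2^+\le\frac{g^-_{*,s}}{2}+1$. Spaces. $L^{\Phi}(\Omega)$ and $L^{\widehat G_x}$ are the Musielak–Orlicz spaces with Luxemburg norm. Let $Q=(\mathbb{R}^N\times\mathbb{R}^N)\setminus((\mathbb{R}^N\setminus\Omega)\times(\mathbb{R}^N\setminus\Omega))$,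 $d\mu=\frac{dx\,dy}{|x-y|^N}$, $D^su=\frac{u(x)-u(y)}{|x-y|^s}$. $W_0^{s,G_{x,y}}(\Omega)$ is the set of $u\in L^{\widehat G_x}(\mathbb{R}^N)$ with $u=0$ in $\mathbb{R}^N\setminus\Omega$ and $D^su\in L^{G_{x,y}}(Q,d\mu)$, normed by $[u]_{s,G_{x,y}}=\inf\{\lambda>0:\iint_QG_{x,y}(D^su/\lambda)\,d\mu\le1\}$. It is a standing fact of the setting that $W_0^{s,G_{x,y}}(\Omega)$ is compactly embedded in $L^\Phi(\Omega)$. Operator: $(-\Delta)^s_{g_{x,y}}u(x)=\mathrm{P.V.}\int_{\mathbb{R}^N}g_{x,y}(D^su)\frac{dy}{|x-y|^{N+s}}$. Functionals on $W_0^{s,G_{x,y}}(\Omega)$: $E(u)=\iint_QG_{x,y}(D^su)\,d\mu-\int_\Omega F(x,u)\,dx$ and $I(u)=\iint_Qg_{x,y}(D^su)D^su\,d\mu-\int_\Omega f(x,u)u\,dx$. Nehari manifold $\mathcal{N}=\{u\ne0:I(u)=0\}$, depth $d=\inf_{\mathcal{N}}E$. Weak solution on $[0,T]$ (global if $T=\infty$): $u\in L^\infty(0,T;W_0^{s,G_{x,y}}(\Omega))$ with $u_t\in L^2(0,T;L^2(\Omega))$ such that $u(\cdot,0)=u_0$ a.e. in $\Omega$; for all $\phi\in W_0^{s,G_{x,y}}(\Omega)$ and a.e. $t$, $\int_\Omega u_t\phi\,dx+\iint_Qg_{x,y}(D^su)D^s\phi\,d\mu=\int_\Omega f(x,u)\phi\,dx$;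 $u\in C(0,T;L^\Phi(\Omega))$; and $\int_0^t\|u_t(\cdot,\tau)\|_{L^2(\Omega)}^2d\tau+E(u(\cdot,t))\le E(u_0)$ for a.e. $t\in[0,T)$. Strong solution: a weak solution for which $\int_0^t\|u_t(\cdot,\tau)\|_{L^2(\Omega)}^2d\tau+E(u(\cdot,t))=E(u(\cdot,0))$ for every interval $[0,t]\subset[0,T)$. *)

theory Defs
  imports "HOL-Analysis.Analysis"
begin

section \<open>Smooth domains\<close>

fun Ck_on :: "nat \<Rightarrow> 'a::euclidean_space set \<Rightarrow> ('a \<Rightarrow> real) \<Rightarrow> bool" where
  "Ck_on 0 U r \<longleftrightarrow> continuous_on U r"
| "Ck_on (Suc k) U r \<longleftrightarrow> r differentiable_on U \<and>
     (\<forall>b\<in>Basis. Ck_on k U (\<lambda>x. frechet_derivative r (at x) b))"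

text \<open>The boundary is smooth if near each of its points the set is a sublevel set of a smooth
  function with non-vanishing gradient.\<close>

definition smooth_boundary :: "'a::euclidean_space set \<Rightarrow> bool" where
  "smooth_boundary \<Omega> \<longleftrightarrow> (\<forall>p\<in>frontier \<Omega>. \<exists>U r. open U \<and> p \<in> U \<and> (\<forall>k. Ck_on k U r) \<and>
     (\<forall>x\<in>U. frechet_derivative r (at x) \<noteq> (\<lambda>h. 0)) \<and> \<Omega> \<inter> U = {x\<in>U. r x < 0})"

definition smooth_bounded_domain :: "'a::euclidean_space set \<Rightarrow> bool" where
  "smooth_bounded_domain \<Omega> \<longleftrightarrow>
     open \<Omega> \<and> connected \<Omega> \<and> \<Omega> \<noteq> {} \<and> bounded \<Omega> \<and> smooth_boundary \<Omega>"

section \<open>The N-functions\<close>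

definition G_fun :: "('a \<Rightarrow> 'a \<Rightarrow> real \<Rightarrow> real) \<Rightarrow> 'a \<Rightarrow> 'a \<Rightarrow> real \<Rightarrow> real" where
  "G_fun g x y t = (LBINT \<tau>=0..ereal \<bar>t\<bar>. g x y \<tau>)"

definition G_hat :: "('a \<Rightarrow> 'a \<Rightarrow> real \<Rightarrow> real) \<Rightarrow> 'a \<Rightarrow> real \<Rightarrow> real" where
  "G_hat g x t = G_fun g x x t"

definition G_hat_inv :: "('a \<Rightarrow> 'a \<Rightarrow> real \<Rightarrow> real) \<Rightarrow> 'a \<Rightarrow> real \<Rightarrow> real" where
  "G_hat_inv g x = inv_into {0..} (G_hat g x)"

definition conj_integrand ::
  "real \<Rightarrow> ('a::euclidean_space \<Rightarrow> 'a \<Rightarrow> real \<Rightarrow> real) \<Rightarrow> 'a \<Rightarrow> real \<Rightarrow> real" where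
  "conj_integrand s g x \<tau> = G_hat_inv g x \<tau> * \<tau> powr (- ((real DIM('a) + s) / real DIM('a)))"

definition G_star_inv ::
  "real \<Rightarrow> ('a::euclidean_space \<Rightarrow> 'a \<Rightarrow> real \<Rightarrow> real) \<Rightarrow> 'a \<Rightarrow> real \<Rightarrow> real" where
  "G_star_inv s g x t = (LBINT \<tau>=0..ereal t. conj_integrand s g x \<tau>)"

definition G_star ::
  "real \<Rightarrow> ('a::euclidean_space \<Rightarrow> 'a \<Rightarrow> real \<Rightarrow> real) \<Rightarrow> 'a \<Rightarrow> real \<Rightarrow> real" where
  "G_star s g x = inv_into {0..} (G_star_inv s g x)"

definition crit_exp :: "nat \<Rightarrow> real \<Rightarrow> real \<Rightarrow> ereal" where
  "crit_exp N s p = (if real N > s * p then ereal (real N * p / (real N - s * p)) else \<infinity>)"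

definition F_fun :: "('a \<Rightarrow> real \<Rightarrow> real) \<Rightarrow> 'a \<Rightarrow> real \<Rightarrow> real" where
  "F_fun f x t = (LBINT \<tau>=0..ereal t. f x \<tau>)"

definition Phi_fun :: "('a \<Rightarrow> real) \<Rightarrow> 'a \<Rightarrow> real \<Rightarrow> real" where
  "Phi_fun h x t = t powr h x"

section \<open>Musielak--Orlicz spaces and the fractional space\<close>

text \<open>Elements of function spaces are represented by functions, not by classes modulo
  equality almost everywhere; the norms are therefore seminorms.\<close>

definition modular :: "'b measure \<Rightarrow> ('b \<Rightarrow> real \<Rightarrow> real) \<Rightarrow> ('b \<Rightarrow> real) \<Rightarrow> ennreal" where
  "modular M A w = (\<integral>\<^sup>+z. ennreal (A z \<bar>w z\<bar>) \<partial>M)"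

definition MO_space :: "'b measure \<Rightarrow> ('b \<Rightarrow> real \<Rightarrow> real) \<Rightarrow> ('b \<Rightarrow> real) set" where
  "MO_space M A = {w \<in> borel_measurable M. \<exists>c>0. modular M A (\<lambda>z. w z / c) < \<infinity>}"

definition lux_norm :: "'b measure \<Rightarrow> ('b \<Rightarrow> real \<Rightarrow> real) \<Rightarrow> ('b \<Rightarrow> real) \<Rightarrow> real" where
  "lux_norm M A w = Inf {c. c > 0 \<and> modular M A (\<lambda>z. w z / c) \<le> 1}"

definition Q_set :: "'a set \<Rightarrow> ('a \<times> 'a) set" where
  "Q_set \<Omega> = UNIV - (UNIV - \<Omega>) \<times> (UNIV - \<Omega>)"

definition mu_Q :: "'a::euclidean_space set \<Rightarrow> ('a \<times> 'a) measure" where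
  "mu_Q \<Omega> = restrict_space
     (density lebesgue (\<lambda>(x, y). ennreal (1 / norm (x - y) ^ DIM('a)))) (Q_set \<Omega>)"

definition Ds :: "real \<Rightarrow> ('a::euclidean_space \<Rightarrow> real) \<Rightarrow> 'a \<times> 'a \<Rightarrow> real" where
  "Ds s u = (\<lambda>(x, y). (u x - u y) / norm (x - y) powr s)"

definition W0 :: "real \<Rightarrow> 'a::euclidean_space set \<Rightarrow> ('a \<Rightarrow> 'a \<Rightarrow> real \<Rightarrow> real) \<Rightarrow> ('a \<Rightarrow> real) set" where
  "W0 s \<Omega> g = {u \<in> MO_space lebesgue (G_hat g).
     (AE x in lebesgue. x \<notin> \<Omega> \<longrightarrow> u x = 0) \<and>
     Ds s u \<in> MO_space (mu_Q \<Omega>) (\<lambda>(x, y). G_fun g x y)}"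

definition W0_norm :: "real \<Rightarrow> 'a::euclidean_space set \<Rightarrow> ('a \<Rightarrow> 'a \<Rightarrow> real \<Rightarrow> real) \<Rightarrow> ('a \<Rightarrow> real) \<Rightarrow> real" where
  "W0_norm s \<Omega> g u = lux_norm (mu_Q \<Omega>) (\<lambda>(x, y). G_fun g x y) (Ds s u)"

definition L_Phi :: "'a::euclidean_space set \<Rightarrow> ('a \<Rightarrow> real) \<Rightarrow> ('a \<Rightarrow> real) set" where
  "L_Phi \<Omega> h = MO_space (lebesgue_on \<Omega>) (Phi_fun h)"

definition L_Phi_norm :: "'a::euclidean_space set \<Rightarrow> ('a \<Rightarrow> real) \<Rightarrow> ('a \<Rightarrow> real) \<Rightarrow> real" where
  "L_Phi_norm \<Omega> h = lux_norm (lebesgue_on \<Omega>) (Phi_fun h)"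

definition L2_space :: "'a::euclidean_space set \<Rightarrow> ('a \<Rightarrow> real) set" where
  "L2_space \<Omega> = {w \<in> borel_measurable (lebesgue_on \<Omega>). integrable (lebesgue_on \<Omega>) (\<lambda>x. (w x)\<^sup>2)}"

definition L2_norm :: "'a::euclidean_space set \<Rightarrow> ('a \<Rightarrow> real) \<Rightarrow> real" where
  "L2_norm \<Omega> w = sqrt (LINT x|lebesgue_on \<Omega>. (w x)\<^sup>2)"

definition compactly_embedded ::
  "('a \<Rightarrow> real) set \<Rightarrow> (('a \<Rightarrow> real) \<Rightarrow> real) \<Rightarrow> ('a \<Rightarrow> real) set \<Rightarrow> (('a \<Rightarrow> real) \<Rightarrow> real) \<Rightarrow> bool" where
  "compactly_embedded X nX Y nY \<longleftrightarrow> X \<subseteq> Y \<and>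
     (\<forall>w :: nat \<Rightarrow> 'a \<Rightarrow> real. range w \<subseteq> X \<and> (\<exists>C. \<forall>n. nX (w n) \<le> C) \<longrightarrow>
        (\<exists>r v. strict_mono r \<and> v \<in> Y \<and> (\<lambda>n. nY (\<lambda>x. w (r n) x - v x)) \<longlonglongrightarrow> 0))"

section \<open>Energy, Nehari functional and potential well\<close>

definition energy_E ::
  "real \<Rightarrow> 'a::euclidean_space set \<Rightarrow> ('a \<Rightarrow> 'a \<Rightarrow> real \<Rightarrow> real) \<Rightarrow> ('a \<Rightarrow> real \<Rightarrow> real) \<Rightarrow> ('a \<Rightarrow> real) \<Rightarrow> real" where
  "energy_E s \<Omega> g f u =
     (LINT (x, y)|mu_Q \<Omega>. G_fun g x y (Ds s u (x, y))) - (LINT x|lebesgue_on \<Omega>. F_fun f x (u x))"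

definition nehari_I ::
  "real \<Rightarrow> 'a::euclidean_space set \<Rightarrow> ('a \<Rightarrow> 'a \<Rightarrow> real \<Rightarrow> real) \<Rightarrow> ('a \<Rightarrow> real \<Rightarrow> real) \<Rightarrow> ('a \<Rightarrow> real) \<Rightarrow> real" where
  "nehari_I s \<Omega> g f u =
     (LINT (x, y)|mu_Q \<Omega>. g x y (Ds s u (x, y)) * Ds s u (x, y))
     - (LINT x|lebesgue_on \<Omega>. f x (u x) * u x)"

definition nehari_manifold ::
  "real \<Rightarrow> 'a::euclidean_space set \<Rightarrow> ('a \<Rightarrow> 'a \<Rightarrow> real \<Rightarrow> real) \<Rightarrow> ('a \<Rightarrow> real \<Rightarrow> real) \<Rightarrow> ('a \<Rightarrow> real) set" where
  "nehari_manifold s \<Omega> g f =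
     {u \<in> W0 s \<Omega> g. \<not> (AE x in lebesgue. u x = 0) \<and> nehari_I s \<Omega> g f u = 0}"

definition depth_d ::
  "real \<Rightarrow> 'a::euclidean_space set \<Rightarrow> ('a \<Rightarrow> 'a \<Rightarrow> real \<Rightarrow> real) \<Rightarrow> ('a \<Rightarrow> real \<Rightarrow> real) \<Rightarrow> real" where
  "depth_d s \<Omega> g f = Inf (energy_E s \<Omega> g f ` nehari_manifold s \<Omega> g f)"

section \<open>Functions of time with values in a function space\<close>

text \<open>Strong (Bochner) measurability on \<open>J\<close>: almost everywhere limit of simple functions with
  values in the space \<open>X\<close> with (semi)norm \<open>nX\<close>.\<close>

definition bochner_measurable ::
  "real set \<Rightarrow> ('a \<Rightarrow> real) set \<Rightarrow> (('a \<Rightarrow> real) \<Rightarrow> real) \<Rightarrow> (real \<Rightarrow> 'a \<Rightarrow> real) \<Rightarrow> bool" where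
  "bochner_measurable J X nX u \<longleftrightarrow>
     (\<exists>S :: nat \<Rightarrow> real \<Rightarrow> 'a \<Rightarrow> real.
        (\<forall>n. S n ` J \<subseteq> X \<and> finite (S n ` J) \<and> (\<forall>w. {t\<in>J. S n t = w} \<in> sets lebesgue)) \<and>
        (AE t in lebesgue. t \<in> J \<longrightarrow> u t \<in> X \<and> (\<lambda>n. nX (\<lambda>x. S n t x - u t x)) \<longlonglongrightarrow> 0))"

definition bochner_Linf ::
  "real set \<Rightarrow> ('a \<Rightarrow> real) set \<Rightarrow> (('a \<Rightarrow> real) \<Rightarrow> real) \<Rightarrow> (real \<Rightarrow> 'a \<Rightarrow> real) \<Rightarrow> bool" where
  "bochner_Linf J X nX u \<longleftrightarrow> bochner_measurable J X nX u \<and>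
     (\<exists>C. AE t in lebesgue. t \<in> J \<longrightarrow> nX (u t) \<le> C)"

definition bochner_L2 ::
  "real set \<Rightarrow> ('a \<Rightarrow> real) set \<Rightarrow> (('a \<Rightarrow> real) \<Rightarrow> real) \<Rightarrow> (real \<Rightarrow> 'a \<Rightarrow> real) \<Rightarrow> bool" where
  "bochner_L2 J X nX u \<longleftrightarrow> bochner_measurable J X nX u \<and>
     (\<integral>\<^sup>+t\<in>J. ennreal ((nX (u t))\<^sup>2) \<partial>lebesgue) < \<infinity>"

definition continuous_into ::
  "real set \<Rightarrow> ('a \<Rightarrow> real) set \<Rightarrow> (('a \<Rightarrow> real) \<Rightarrow> real) \<Rightarrow> (real \<Rightarrow> 'a \<Rightarrow> real) \<Rightarrow> bool" where
  "continuous_into J X nX u \<longleftrightarrow>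
     (\<forall>t\<in>J. u t \<in> X \<and> ((\<lambda>\<tau>. nX (\<lambda>x. u \<tau> x - u t x)) \<longlongrightarrow> 0) (at t within J))"

definition open_time :: "ereal \<Rightarrow> real set" where
  "open_time T = {t. 0 < t \<and> ereal t < T}"

definition test_fun :: "ereal \<Rightarrow> (real \<Rightarrow> real) \<Rightarrow> bool" where
  "test_fun T \<psi> \<longleftrightarrow> (\<forall>k. (deriv ^^ k) \<psi> differentiable_on UNIV) \<and>
     (\<exists>a b. {a..b} \<subseteq> open_time T \<and> (\<forall>t. t \<notin> {a..b} \<longrightarrow> \<psi> t = 0))"

text \<open>The distributional time derivative; the identity between the two \<open>L\<^sup>2(\<Omega>)\<close>-valued
  integrals is expressed by pairing with every \<open>\<phi>\<close> in \<open>L\<^sup>2(\<Omega>)\<close>.\<close>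

definition weak_time_deriv ::
  "ereal \<Rightarrow> 'a::euclidean_space set \<Rightarrow> (real \<Rightarrow> 'a \<Rightarrow> real) \<Rightarrow> (real \<Rightarrow> 'a \<Rightarrow> real) \<Rightarrow> bool" where
  "weak_time_deriv T \<Omega> u v \<longleftrightarrow> (\<forall>\<phi>\<in>L2_space \<Omega>. \<forall>\<psi>. test_fun T \<psi> \<longrightarrow>
     (LINT t:open_time T|lebesgue. deriv \<psi> t * (LINT x|lebesgue_on \<Omega>. u t x * \<phi> x)) =
     - (LINT t:open_time T|lebesgue. \<psi> t * (LINT x|lebesgue_on \<Omega>. v t x * \<phi> x)))"

section \<open>Weak and strong solutions\<close>

text \<open>Here \<open>v\<close> plays the role of \<open>u\<^sub>t\<close>, which is determined by \<open>u\<close> up to null sets; a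
  weak solution is a \<open>u\<close> for which some such \<open>v\<close> exists. The value
  \<open>T = \<infinity>\<close> is allowed. Integrability is required explicitly because the integral of a
  non-integrable function is \<open>0\<close> in the library.\<close>

definition weak_solution_with ::
  "real \<Rightarrow> 'a::euclidean_space set \<Rightarrow> ('a \<Rightarrow> 'a \<Rightarrow> real \<Rightarrow> real) \<Rightarrow> ('a \<Rightarrow> real \<Rightarrow> real) \<Rightarrow> ('a \<Rightarrow> real)
    \<Rightarrow> ('a \<Rightarrow> real) \<Rightarrow> ereal \<Rightarrow> (real \<Rightarrow> 'a \<Rightarrow> real) \<Rightarrow> (real \<Rightarrow> 'a \<Rightarrow> real) \<Rightarrow> bool" where
  "weak_solution_with s \<Omega> g f h u0 T u v \<longleftrightarrow>
     bochner_Linf (open_time T) (W0 s \<Omega> g) (W0_norm s \<Omega> g) u \<and>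
     bochner_L2 (open_time T) (L2_space \<Omega>) (L2_norm \<Omega>) v \<and>
     weak_time_deriv T \<Omega> u v \<and>
     (AE x in lebesgue_on \<Omega>. u 0 x = u0 x) \<and>
     (\<forall>\<phi>\<in>W0 s \<Omega> g. AE t in lebesgue. t \<in> open_time T \<longrightarrow>
        integrable (lebesgue_on \<Omega>) (\<lambda>x. v t x * \<phi> x) \<and>
        integrable (mu_Q \<Omega>) (\<lambda>(x, y). g x y (Ds s (u t) (x, y)) * Ds s \<phi> (x, y)) \<and>
        integrable (lebesgue_on \<Omega>) (\<lambda>x. f x (u t x) * \<phi> x) \<and>
        (LINT x|lebesgue_on \<Omega>. v t x * \<phi> x)
          + (LINT (x, y)|mu_Q \<Omega>. g x y (Ds s (u t) (x, y)) * Ds s \<phi> (x, y))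
        = (LINT x|lebesgue_on \<Omega>. f x (u t x) * \<phi> x)) \<and>
     continuous_into {t. 0 \<le> t \<and> ereal t \<le> T} (L_Phi \<Omega> h) (L_Phi_norm \<Omega> h) u \<and>
     (AE t in lebesgue. t \<in> open_time T \<longrightarrow>
        integrable (lebesgue_on \<Omega>) (\<lambda>x. F_fun f x (u t x)) \<and>
        (LINT \<tau>:{0..t}|lebesgue. (L2_norm \<Omega> (v \<tau>))\<^sup>2) + energy_E s \<Omega> g f (u t)
        \<le> energy_E s \<Omega> g f u0)"

text \<open>The energy identity at time \<open>t\<close> presupposes that \<open>E\<close> is defined at \<open>u t\<close>, i.e. that
  \<open>u t\<close> lies in the space and that \<open>F(x, u t)\<close> is integrable.\<close>

definition strong_solution ::
  "real \<Rightarrow> 'a::euclidean_space set \<Rightarrow> ('a \<Rightarrow> 'a \<Rightarrow> real \<Rightarrow> real) \<Rightarrow> ('a \<Rightarrow> real \<Rightarrow> real) \<Rightarrow> ('a \<Rightarrow> real)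
    \<Rightarrow> ('a \<Rightarrow> real) \<Rightarrow> ereal \<Rightarrow> (real \<Rightarrow> 'a \<Rightarrow> real) \<Rightarrow> bool" where
  "strong_solution s \<Omega> g f h u0 T u \<longleftrightarrow> (\<exists>v. weak_solution_with s \<Omega> g f h u0 T u v \<and>
     (\<forall>t. 0 \<le> t \<and> ereal t < T \<longrightarrow>
        u t \<in> W0 s \<Omega> g \<and> integrable (lebesgue_on \<Omega>) (\<lambda>x. F_fun f x (u t x)) \<and>
        (LINT \<tau>:{0..t}|lebesgue. (L2_norm \<Omega> (v \<tau>))\<^sup>2) + energy_E s \<Omega> g f (u t)
        = energy_E s \<Omega> g f (u 0)))"

end

theory Submission
  imports Defs "HOL-Computational_Algebra.Polynomial"
begin

text \<open>The proof combines the potential well of Payne and Sattinger with Levine's concavity method.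

  Write \<open>\<delta>(w) = \<alpha> E(w) - I(w)\<close> for the defect of a state \<open>w\<close>. It is the integral of
  \<open>\<alpha> G - g t\<close>, evaluated at the difference quotient of \<open>w\<close>, plus the integral of \<open>f t - \<alpha> F\<close>, evaluated
  at \<open>w\<close>. Both integrands are nonnegative and grow when \<open>w\<close> is multiplied by a larger factor. If
  \<open>I(w) < 0\<close>, then some multiple \<open>\<kappa> w\<close> with \<open>0 < \<kappa> < 1\<close> lies on the Nehari manifold, because for small
  factors the growth exponent \<open>gp\<close> of the gradient term beats the exponents \<open>h1 > gp\<close> of the source.
  Hence \<open>\<alpha> d \<le> \<alpha> E(\<kappa> w) = \<delta>(\<kappa> w) \<le> \<delta>(w)\<close>, that is \<open>- I(w) \<ge> \<alpha> (d - E(w))\<close>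
  (\<open>depth_le_defect\<close>).

  Along the flow, the derivative of \<open>\<parallel>u\<parallel>\<^sup>2 / 2\<close> is \<open>(u\<^sub>t, u) = - I(u)\<close>, and the energy identity turns
  the lower bound into \<open>(u\<^sub>t, u) \<ge> \<alpha> (V + \<beta>) - \<beta>\<close>, where \<open>V(t)\<close> is the integral of \<open>\<parallel>u\<^sub>t\<parallel>\<^sup>2\<close> up to
  time \<open>t\<close> and \<open>\<beta> = \<alpha> (d - E(u\<^sub>0)) / (\<alpha> - 1)\<close>. For
  \<open>M(t) = \<integral>\<^sub>0\<^sup>t \<parallel>u\<parallel>\<^sup>2 + (T\<^sup>* - t) \<parallel>u\<^sub>0\<parallel>\<^sup>2 + \<beta> (t + \<sigma>)\<^sup>2\<close> this gives
  \<open>M M'' \<ge> (\<alpha> / 2) M'\<^sup>2\<close>, so that \<open>M\<close> to the power \<open>- (\<alpha> - 2) / 2\<close> lies below its tangent at \<open>0\<close>.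
  With \<open>\<sigma> = (\<alpha> - 2) T\<^sup>* / 2\<close> the tangent vanishes exactly at \<open>T\<^sup>*\<close>, and \<open>M\<close> is at least a multiple
  of a negative power of \<open>1 - t / T\<^sup>*\<close> (\<open>concavity_lower_bound\<close>).

  Two steps need care, since \<open>F(x, 1)\<close> may be unbounded in \<open>x\<close>: the source term need then not be
  continuous on the energy space, nor \<open>I\<close> along the flow.

  First, the weak equation holds for each test function at almost every time, and \<open>u(t)\<close> itself is
  not a fixed test function. It is reached from the countably many functions
  \<open>min(u(r)\<^sup>\<plusminus>, u(r')\<^sup>\<plusminus>)\<close> with rational \<open>r\<close>, \<open>r'\<close> by letting first \<open>r\<close> and then \<open>r'\<close> tend to \<open>t\<close>.
  In both limits the source term is dominated, which is the truncation argument of Brezis and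
  Browder (\<open>tested_self\<close>).

  Second, \<open>I(u(t)) < 0\<close> has to persist (\<open>invariant\<close>). The defect is lower semicontinuous and the
  energy is continuous in time, so \<open>I\<close> is upper semicontinuous along the flow; hence there is a first
  time \<open>t\<^sub>0 > 0\<close> with \<open>I(u(t\<^sub>0)) \<ge> 0\<close> if there is any such time. Before \<open>t\<^sub>0\<close>, \<open>- I(u)\<close> exceeds a
  positive constant. Testing with \<open>u(t) - u(t\<^sub>0)\<close> shows that \<open>\<parallel>u(t) - u(t\<^sub>0)\<parallel>\<^sup>2\<close> increases on an
  interval that ends at \<open>t\<^sub>0\<close>, although it vanishes there.\<close>

section \<open>One-variable estimates for N-functions and source terms\<close>

text \<open>A Young inequality that needs no conjugate function: if \<open>b\<close> does not exceed \<open>\<epsilon> a\<close> in the direction of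
  \<open>a\<close>, the first term dominates; otherwise \<open>b / \<epsilon>\<close> lies beyond \<open>a\<close> on the same side of \<open>0\<close>, and monotonicity
  gives the second term.\<close>

lemma mono_mult_young:
  fixes k :: "real \<Rightarrow> real"
  assumes "mono k" "k 0 = 0" "0 < \<epsilon>"
  shows "k a * b \<le> \<epsilon> * (k a * a) + k (b / \<epsilon>) * b"
proof -
  have sgn: "0 \<le> k t * t" "0 \<le> k (t / \<epsilon>) * t" for t
    using assms monoD[OF assms(1), of 0 t] monoD[OF assms(1), of t 0]
      monoD[OF assms(1), of 0 "t/\<epsilon>"] monoD[OF assms(1), of "t/\<epsilon>" 0]
    by (cases "t \<ge> 0"; auto simp: mult_nonneg_nonneg mult_nonpos_nonpos divide_le_0_iff)+
  consider "0 \<le> a" "b \<le> \<epsilon> * a" | "0 \<le> a" "\<epsilon> * a \<le> b" | "a \<le> 0" "\<epsilon> * a \<le> b" | "a \<le> 0" "b \<le> \<epsilon> * a"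
    by linarith
  then show ?thesis
  proof cases
    case 1
    have "k a * b \<le> k a * (\<epsilon> * a)" using 1 assms monoD[OF assms(1), of 0 a] by (intro mult_left_mono) auto
    then show ?thesis using sgn[of b] by (simp add: algebra_simps)
  next
    case 2
    then have "a \<le> b / \<epsilon>" "b \<ge> 0"
      using assms(3) mult_nonneg_nonneg[of \<epsilon> a] by (simp add: pos_le_divide_eq mult.commute, linarith)
    then have "k a * b \<le> k (b / \<epsilon>) * b" using monoD[OF assms(1)] by (intro mult_right_mono) auto
    then show ?thesis using sgn(1)[of a] assms by (simp add: add_increasing)
  next
    case 3
    have "k a * b \<le> k a * (\<epsilon> * a)" using 3 assms monoD[OF assms(1), of a 0] by (intro mult_left_mono_neg) auto
    then show ?thesis using sgn[of b] by (simp add: algebra_simps)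
  next
    case 4
    then have "b / \<epsilon> \<le> a" "b \<le> 0"
      using assms(3) mult_nonneg_nonpos[of \<epsilon> a] by (simp add: pos_divide_le_eq mult.commute, linarith)
    then have "k a * b \<le> k (b / \<epsilon>) * b" using monoD[OF assms(1)] by (intro mult_right_mono_neg) auto
    then show ?thesis using sgn(1)[of a] assms by (simp add: add_increasing)
  qed
qed

text \<open>The differential inequality says that \<open>t powr (- p) * H t\<close> is nonincreasing.\<close>

lemma scale_ge_powr:
  fixes H h :: "real \<Rightarrow> real"
  assumes d: "\<And>t. 0 < t \<Longrightarrow> (H has_real_derivative h t) (at t)"
    and le: "\<And>t. 0 < t \<Longrightarrow> t * h t \<le> p * H t"
    and l: "0 < \<kappa>" "\<kappa> \<le> 1" and t: "0 < t"
  shows "\<kappa> powr p * H t \<le> H (\<kappa> * t)"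
proof -
  define \<phi> where "\<phi> t = H t * t powr (- p)" for t
  have "\<phi> t \<le> \<phi> (\<kappa> * t)"
  proof (rule DERIV_nonpos_imp_nonincreasing[where a = "\<kappa> * t" and b = t and f = \<phi>])
    show "\<kappa> * t \<le> t" using l t by simp
    fix x assume x: "\<kappa> * t \<le> x" "x \<le> t"
    have x0: "x > 0" using x l t by (meson mult_pos_pos less_le_trans)
    have "(\<phi> has_real_derivative (h x * x powr (-p) + H x * (- p * x powr (- p - 1)))) (at x)"
      unfolding \<phi>_def using x0 by (auto intro!: derivative_eq_intros d has_real_derivative_powr)
    moreover have "h x * x powr (-p) + H x * (- p * x powr (- p - 1)) = (x * h x - p * H x) * x powr (- p - 1)"
      using x0 by (simp add: powr_diff algebra_simps)
    moreover have "\<dots> \<le> 0" using le[OF x0] by (intro mult_nonpos_nonneg) auto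
    ultimately show "\<exists>y. (\<phi> has_real_derivative y) (at x) \<and> y \<le> 0" by auto
  qed
  then have "H t * t powr (-p) \<le> H (\<kappa> * t) * \<kappa> powr (-p) * t powr (-p)"
    using l t by (simp add: \<phi>_def powr_mult mult_ac)
  then have "H t \<le> H (\<kappa> * t) * \<kappa> powr (-p)" using t by simp
  then have "\<kappa> powr p * H t \<le> \<kappa> powr p * (H (\<kappa> * t) * \<kappa> powr (-p))" by (rule mult_left_mono) simp
  then show ?thesis using l by (simp add: powr_minus field_simps)
qed

lemma scale_le_powr:
  fixes H h :: "real \<Rightarrow> real"
  assumes d: "\<And>t. 0 < t \<Longrightarrow> (H has_real_derivative h t) (at t)"
    and le: "\<And>t. 0 < t \<Longrightarrow> p * H t \<le> t * h t"
    and l: "0 < \<kappa>" "\<kappa> \<le> 1" and t: "0 < t"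
  shows "H (\<kappa> * t) \<le> \<kappa> powr p * H t"
  using scale_ge_powr[of "\<lambda>t. - H t" "\<lambda>t. - h t" p \<kappa> t] assms
  by (auto intro!: derivative_eq_intros)

lemma interval_integral_has_derivative:
  fixes k :: "real \<Rightarrow> real"
  assumes "continuous_on UNIV k"
  shows "((\<lambda>u. LBINT y=0..ereal u. k y) has_real_derivative k t) (at t)"
proof -
  have "((\<lambda>u. LBINT y=ereal 0..ereal u. k y) has_vector_derivative k t) (at t within {-\<bar>t\<bar>-1..\<bar>t\<bar>+1})"
    by (rule interval_integral_FTC2) (use assms continuous_on_subset in auto)
  then show ?thesis
    by (subst (asm) at_within_interior) (auto simp: has_real_derivative_iff_has_vector_derivative zero_ereal_def)
qed

text \<open>The density \<open>k\<close> and its primitive \<open>G\<close> for one fixed pair \<open>(x, y)\<close>.\<close>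

locale N_function =
  fixes k G :: "real \<Rightarrow> real" and gm gp :: real
  assumes G_eq: "\<And>t. G t = (LBINT \<tau>=0..ereal \<bar>t\<bar>. k \<tau>)"
    and nonneg: "\<And>t. t \<ge> 0 \<Longrightarrow> k t \<ge> 0"
    and odd: "\<And>t. k (- t) = - k t"
    and lim0: "(k \<longlongrightarrow> 0) (at_right 0)"
    and diff: "k differentiable_on {0<..}"
    and mono_pos: "mono_on {0<..} k"
    and gm: "1 < gm"
    and bounds: "\<And>t. t > 0 \<Longrightarrow> gm \<le> k t * t / G t \<and> k t * t / G t \<le> gp"
    and deriv_bound: "\<And>t. t > 0 \<Longrightarrow> deriv k t * t / k t \<le> gp - 1"
begin

lemma k0: "k 0 = 0" using odd[of 0] by simp

lemma mono: "mono k"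
proof (rule monoI)
  fix x y :: real assume xy: "x \<le> y"
  have pos: "k x \<le> k y" if "0 \<le> x" "x \<le> y" for x y
  proof (cases "x = 0")
    case True then show ?thesis using nonneg that k0 by auto
  next
    case False then show ?thesis using mono_onD[OF mono_pos, of x y] that by auto
  qed
  consider "0 \<le> x" | "y \<le> 0" | "x \<le> 0" "0 \<le> y" using xy by linarith
  then show "k x \<le> k y"
  proof cases
    case 1 then show ?thesis using pos xy by blast
  next
    case 2 then show ?thesis using pos[of "-y" "-x"] xy odd by auto
  next
    case 3 then show ?thesis using nonneg[of y] nonneg[of "-x"] odd[of x] by auto
  qed
qed

lemma cont: "continuous_on UNIV k"
proof -
  have pos: "isCont k t" if "t > 0" for t
    using differentiable_imp_continuous_on[OF diff] that
    by (simp add: continuous_on_eq_continuous_at)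
  have neg: "isCont k t" if "t < 0" for t
  proof -
    have "isCont (\<lambda>s. - k (- s)) t"
      by (intro continuous_minus isCont_o2[of t uminus]) (use pos[of "-t"] that in auto)
    moreover have "(\<lambda>s. - k (- s)) = k" using odd by auto
    ultimately show ?thesis by simp
  qed
  have "(k \<longlongrightarrow> 0) (at_left 0)"
  proof -
    have "((\<lambda>s. - k (- s)) \<longlongrightarrow> - 0) (at_left 0)"
      by (intro tendsto_minus filterlim_compose[OF lim0])
        (simp add: filterlim_at_right_to_0 filterlim_def at_right_minus filtermap_filtermap)
    moreover have "(\<lambda>s. - k (- s)) = k" using odd by auto
    ultimately show ?thesis by simp
  qed
  then have "isCont k 0" using lim0 by (simp add: isCont_def k0 filterlim_split_at)
  then show ?thesis using pos neg
    by (metis continuous_at_imp_continuous_on linorder_neqE_linordered_idom)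
qed

lemma G_deriv: "(G has_real_derivative k t) (at t)" if "0 < t"
proof (rule has_field_derivative_transform_within_open[where S = "{0<..}"])
  show "((\<lambda>u. LBINT y=0..ereal u. k y) has_real_derivative k t) (at t)"
    by (rule interval_integral_has_derivative[OF cont])
qed (use that in \<open>auto simp: G_eq\<close>)

lemma G0: "G 0 = 0" by (simp add: G_eq zero_ereal_def)
lemma G_abs: "G \<bar>t\<bar> = G t" by (simp add: G_eq)

lemma G_nonneg: "0 \<le> G t"
proof -
  have "0 \<le> (LBINT \<tau>:{0..\<bar>t\<bar>}. k \<tau>)"
    unfolding set_lebesgue_integral_def
    by (intro Bochner_Integration.integral_nonneg) (auto intro: nonneg simp: indicator_def)
  then show ?thesis unfolding G_eq using interval_integral_Icc[of 0 "\<bar>t\<bar>" k] by (simp add: zero_ereal_def)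
qed

text \<open>A quotient with denominator \<open>0\<close> is \<open>0\<close> and would violate the lower bound \<open>gm > 1\<close>.\<close>

lemma G_pos: "0 < G t" if "t \<noteq> 0"
proof -
  have "G \<bar>t\<bar> \<noteq> 0" using bounds[of "\<bar>t\<bar>"] gm that by auto
  then show ?thesis using G_nonneg[of t] by (simp add: G_abs)
qed

lemma k_abs: "k \<bar>t\<bar> * \<bar>t\<bar> = k t * t"
  using odd[of t] by (cases "t \<ge> 0") auto

lemma kt_nonneg: "0 \<le> k t * t"
  using k_abs[of t] nonneg[of "\<bar>t\<bar>"] by (metis abs_ge_zero mult_nonneg_nonneg)

lemma kt_bounds: "gm * G t \<le> k t * t" "k t * t \<le> gp * G t"
proof -
  have "gm * G \<bar>t\<bar> \<le> k \<bar>t\<bar> * \<bar>t\<bar> \<and> k \<bar>t\<bar> * \<bar>t\<bar> \<le> gp * G \<bar>t\<bar>"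
  proof (cases "t = 0")
    case False
    then show ?thesis using bounds[of "\<bar>t\<bar>"] G_pos[of "\<bar>t\<bar>"] by (simp add: field_simps)
  qed (simp add: G0)
  then show "gm * G t \<le> k t * t" "k t * t \<le> gp * G t" by (simp_all only: G_abs k_abs)
qed

text \<open>The two bounds on \<open>t k(t) / G(t)\<close>, integrated: \<open>G\<close> grows at least like the power \<open>gm\<close> and at
  most like the power \<open>gp\<close>.\<close>

lemma G_scale: "\<kappa> powr gp * G t \<le> G (\<kappa> * t)" "G (\<kappa> * t) \<le> \<kappa> powr gm * G t"
  if l: "0 < \<kappa>" "\<kappa> \<le> 1"
proof -
  have "\<kappa> powr gp * G \<bar>t\<bar> \<le> G (\<kappa> * \<bar>t\<bar>) \<and> G (\<kappa> * \<bar>t\<bar>) \<le> \<kappa> powr gm * G \<bar>t\<bar>"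
  proof (cases "t = 0")
    case False
    show ?thesis
    proof (intro conjI scale_ge_powr[of G k] scale_le_powr[of G k])
    qed (use False l kt_bounds in \<open>auto intro: G_deriv simp: mult.commute\<close>)
  qed (simp add: G0)
  moreover have "G (\<kappa> * \<bar>t\<bar>) = G (\<kappa> * t)" using G_abs[of "\<kappa> * t"] l by (simp add: abs_mult)
  ultimately show "\<kappa> powr gp * G t \<le> G (\<kappa> * t)" "G (\<kappa> * t) \<le> \<kappa> powr gm * G t" by (simp_all add: G_abs)
qed

lemma G_mono: "G s \<le> G t" if "\<bar>s\<bar> \<le> \<bar>t\<bar>"
proof -
  have "G \<bar>s\<bar> \<le> G \<bar>t\<bar>"
  proof (cases "s = 0")
    case True then show ?thesis using G_nonneg by (simp add: G0)
  next
    case False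
    show ?thesis
    proof (rule DERIV_nonneg_imp_nondecreasing[OF that])
      fix x assume "\<bar>s\<bar> \<le> x"
      then show "\<exists>y. (G has_real_derivative y) (at x) \<and> y \<ge> 0"
        using False G_deriv[of x] nonneg[of x] by (intro exI[of _ "k x"]) auto
    qed
  qed
  then show ?thesis by (simp add: G_abs)
qed

lemma G_dilate: "G (c * t) \<le> c powr gp * G t" if "1 \<le> c"
proof -
  have "(1 / c) powr gp * G (c * t) \<le> G ((1/c) * (c * t))"
    by (rule G_scale) (use that in auto)
  then show ?thesis using that by (simp add: powr_divide field_simps)
qed

lemma G_contract: "G (t / c) \<le> G t / c" if "1 \<le> c"
proof -
  have "G (t/c) \<le> (1 / c) powr gm * G t" using G_scale(2)[of "1/c" t] that by simp
  also have "(1/c) powr gm \<le> (1/c) powr 1" using that gm by (intro powr_mono') auto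
  finally show ?thesis using G_nonneg[of t] that by (simp add: mult_right_mono field_simps)
qed

lemma G_add: "G (a + b) \<le> 2 powr gp * (G a + G b)"
proof -
  define m where "m = max \<bar>a\<bar> \<bar>b\<bar>"
  have "G (a + b) \<le> G (2 * m)" by (rule G_mono) (auto simp: m_def)
  also have "\<dots> \<le> 2 powr gp * G m" by (rule G_dilate) simp
  also have "G m \<le> G a + G b" using G_nonneg[of a] G_nonneg[of b] by (auto simp: m_def max_def G_abs)
  finally show ?thesis by (simp add: mult_left_mono)
qed

lemma young_self: "\<bar>k a * b\<bar> \<le> \<epsilon> * (k a * a) + k (b / \<epsilon>) * b" if "0 < \<epsilon>"
  using mono_mult_young[OF mono k0 that, of a b] mono_mult_young[OF mono k0 that, of a "-b"] odd[of "b/\<epsilon>"]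
  by (simp add: abs_le_iff)

text \<open>Since \<open>gm > 1\<close>, the factor in front of \<open>G b\<close> tends to \<open>0\<close> with \<open>\<epsilon>\<close>. A family of functions
  \<open>b\<close> with bounded modulars is therefore uniformly integrable against a fixed \<open>k a\<close>.\<close>

lemma young_small: "\<bar>k a * b\<bar> \<le> (k a * a) / \<epsilon> + gp * \<epsilon> powr (gm - 1) * G b" if e: "0 < \<epsilon>" "\<epsilon> \<le> 1"
proof -
  have "\<bar>k a * b\<bar> \<le> (1/\<epsilon>) * (k a * a) + k (b / (1/\<epsilon>)) * b"
    by (rule young_self) (use e in simp)
  also have "k (b / (1/\<epsilon>)) * b = (k (\<epsilon> * b) * (\<epsilon> * b)) / \<epsilon>" using e by (simp add: mult.commute)
  also have "\<dots> \<le> gp * G (\<epsilon> * b) / \<epsilon>" using kt_bounds(2)[of "\<epsilon> * b"] e by (intro divide_right_mono) auto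
  also have "\<dots> \<le> gp * (\<epsilon> powr gm * G b) / \<epsilon>"
  proof -
    have "gp \<ge> 0" using bounds[of 1] gm by auto
    then show ?thesis using G_scale(2)[OF e, of b] e by (intro divide_right_mono mult_left_mono) auto
  qed
  also have "\<dots> = gp * \<epsilon> powr (gm - 1) * G b" using e by (simp add: powr_diff)
  finally show ?thesis by simp
qed

text \<open>The derivative of \<open>\<alpha> G(t) - t k(t)\<close> is \<open>(\<alpha> - 1) k - t k'\<close>, and \<open>t k' \<le> (gp - 1) k\<close>.\<close>

lemma defect_mono:
  assumes \<alpha>: "gp \<le> \<alpha>" and l: "0 < \<kappa>" "\<kappa> \<le> 1"
  shows "\<alpha> * G (\<kappa> * t) - k (\<kappa> * t) * (\<kappa> * t) \<le> \<alpha> * G t - k t * t"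
proof -
  have pos: "\<alpha> * G s - k s * s \<le> \<alpha> * G t - k t * t" if st: "0 < s" "s \<le> t" for s t
  proof (rule DERIV_nonneg_imp_nondecreasing[OF st(2)])
    fix x assume x: "s \<le> x" "x \<le> t"
    then have x0: "x > 0" using st by simp
    have dk: "(k has_real_derivative deriv k x) (at x)"
      using diff x0 by (simp add: differentiable_on_eq_differentiable_at DERIV_deriv_iff_real_differentiable)
    have "((\<lambda>s. \<alpha> * G s - k s * s) has_real_derivative (\<alpha> * k x - (deriv k x * x + k x))) (at x)"
      by (auto intro!: derivative_eq_intros dk G_deriv x0)
    moreover have "k x > 0"
      using kt_bounds(1)[of x] G_pos[of x] x0 gm
      by (metis less_le_trans mult_pos_pos zero_less_mult_pos2 order.strict_trans zero_less_one less_irrefl)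
    then have "deriv k x * x \<le> (gp - 1) * k x" using deriv_bound[OF x0] by (simp add: field_simps)
    then have "\<alpha> * k x - (deriv k x * x + k x) \<ge> 0"
    proof -
      have "gp * k x \<le> \<alpha> * k x" using \<alpha> \<open>k x > 0\<close> by (intro mult_right_mono) auto
      moreover have "(gp - 1) * k x = gp * k x - k x" by (simp add: algebra_simps)
      ultimately show ?thesis using \<open>deriv k x * x \<le> (gp - 1) * k x\<close> by linarith
    qed
    ultimately show "\<exists>y. ((\<lambda>s. \<alpha> * G s - k s * s) has_real_derivative y) (at x) \<and> y \<ge> 0" by blast
  qed
  have "\<alpha> * G (\<kappa> * \<bar>t\<bar>) - k (\<kappa> * \<bar>t\<bar>) * (\<kappa> * \<bar>t\<bar>) \<le> \<alpha> * G \<bar>t\<bar> - k \<bar>t\<bar> * \<bar>t\<bar>"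
  proof (cases "t = 0")
    case False
    then show ?thesis using pos[of "\<kappa> * \<bar>t\<bar>" "\<bar>t\<bar>"] l by (simp add: mult_left_le_one_le)
  qed simp
  moreover have "G (\<kappa> * \<bar>t\<bar>) = G (\<kappa> * t)" "k (\<kappa> * \<bar>t\<bar>) * (\<kappa> * \<bar>t\<bar>) = k (\<kappa> * t) * (\<kappa> * t)"
    using G_abs[of "\<kappa> * t"] k_abs[of "\<kappa> * t"] l by (simp_all add: abs_mult)
  ultimately show ?thesis by (simp only: G_abs k_abs)
qed

lemma kt_mono: "k (\<kappa> * t) * (\<kappa> * t) \<le> k t * t" "0 \<le> k (\<kappa> * t) * (\<kappa> * t)" if l: "0 < \<kappa>" "\<kappa> \<le> 1"
proof -
  have "k (\<kappa> * \<bar>t\<bar>) * (\<kappa> * \<bar>t\<bar>) \<le> k \<bar>t\<bar> * \<bar>t\<bar>"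
    using l by (intro mult_mono monoD[OF mono] nonneg) (auto simp: mult_left_le_one_le)
  moreover have "k (\<kappa> * \<bar>t\<bar>) * (\<kappa> * \<bar>t\<bar>) = k (\<kappa> * t) * (\<kappa> * t)"
    using k_abs[of "\<kappa> * t"] l by (simp add: abs_mult)
  ultimately show "k (\<kappa> * t) * (\<kappa> * t) \<le> k t * t" by (simp only: k_abs)
qed (rule kt_nonneg)

lemma G_cont: "continuous_on UNIV G"
proof -
  have "continuous_on UNIV (\<lambda>u. LBINT y=0..ereal u. k y)"
    by (intro DERIV_continuous_on[of UNIV]) (use interval_integral_has_derivative[OF cont] in auto)
  then have "continuous_on UNIV ((\<lambda>u. LBINT y=0..ereal u. k y) \<circ> abs)"
    by (intro continuous_on_compose continuous_intros) (auto intro: continuous_on_subset)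
  then show ?thesis by (simp add: o_def G_eq[abs_def])
qed

end

text \<open>The source at one fixed point \<open>x\<close>, with primitive \<open>F\<close>, derivative \<open>df\<close> and growth exponents
  between \<open>p\<close> and \<open>q\<close>.\<close>

locale source_term =
  fixes f F df :: "real \<Rightarrow> real" and p q \<alpha> :: real
  assumes f_deriv: "\<And>t. (f has_real_derivative df t) (at t)"
    and F_deriv: "\<And>t. (F has_real_derivative f t) (at t)"
    and zero: "F 0 = 0" "f 0 = 0" "df 0 = 0"
    and conv: "convex_on {0<..} f" "convex_on {0<..} (\<lambda>t. - f (- t))"
    and p: "1 < p"
    and bounds: "\<And>t. p * F t \<le> t * f t" "\<And>t. t * f t \<le> q * F t"
    and superlin: "\<And>t. t \<noteq> 0 \<Longrightarrow> 0 < t * (df t * t - (\<alpha> - 1) * f t)"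
    and \<alpha>: "2 < \<alpha>"
begin

text \<open>Estimates are proved for positive arguments and carried over to negative ones by this symmetry.
  A source need not be odd, and the values for both signs are unrelated.\<close>

lemma reflect: "source_term (\<lambda>t. - f (- t)) (\<lambda>t. F (- t)) (\<lambda>t. df (- t)) p q \<alpha>"
proof
  show "((\<lambda>t. - f (- t)) has_real_derivative df (- t)) (at t)" for t
    using DERIV_minus[OF DERIV_chain2[OF f_deriv[of "-t"] DERIV_minus[OF DERIV_ident]]] by simp
  show "((\<lambda>t. F (- t)) has_real_derivative - f (- t)) (at t)" for t
    using DERIV_chain2[OF F_deriv[of "-t"] DERIV_minus[OF DERIV_ident]] by simp
  show "0 < t * (df (- t) * t - (\<alpha> - 1) * (- f (- t)))" if "t \<noteq> 0" for t
    using superlin[of "-t"] that by (simp add: algebra_simps)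
  show "p * F (- t) \<le> t * (- f (- t))" for t using bounds(1)[of "-t"] by simp
  show "t * (- f (- t)) \<le> q * F (- t)" for t using bounds(2)[of "-t"] by simp
qed (use zero conv p \<alpha> in auto)

lemma f_cont: "continuous_on UNIV f"
  using f_deriv by (meson DERIV_continuous_on DERIV_subset UNIV_I subset_UNIV)

text \<open>Convexity and \<open>f 0 = 0\<close> make \<open>f h / h\<close> nondecreasing, and its limit at \<open>0\<close> is \<open>df 0 = 0\<close>.\<close>

lemma f_nonneg: "0 \<le> f t" if t: "0 \<le> t"
proof (cases "t = 0")
  case False
  then have t: "t > 0" using that by simp
  have lin: "f (\<theta> * t) \<le> \<theta> * f t" if \<theta>: "0 < \<theta>" "\<theta> < 1" for \<theta>
  proof (rule tendsto_le[of "at_right 0"])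
    have c: "isCont f x" for x using f_deriv DERIV_isCont by blast
    have "isCont (\<lambda>e. f ((1 - \<theta>) * e + \<theta> * t)) 0" "isCont (\<lambda>e. (1 - \<theta>) * f e + \<theta> * f t) 0"
      by (auto intro!: continuous_intros isCont_o2[of _ _ f] c)
    then show "((\<lambda>e. f ((1 - \<theta>) * e + \<theta> * t)) \<longlongrightarrow> f (\<theta> * t)) (at_right 0)"
      "((\<lambda>e. (1 - \<theta>) * f e + \<theta> * f t) \<longlongrightarrow> \<theta> * f t) (at_right 0)"
      by (auto simp: isCont_def zero intro: tendsto_within_subset)
    show "\<forall>\<^sub>F e in at_right 0. f ((1 - \<theta>) * e + \<theta> * t) \<le> (1 - \<theta>) * f e + \<theta> * f t"
      using eventually_at_right_less
    proof eventually_elim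
      fix e :: real assume "0 < e"
      then show "f ((1 - \<theta>) * e + \<theta> * t) \<le> (1 - \<theta>) * f e + \<theta> * f t"
        using convex_onD[OF conv(1), of \<theta> e t] \<theta> t by simp
    qed
  qed simp
  have "((\<lambda>h. (f (0 + h) - f 0) / h) \<longlongrightarrow> df 0) (at 0)" using f_deriv[of 0] by (simp add: DERIV_def)
  then have lim: "((\<lambda>h. f h / h) \<longlongrightarrow> 0) (at_right 0)"
    by (auto simp: zero intro: tendsto_within_subset)
  have "0 \<le> f t / t"
  proof (rule tendsto_upperbound[OF lim])
    have "\<forall>\<^sub>F h in at_right 0. h \<in> {0<..<t}" using t by (rule eventually_at_right_real)
    then show "\<forall>\<^sub>F h in at_right 0. f h / h \<le> f t / t"
    proof eventually_elim
      fix h assume h: "h \<in> {0<..<t}"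
      then show "f h / h \<le> f t / t" using lin[of "h/t"] t by (simp add: field_simps)
    qed
  qed simp
  then show ?thesis using t by (simp add: zero_le_divide_iff)
qed (simp add: zero)

lemma f_nonpos: "f t \<le> 0" if "t \<le> 0"
  using source_term.f_nonneg[OF reflect, of "-t"] that by simp

lemma ft_nonneg: "0 \<le> f t * t"
  using f_nonneg[of t] f_nonpos[of t] by (cases "t \<ge> 0") (auto simp: mult_nonpos_nonpos)

text \<open>Superlinearity bounds \<open>t * df t\<close> by \<open>(\<alpha> - 1) * f t\<close>, whose sign is known.\<close>

lemma df_nonneg: "0 \<le> df t"
proof (cases t "0::real" rule: linorder_cases)
  case less
  have "(\<alpha> - 1) * f t \<le> 0" using f_nonpos[of t] \<alpha> less by (simp add: mult_nonneg_nonpos)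
  moreover have "df t * t - (\<alpha> - 1) * f t < 0" using superlin[of t] less by (simp add: zero_less_mult_iff)
  ultimately have "df t * t \<le> 0" by linarith
  then show ?thesis using less by (simp add: mult_le_0_iff)
next
  case greater
  have "(\<alpha> - 1) * f t \<ge> 0" using f_nonneg[of t] \<alpha> greater by simp
  moreover have "df t * t - (\<alpha> - 1) * f t > 0" using superlin[of t] greater by (simp add: zero_less_mult_iff)
  ultimately have "df t * t \<ge> 0" by linarith
  then show ?thesis using greater by (simp add: zero_le_mult_iff)
qed (simp add: zero)

lemma mono: "mono f"
  by (rule monoI, rule DERIV_nonneg_imp_nondecreasing) (use f_deriv df_nonneg in blast)+

lemma F_nonneg: "0 \<le> F t"
proof -
  have *: "F 0 \<le> F t" if "0 \<le> t" and F: "\<And>t. (F has_real_derivative f t) (at t)"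
    and f: "\<And>t. 0 \<le> t \<Longrightarrow> 0 \<le> f t" for f F :: "real \<Rightarrow> real" and t
    by (rule DERIV_nonneg_imp_nondecreasing[OF that(1)]) (use F f in blast)
  show ?thesis
  proof (cases "t \<ge> 0")
    case True then show ?thesis using *[OF True F_deriv f_nonneg] zero by simp
  next
    case False
    interpret r: source_term "\<lambda>t. - f (- t)" "\<lambda>t. F (- t)" "\<lambda>t. df (- t)" p q \<alpha> by (rule reflect)
    show ?thesis using *[OF _ r.F_deriv r.f_nonneg, of "-t"] False zero by simp
  qed
qed

lemma F_scale: "F (\<kappa> * t) \<le> \<kappa> powr p * F t" if l: "0 < \<kappa>" "\<kappa> \<le> 1"
proof (cases t "0::real" rule: linorder_cases)
  case less
  interpret r: source_term "\<lambda>t. - f (- t)" "\<lambda>t. F (- t)" "\<lambda>t. df (- t)" p q \<alpha> by (rule reflect)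
  show ?thesis
    using scale_le_powr[OF r.F_deriv r.bounds(1) l, of "-t"] less by simp
next
  case greater
  show ?thesis using scale_le_powr[OF F_deriv bounds(1) l greater] .
qed (simp add: zero)

lemma F_dilate: "F (c * t) \<le> c powr q * F t" if c: "1 \<le> c"
proof -
  have "(1/c) powr q * F (c * t) \<le> F ((1/c) * (c * t))"
  proof (cases t "0::real" rule: linorder_cases)
    case less
    interpret r: source_term "\<lambda>t. - f (- t)" "\<lambda>t. F (- t)" "\<lambda>t. df (- t)" p q \<alpha> by (rule reflect)
    show ?thesis
      using scale_ge_powr[OF r.F_deriv r.bounds(2), of "1/c" "-(c * t)"] less c by (simp add: mult_pos_neg)
  next
    case greater
    show ?thesis using scale_ge_powr[OF F_deriv bounds(2), of "1/c" "c * t"] greater c by simp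
  qed (simp add: zero)
  then show ?thesis using c by (simp add: powr_divide field_simps)
qed

text \<open>The derivative of \<open>t f(t) - \<alpha> F(t)\<close> is \<open>t f'(t) - (\<alpha> - 1) f(t)\<close>, which has the sign of \<open>t\<close>.\<close>

lemma defect_mono:
  assumes l: "0 \<le> \<kappa>" "\<kappa> \<le> 1"
  shows "f (\<kappa> * t) * (\<kappa> * t) - \<alpha> * F (\<kappa> * t) \<le> f t * t - \<alpha> * F t"
proof -
  have *: "f (\<kappa> * t) * (\<kappa> * t) - \<alpha> * F (\<kappa> * t) \<le> f t * t - \<alpha> * F t"
    if "0 < t" "source_term f F df p q \<alpha>" for f F df t
  proof -
    interpret r: source_term f F df p q \<alpha> by fact
    show ?thesis
    proof (rule DERIV_nonneg_imp_nondecreasing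
        [where a = "\<kappa> * t" and b = t and f = "\<lambda>s. f s * s - \<alpha> * F s"])
      show "\<kappa> * t \<le> t" using l that by simp
      fix x assume x: "\<kappa> * t \<le> x" "x \<le> t"
      have x0: "x \<ge> 0" using x l that by (meson mult_nonneg_nonneg order.trans less_imp_le)
      have "((\<lambda>s. f s * s - \<alpha> * F s) has_real_derivative (df x * x + f x - \<alpha> * f x)) (at x)"
        by (auto intro!: derivative_eq_intros r.f_deriv r.F_deriv)
      moreover have "df x * x + f x - \<alpha> * f x \<ge> 0"
      proof (cases "x = 0")
        case False
        then have "df x * x - (\<alpha> - 1) * f x > 0" using r.superlin[of x] x0 by (simp add: zero_less_mult_iff)
        then show ?thesis by (simp add: algebra_simps)
      qed (simp add: r.zero)
      ultimately show "\<exists>y. ((\<lambda>s. f s * s - \<alpha> * F s) has_real_derivative y) (at x) \<and> y \<ge> 0" by blast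
    qed
  qed
  show ?thesis
  proof (cases t "0::real" rule: linorder_cases)
    case less show ?thesis using *[OF _ reflect, of "-t"] less by simp
  next
    case greater show ?thesis using *[OF greater source_term_axioms] .
  qed (simp add: zero)
qed

lemma defect_nonneg: "0 \<le> f t * t - \<alpha> * F t"
  using defect_mono[of 0 t] by (simp add: zero)

lemma ft_mono: "f (\<kappa> * t) * (\<kappa> * t) \<le> f t * t" if l: "0 \<le> \<kappa>" "\<kappa> \<le> 1"
proof (cases "t \<ge> 0")
  case True
  then show ?thesis using l by (intro mult_mono monoD[OF mono] f_nonneg) (auto simp: mult_left_le_one_le)
next
  case False
  then have "t \<le> \<kappa> * t" using l mult_right_mono_neg[of \<kappa> 1 t] by simp
  then have "(- f (\<kappa> * t)) * (- (\<kappa> * t)) \<le> (- f t) * (- t)"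
    using l False by (intro mult_mono) (auto intro: monoD[OF mono] f_nonpos simp: mult_nonneg_nonpos)
  then show ?thesis by simp
qed

end

section \<open>Measure theory and square-integrable functions\<close>

lemma tendsto_if_dist_le_inverse:
  fixes X :: "nat \<Rightarrow> real"
  assumes "\<And>n. \<bar>X n - l\<bar> \<le> 1 / real (Suc n)"
  shows "X \<longlonglongrightarrow> l"
proof -
  have "(\<lambda>n. X n - l) \<longlonglongrightarrow> 0"
    by (rule Lim_null_comparison[OF _ LIMSEQ_Suc[OF lim_1_over_n]])
      (use assms in \<open>auto intro!: always_eventually\<close>)
  then show ?thesis by (simp add: LIM_zero_iff)
qed

text \<open>The function \<open>w\<close> is a limit of functions with countably many values, and for those the claim
  holds value by value.\<close>

lemma caratheodory_measurable:
  fixes k :: "'b \<Rightarrow> real \<Rightarrow> real"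
  assumes k: "\<And>t. (\<lambda>z. k z t) \<in> borel_measurable M"
    and cont: "\<And>z. z \<in> space M \<Longrightarrow> continuous_on UNIV (k z)"
    and w: "w \<in> borel_measurable M"
  shows "(\<lambda>z. k z (w z)) \<in> borel_measurable M"
proof (rule borel_measurable_LIMSEQ_real)
  define wn where "wn n z = real_of_int \<lfloor>real (Suc n) * w z\<rfloor> / real (Suc n)" for n z
  show "(\<lambda>n. k z (wn n z)) \<longlonglongrightarrow> k z (w z)" if z: "z \<in> space M" for z
  proof -
    have close: "\<bar>wn n z - w z\<bar> \<le> 1 / real (Suc n)" for n
    proof -
      have "real (Suc n) * w z - 1 < real_of_int \<lfloor>real (Suc n) * w z\<rfloor>"
        "real_of_int \<lfloor>real (Suc n) * w z\<rfloor> \<le> real (Suc n) * w z" by linarith+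
      then have "real (Suc n) * wn n z \<le> real (Suc n) * w z"
        "real (Suc n) * (w z - wn n z) \<le> real (Suc n) * (1 / real (Suc n))"
        unfolding wn_def right_diff_distrib by (simp_all del: of_nat_Suc) linarith
      then have "wn n z \<le> w z" "w z - wn n z \<le> 1 / real (Suc n)"
        by (simp_all only: mult_le_cancel_left_pos[OF of_nat_0_less_iff[THEN iffD2, OF zero_less_Suc]])
      then show ?thesis by auto
    qed
    then have "(\<lambda>n. wn n z) \<longlonglongrightarrow> w z" by (rule tendsto_if_dist_le_inverse)
    then show ?thesis
      by (rule isCont_tendsto_compose[rotated]) (use cont[OF z] in \<open>simp add: continuous_on_eq_continuous_at\<close>)
  qed
  show "(\<lambda>z. k z (wn n z)) \<in> borel_measurable M" for n
  proof -
    have "(\<lambda>z. (\<lambda>i z. k z (real_of_int i / real (Suc n))) \<lfloor>real (Suc n) * w z\<rfloor> z) \<in> borel_measurable M"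
      by (rule measurable_compose_countable) (use k w in measurable)
    then show ?thesis by (simp add: wn_def)
  qed
qed

text \<open>A reverse Fatou lemma in which domination by \<open>H\<close> is only required up to \<open>\<epsilon>\<close> times functions
  that are bounded in mean. The ordinary Fatou lemma is applied to \<open>H - min (z n) H\<close>.\<close>

lemma integral_limsup_le:
  fixes z :: "nat \<Rightarrow> 'b \<Rightarrow> real"
  assumes int: "\<And>n. integrable M (z n)" "integrable M z'" "\<And>n. integrable M (e n)"
    and lim: "AE x in M. (\<lambda>n. z n x) \<longlonglongrightarrow> z' x"
    and bnd: "\<And>\<epsilon>. 0 < \<epsilon> \<Longrightarrow> \<exists>H. integrable M H \<and> (\<forall>n. AE x in M. z n x \<le> H x + \<epsilon> * e n x)"
    and e: "\<And>n. AE x in M. 0 \<le> e n x" "\<And>n. integral\<^sup>L M (e n) \<le> C"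
    and \<delta>: "0 < \<delta>"
  shows "\<forall>\<^sub>F n in sequentially. integral\<^sup>L M (z n) \<le> integral\<^sup>L M z' + \<delta>"
proof -
  \<comment> \<open>\<open>C\<close> may be \<open>0\<close>, and a positive bound is needed as a divisor.\<close>
  define C' where "C' = max C 0 + 1"
  have C': "C' > 0" "\<And>n. integral\<^sup>L M (e n) \<le> C'" using e(2) by (auto simp: C'_def max_def intro: order_trans[OF e(2)])
  define \<epsilon> where "\<epsilon> = \<delta> / (4 * C')"
  have \<epsilon>: "\<epsilon> > 0" "\<epsilon> * C' \<le> \<delta> / 4" using \<delta> C' by (auto simp: \<epsilon>_def)
  obtain H where H: "integrable M H" "\<And>n. AE x in M. z n x \<le> H x + \<epsilon> * e n x"
    using bnd[OF \<epsilon>(1)] by blast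
  define y where "y n x = H x - min (z n x) (H x)" for n x
  define y' where "y' x = H x - min (z' x) (H x)" for x
  have iy: "integrable M (y n)" "integrable M y'" for n
    unfolding y_def y'_def using int H by auto
  have y0: "y n x \<ge> 0" "y' x \<ge> 0" for n x by (auto simp: y_def y'_def)
  have "(\<integral>\<^sup>+x. ennreal (y' x) \<partial>M) = (\<integral>\<^sup>+x. liminf (\<lambda>n. ennreal (y n x)) \<partial>M)"
  proof (rule nn_integral_cong_AE, use lim in eventually_elim)
    fix x assume "(\<lambda>n. z n x) \<longlonglongrightarrow> z' x"
    then have "(\<lambda>n. y n x) \<longlonglongrightarrow> y' x" unfolding y_def y'_def by (intro tendsto_intros)
    then have "(\<lambda>n. ennreal (y n x)) \<longlonglongrightarrow> ennreal (y' x)" by (rule tendsto_ennrealI)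
    then show "ennreal (y' x) = liminf (\<lambda>n. ennreal (y n x))"
      by (simp add: lim_imp_Liminf)
  qed
  also have "\<dots> \<le> liminf (\<lambda>n. \<integral>\<^sup>+x. ennreal (y n x) \<partial>M)"
    by (rule nn_integral_liminf) (use iy in auto)
  finally have *: "ennreal (integral\<^sup>L M y') \<le> liminf (\<lambda>n. ennreal (integral\<^sup>L M (y n)))"
    using iy y0 by (simp add: nn_integral_eq_integral)
  have "\<forall>\<^sub>F n in sequentially. integral\<^sup>L M y' - \<delta>/2 < integral\<^sup>L M (y n)"
  proof (cases "integral\<^sup>L M y' - \<delta>/2 \<ge> 0")
    case True
    have "ennreal (integral\<^sup>L M y' - \<delta>/2) < ennreal (integral\<^sup>L M y')"
      using True \<delta> by (intro ennreal_lessI) auto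
    also note *
    finally have "\<forall>\<^sub>F n in sequentially. ennreal (integral\<^sup>L M y' - \<delta>/2) < ennreal (integral\<^sup>L M (y n))"
      by (simp add: less_LiminfD)
    then show ?thesis by eventually_elim (use True in \<open>simp add: ennreal_less_iff\<close>)
  next
    case False
    have "integral\<^sup>L M y' - \<delta>/2 < integral\<^sup>L M (y n)" for n
      using False Bochner_Integration.integral_nonneg[OF y0(1), where ?M=M] by (meson less_le_trans not_le)
    then show ?thesis by simp
  qed
  then show ?thesis
  proof eventually_elim
    fix n assume a: "integral\<^sup>L M y' - \<delta>/2 < integral\<^sup>L M (y n)"
    have "AE x in M. z n x \<le> H x - y n x + \<epsilon> * e n x"
      using e(1)[of n] H(2)[of n]
    proof eventually_elim
      fix x assume "0 \<le> e n x" "z n x \<le> H x + \<epsilon> * e n x"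
      then show "z n x \<le> H x - y n x + \<epsilon> * e n x"
        using mult_nonneg_nonneg[of \<epsilon> "e n x"] \<epsilon> by (auto simp: y_def min_def)
    qed
    then have "integral\<^sup>L M (z n) \<le> integral\<^sup>L M (\<lambda>x. H x - y n x + \<epsilon> * e n x)"
      by (intro integral_mono_AE) (use int H iy in auto)
    also have "\<dots> = integral\<^sup>L M H - integral\<^sup>L M (y n) + \<epsilon> * integral\<^sup>L M (e n)"
      using int H iy by simp
    also have "\<dots> \<le> integral\<^sup>L M H - integral\<^sup>L M (y n) + \<delta>/4"
      using \<epsilon> C'(2)[of n] mult_left_mono[OF C'(2)[of n], of \<epsilon>] by linarith
    also have "\<dots> \<le> integral\<^sup>L M H - integral\<^sup>L M y' + \<delta>" using a \<delta> by linarith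
    also have "integral\<^sup>L M H - integral\<^sup>L M y' = integral\<^sup>L M (\<lambda>x. H x - y' x)"
      using H iy by simp
    also have "\<dots> \<le> integral\<^sup>L M z'"
      by (rule integral_mono) (use int H iy in \<open>auto simp: y'_def\<close>)
    finally show "integral\<^sup>L M (z n) \<le> integral\<^sup>L M z' + \<delta>" by linarith
  qed
qed

text \<open>This is a form of Vitali's theorem; the two one-sided estimates come from the functions and
  from their negatives.\<close>

lemma integral_tendsto_if_bounded:
  fixes z :: "nat \<Rightarrow> 'b \<Rightarrow> real"
  assumes int: "\<And>n. integrable M (z n)" "integrable M z'" "\<And>n. integrable M (e n)"
    and lim: "AE x in M. (\<lambda>n. z n x) \<longlonglongrightarrow> z' x"
    and bnd: "\<And>\<epsilon>. 0 < \<epsilon> \<Longrightarrow> \<exists>H. integrable M H \<and> (\<forall>n. AE x in M. \<bar>z n x\<bar> \<le> H x + \<epsilon> * e n x)"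
    and e: "\<And>n. AE x in M. 0 \<le> e n x" "\<And>n. integral\<^sup>L M (e n) \<le> C"
  shows "(\<lambda>n. integral\<^sup>L M (z n)) \<longlonglongrightarrow> integral\<^sup>L M z'"
proof (rule tendstoI)
  fix \<delta> :: real assume \<delta>: "0 < \<delta>"
  have b1: "\<exists>H. integrable M H \<and> (\<forall>n. AE x in M. z n x \<le> H x + \<epsilon> * e n x)" if \<epsilon>: "0 < \<epsilon>" for \<epsilon>
  proof -
    obtain H where H: "integrable M H" "\<And>n. AE x in M. \<bar>z n x\<bar> \<le> H x + \<epsilon> * e n x"
      using bnd[OF \<epsilon>] by blast
    have "AE x in M. z n x \<le> H x + \<epsilon> * e n x" for n using H(2)[of n] by eventually_elim linarith
    with H(1) show ?thesis by blast
  qed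
  have b2: "\<exists>H. integrable M H \<and> (\<forall>n. AE x in M. - z n x \<le> H x + \<epsilon> * e n x)" if \<epsilon>: "0 < \<epsilon>" for \<epsilon>
  proof -
    obtain H where H: "integrable M H" "\<And>n. AE x in M. \<bar>z n x\<bar> \<le> H x + \<epsilon> * e n x"
      using bnd[OF \<epsilon>] by blast
    have "AE x in M. - z n x \<le> H x + \<epsilon> * e n x" for n using H(2)[of n] by eventually_elim linarith
    with H(1) show ?thesis by blast
  qed
  have l2: "AE x in M. (\<lambda>n. - z n x) \<longlonglongrightarrow> - z' x"
    using lim by eventually_elim (rule tendsto_minus)
  have i2: "integrable M (\<lambda>x. - z n x)" "integrable M (\<lambda>x. - z' x)" for n using int by auto
  have \<delta>2: "0 < \<delta>/2" using \<delta> by simp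
  have "\<forall>\<^sub>F n in sequentially. integral\<^sup>L M (z n) \<le> integral\<^sup>L M z' + \<delta>/2"
    by (rule integral_limsup_le[OF int lim b1 e \<delta>2])
  moreover have "\<forall>\<^sub>F n in sequentially. integral\<^sup>L M (\<lambda>x. - z n x) \<le> integral\<^sup>L M (\<lambda>x. - z' x) + \<delta>/2"
    by (rule integral_limsup_le[OF i2 int(3) l2 b2 e \<delta>2])
  ultimately show "\<forall>\<^sub>F n in sequentially. dist (integral\<^sup>L M (z n)) (integral\<^sup>L M z') < \<delta>"
    by eventually_elim (use \<delta> in \<open>simp add: dist_real_def\<close>)
qed

lemma L2_spaceD:
  assumes "a \<in> L2_space \<Omega>"
  shows "a \<in> borel_measurable (lebesgue_on \<Omega>)" "integrable (lebesgue_on \<Omega>) (\<lambda>x. (a x)\<^sup>2)"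
  using assms by (auto simp: L2_space_def)

lemma L2_integrable_mult:
  assumes a: "a \<in> L2_space \<Omega>" and b: "b \<in> L2_space \<Omega>"
  shows "integrable (lebesgue_on \<Omega>) (\<lambda>x. a x * b x)"
proof (rule Bochner_Integration.integrable_bound)
  show "integrable (lebesgue_on \<Omega>) (\<lambda>x. (a x)\<^sup>2 + (b x)\<^sup>2)"
    using L2_spaceD[OF a] L2_spaceD[OF b] by simp
  show "(\<lambda>x. a x * b x) \<in> borel_measurable (lebesgue_on \<Omega>)"
    using L2_spaceD[OF a] L2_spaceD[OF b] by measurable
  have "\<bar>p * q\<bar> \<le> p\<^sup>2 + q\<^sup>2" for p q :: real
  proof -
    have "0 \<le> (\<bar>p\<bar> - \<bar>q\<bar>)\<^sup>2" "0 \<le> p\<^sup>2" "0 \<le> q\<^sup>2" by auto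
    moreover have "0 \<le> \<bar>p\<bar> * \<bar>q\<bar>" by simp
    ultimately show ?thesis by (simp only: power2_diff power2_abs abs_mult)
  qed
  then show "AE x in lebesgue_on \<Omega>. norm (a x * b x) \<le> norm ((a x)\<^sup>2 + (b x)\<^sup>2)" by simp
qed

lemma L2_space_lincomb:
  assumes a: "a \<in> L2_space \<Omega>" and b: "b \<in> L2_space \<Omega>"
  shows "(\<lambda>x. p * a x + q * b x) \<in> L2_space \<Omega>"
proof -
  have "integrable (lebesgue_on \<Omega>) (\<lambda>x. p\<^sup>2 * (a x)\<^sup>2 + 2 * p * q * (a x * b x) + q\<^sup>2 * (b x)\<^sup>2)"
    using L2_spaceD[OF a] L2_spaceD[OF b] L2_integrable_mult[OF a b] by simp
  moreover have "(\<lambda>x. p\<^sup>2 * (a x)\<^sup>2 + 2 * p * q * (a x * b x) + q\<^sup>2 * (b x)\<^sup>2) = (\<lambda>x. (p * a x + q * b x)\<^sup>2)"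
    by (simp add: fun_eq_iff power2_eq_square algebra_simps)
  ultimately show ?thesis using L2_spaceD[OF a] L2_spaceD[OF b] by (simp add: L2_space_def)
qed

lemma L2_space_diff: "a \<in> L2_space \<Omega> \<Longrightarrow> b \<in> L2_space \<Omega> \<Longrightarrow> (\<lambda>x. a x - b x) \<in> L2_space \<Omega>"
  using L2_space_lincomb[of a \<Omega> b 1 "-1"] by simp

lemma L2_space_add: "a \<in> L2_space \<Omega> \<Longrightarrow> b \<in> L2_space \<Omega> \<Longrightarrow> (\<lambda>x. a x + b x) \<in> L2_space \<Omega>"
  using L2_space_lincomb[of a \<Omega> b 1 1] by simp

lemma L2_norm_nonneg: "0 \<le> L2_norm \<Omega> a"
  by (auto simp: L2_norm_def intro!: integral_nonneg)

lemma L2_norm_sq: "(L2_norm \<Omega> a)\<^sup>2 = (LINT x|lebesgue_on \<Omega>. (a x)\<^sup>2)"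
  by (auto simp: L2_norm_def intro!: integral_nonneg)

text \<open>The inequality \<open>2 p q \<le> \<epsilon> p\<^sup>2 + q\<^sup>2 / \<epsilon>\<close>, integrated. The form with \<open>\<epsilon>\<close> also replaces the
  Cauchy--Schwarz inequality in time.\<close>

lemma L2_young:
  assumes a: "a \<in> L2_space \<Omega>" and b: "b \<in> L2_space \<Omega>" and \<epsilon>: "0 < \<epsilon>"
  shows "2 * (LINT x|lebesgue_on \<Omega>. a x * b x) \<le> \<epsilon> * (L2_norm \<Omega> a)\<^sup>2 + (L2_norm \<Omega> b)\<^sup>2 / \<epsilon>"
proof -
  have "2 * (p * q) \<le> \<epsilon> * p\<^sup>2 + q\<^sup>2 / \<epsilon>" for p q :: real
  proof -
    have "0 \<le> (\<epsilon> * p - q)\<^sup>2 / \<epsilon>" using \<epsilon> by simp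
    also have "\<dots> = \<epsilon> * p\<^sup>2 + q\<^sup>2 / \<epsilon> - 2 * (p * q)" using \<epsilon> by (simp add: power2_eq_square field_simps)
    finally show ?thesis by simp
  qed
  then have "(LINT x|lebesgue_on \<Omega>. 2 * (a x * b x)) \<le> (LINT x|lebesgue_on \<Omega>. \<epsilon> * (a x)\<^sup>2 + (b x)\<^sup>2 / \<epsilon>)"
    using L2_spaceD[OF a] L2_spaceD[OF b] L2_integrable_mult[OF a b]
    by (intro integral_mono) auto
  then show ?thesis
    using L2_spaceD[OF a] L2_spaceD[OF b] L2_integrable_mult[OF a b] by (simp add: L2_norm_sq)
qed

lemma L2_Cauchy_Schwarz:
  assumes a: "a \<in> L2_space \<Omega>" and b: "b \<in> L2_space \<Omega>"
  shows "\<bar>LINT x|lebesgue_on \<Omega>. a x * b x\<bar> \<le> L2_norm \<Omega> a * L2_norm \<Omega> b"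
proof -
  have *: "(LINT x|lebesgue_on \<Omega>. a x * b x) \<le> L2_norm \<Omega> a * L2_norm \<Omega> b"
    if a: "a \<in> L2_space \<Omega>" and b: "b \<in> L2_space \<Omega>" for a b
  proof (rule field_le_epsilon)
    fix e :: real assume e: "0 < e"
    define p q where "p = L2_norm \<Omega> a" and "q = L2_norm \<Omega> b"
    have pq: "p \<ge> 0" "q \<ge> 0" by (simp_all add: p_def q_def L2_norm_nonneg)
    define d where "d = e / (p + q + 1)"
    have d: "d > 0" using e pq by (simp add: d_def)
    \<comment> \<open>The optimal choice in Young's inequality is \<open>q / p\<close>; the shift by \<open>d\<close> covers vanishing norms.\<close>
    define \<epsilon> where "\<epsilon> = (q + d) / (p + d)"
    have \<epsilon>: "\<epsilon> > 0" using d pq by (simp add: \<epsilon>_def add_nonneg_pos)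
    have "2 * (LINT x|lebesgue_on \<Omega>. a x * b x) \<le> \<epsilon> * p\<^sup>2 + q\<^sup>2 / \<epsilon>"
      using L2_young[OF a b \<epsilon>] by (simp add: p_def q_def)
    also have "\<epsilon> * p\<^sup>2 \<le> (q + d) * p"
    proof -
      have "(p/(p+d)) \<le> 1" using pq d by (simp add: divide_le_eq)
      then have "(q + d) * p * (p/(p+d)) \<le> (q+d) * p * 1" using pq d by (intro mult_left_mono) auto
      then show ?thesis by (simp add: \<epsilon>_def power2_eq_square field_simps)
    qed
    also have "q\<^sup>2 / \<epsilon> \<le> (p + d) * q"
    proof -
      have "(q/(q+d)) \<le> 1" using pq d by (simp add: divide_le_eq)
      then have "(p + d) * q * (q/(q+d)) \<le> (p+d) * q * 1" using pq d by (intro mult_left_mono) auto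
      then show ?thesis by (simp add: \<epsilon>_def power2_eq_square field_simps)
    qed
    also have "(q + d) * p + (p + d) * q \<le> 2 * (p * q + e)"
    proof -
      have "d * (p + q) \<le> e" using e pq by (simp add: d_def field_simps)
      then show ?thesis using e by (simp add: algebra_simps)
    qed
    finally show "(LINT x|lebesgue_on \<Omega>. a x * b x) \<le> L2_norm \<Omega> a * L2_norm \<Omega> b + e"
      by (simp add: p_def q_def)
  qed
  have "(\<lambda>x. - a x) \<in> L2_space \<Omega>" using L2_space_lincomb[OF a b, of "-1" 0] by simp
  from *[OF this b] *[OF a b] show ?thesis by (simp add: abs_le_iff L2_norm_def)
qed

lemma L2_norm_triangle:
  assumes a: "a \<in> L2_space \<Omega>" and b: "b \<in> L2_space \<Omega>"
  shows "L2_norm \<Omega> (\<lambda>x. a x + b x) \<le> L2_norm \<Omega> a + L2_norm \<Omega> b"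
proof -
  have "(L2_norm \<Omega> (\<lambda>x. a x + b x))\<^sup>2 = (LINT x|lebesgue_on \<Omega>. (a x)\<^sup>2 + 2 * (a x * b x) + (b x)\<^sup>2)"
    unfolding L2_norm_sq by (rule Bochner_Integration.integral_cong) (auto simp: power2_eq_square algebra_simps)
  also have "\<dots> = (L2_norm \<Omega> a)\<^sup>2 + 2 * (LINT x|lebesgue_on \<Omega>. a x * b x) + (L2_norm \<Omega> b)\<^sup>2"
    using L2_spaceD[OF a] L2_spaceD[OF b] L2_integrable_mult[OF a b] by (simp add: L2_norm_sq)
  also have "\<dots> \<le> (L2_norm \<Omega> a + L2_norm \<Omega> b)\<^sup>2"
    using L2_Cauchy_Schwarz[OF a b] by (simp add: power2_eq_square algebra_simps)
  finally show ?thesis by (rule power2_le_imp_le) (simp add: L2_norm_nonneg)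
qed

lemma L2_norm_minus_commute: "L2_norm \<Omega> (\<lambda>x. a x - b x) = L2_norm \<Omega> (\<lambda>x. b x - a x)"
  by (simp add: L2_norm_def power2_commute)

lemma L2_norm_triangle_diff:
  assumes a: "a \<in> L2_space \<Omega>" and b: "b \<in> L2_space \<Omega>"
  shows "\<bar>L2_norm \<Omega> a - L2_norm \<Omega> b\<bar> \<le> L2_norm \<Omega> (\<lambda>x. a x - b x)"
  using L2_norm_triangle[OF L2_space_diff[OF a b] b] L2_norm_triangle[OF L2_space_diff[OF b a] a]
    L2_norm_minus_commute[of \<Omega> a b] by simp

lemma L2_subseq_AE:
  assumes a: "\<And>n. a n \<in> L2_space \<Omega>" and b: "b \<in> L2_space \<Omega>"
    and lim: "(\<lambda>n. L2_norm \<Omega> (\<lambda>x. a n x - b x)) \<longlonglongrightarrow> 0"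
  obtains r :: "nat \<Rightarrow> nat" where "strict_mono r" "AE x in lebesgue_on \<Omega>. (\<lambda>n. a (r n) x) \<longlonglongrightarrow> b x"
proof -
  have "\<exists>r::nat\<Rightarrow>nat. strict_mono r \<and> (AE x in lebesgue_on \<Omega>. (\<lambda>n. (a (r n) x - b x)\<^sup>2) \<longlonglongrightarrow> 0)"
  proof (rule tendsto_L1_AE_subseq)
    show "integrable (lebesgue_on \<Omega>) (\<lambda>x. (a n x - b x)\<^sup>2)" for n
      using L2_spaceD(2)[OF L2_space_diff[OF a b]] by simp
    have "(\<lambda>n. (L2_norm \<Omega> (\<lambda>x. a n x - b x))\<^sup>2) \<longlonglongrightarrow> 0\<^sup>2" using lim by (intro tendsto_intros)
    then show "(\<lambda>n. LINT x|lebesgue_on \<Omega>. norm ((a n x - b x)\<^sup>2)) \<longlonglongrightarrow> 0" by (simp add: L2_norm_sq)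
  qed
  then obtain r :: "nat \<Rightarrow> nat" where r: "strict_mono r" "AE x in lebesgue_on \<Omega>. (\<lambda>n. (a (r n) x - b x)\<^sup>2) \<longlonglongrightarrow> 0" by blast
  from r(2) have "AE x in lebesgue_on \<Omega>. (\<lambda>n. a (r n) x) \<longlonglongrightarrow> b x"
  proof eventually_elim
    fix x assume "(\<lambda>n. (a (r n) x - b x)\<^sup>2) \<longlonglongrightarrow> 0"
    then have "(\<lambda>n. sqrt ((a (r n) x - b x)\<^sup>2)) \<longlonglongrightarrow> sqrt 0" by (intro tendsto_intros)
    then have "(\<lambda>n. a (r n) x - b x) \<longlonglongrightarrow> 0" by (simp add: tendsto_rabs_zero_iff)
    then show "(\<lambda>n. a (r n) x) \<longlonglongrightarrow> b x" by (simp add: LIM_zero_iff)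
  qed
  with r(1) show thesis by (rule that)
qed

section \<open>Smooth cut-offs and weak derivatives in time\<close>

text \<open>This is the smoothness that is required of test functions in time.\<close>

definition smooth_fun :: "(real \<Rightarrow> real) \<Rightarrow> bool" where
  "smooth_fun \<psi> \<longleftrightarrow> (\<forall>k. (deriv ^^ k) \<psi> differentiable_on UNIV)"

text \<open>Smoothness of \<open>f\<close> follows once \<open>f\<close> belongs to a family of differentiable functions that is closed
  under differentiation.\<close>

lemma smooth_fun_coinduct:
  assumes "X f" and step: "\<And>f. X f \<Longrightarrow> f differentiable_on UNIV \<and> X (deriv f)"
  shows "smooth_fun f"
proof -
  have "X ((deriv ^^ k) f)" for k by (induction k) (use assms in auto)
  then show ?thesis using step by (auto simp: smooth_fun_def)
qed

lemma smooth_fun_deriv: "smooth_fun f \<Longrightarrow> smooth_fun (deriv f)"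
  unfolding smooth_fun_def by (metis comp_apply funpow_Suc_right)

lemma smooth_fun_DERIV: "smooth_fun f \<Longrightarrow> (f has_real_derivative deriv f x) (at x)"
  unfolding smooth_fun_def
  by (metis DERIV_deriv_iff_real_differentiable UNIV_I differentiable_on_eq_differentiable_at funpow_0 open_UNIV)

lemma smooth_fun_rescaled_combination:
  assumes "smooth_fun f" "smooth_fun g"
  shows "smooth_fun (\<lambda>x. p * f ((x - a) / e) + q * g ((x - b) / e))"
proof (rule smooth_fun_coinduct)
  let ?X = "\<lambda>h. \<exists>p q f g. smooth_fun f \<and> smooth_fun g \<and> h = (\<lambda>x. p * f ((x - a) / e) + q * g ((x - b) / e))"
  show "?X (\<lambda>x. p * f ((x - a) / e) + q * g ((x - b) / e))" using assms by blast
  fix h assume "?X h"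
  then obtain p q f g where fg: "smooth_fun f" "smooth_fun g"
    and h: "h = (\<lambda>x. p * f ((x - a) / e) + q * g ((x - b) / e))" by blast
  have d: "(h has_real_derivative (p / e) * deriv f ((x - a) / e) + (q / e) * deriv g ((x - b) / e)) (at x)" for x
  proof -
    have "((\<lambda>x. f ((x - a) / e)) has_real_derivative deriv f ((x - a) / e) * (1 / e)) (at x)"
      "((\<lambda>x. g ((x - b) / e)) has_real_derivative deriv g ((x - b) / e) * (1 / e)) (at x)"
      using DERIV_chain2[OF smooth_fun_DERIV[OF fg(1)] DERIV_cdivide[OF DERIV_diff[OF DERIV_ident DERIV_const]]]
        DERIV_chain2[OF smooth_fun_DERIV[OF fg(2)] DERIV_cdivide[OF DERIV_diff[OF DERIV_ident DERIV_const]]]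
      by simp_all
    then show ?thesis unfolding h by (auto intro!: derivative_eq_intros simp: mult.commute)
  qed
  then have "deriv h = (\<lambda>x. (p / e) * deriv f ((x - a) / e) + (q / e) * deriv g ((x - b) / e))"
    using DERIV_imp_deriv by blast
  moreover have "h differentiable_on UNIV"
    using d by (simp add: differentiable_on_eq_differentiable_at real_differentiable_def) blast
  ultimately show "h differentiable_on UNIV \<and> ?X (deriv h)" using fg smooth_fun_deriv by blast
qed

text \<open>For \<open>p = 1\<close> and \<open>m = 0\<close> this is the usual bump function \<open>exp (- 1 / (x (1 - x)))\<close> on the unit
  interval. The polynomial \<open>p\<close> and the power \<open>m\<close> make the family closed under differentiation.\<close>

definition bump :: "real poly \<Rightarrow> nat \<Rightarrow> real \<Rightarrow> real" where
  "bump p m x = (if 0 < x \<and> x < 1 then poly p x * (1 / (x * (1 - x))) ^ m * exp (- 1 / (x * (1 - x))) else 0)"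

lemma power_mult_exp_minus_le: "z ^ n * exp (- z) \<le> real n ^ n" if "0 \<le> z" "0 < n" for z :: real
proof -
  have "(z / n) ^ n \<le> (1 + z / n) ^ n" using that by (intro power_mono) auto
  also have "\<dots> \<le> exp z" using that by (intro exp_ge_one_plus_x_over_n_power_n) auto
  finally show ?thesis using that by (simp add: exp_minus field_simps)
qed

text \<open>The exponential absorbs every power of \<open>1 / (x (1 - x))\<close> and leaves a factor \<open>(x (1 - x))\<^sup>2\<close>,
  and \<open>x (1 - x)\<close> is at most the distance from \<open>x\<close> to any point outside the open interval.\<close>

lemma bump_quadratic_bound: "\<exists>C. \<forall>x x0. x0 \<le> 0 \<or> 1 \<le> x0 \<longrightarrow> \<bar>bump p m x\<bar> \<le> C * (x - x0)\<^sup>2"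
proof -
  have "compact (poly p ` {0..1})" by (intro compact_continuous_image continuous_intros) auto
  then obtain B where B: "\<And>x. x \<in> {0..1} \<Longrightarrow> \<bar>poly p x\<bar> \<le> B"
    using compact_imp_bounded bounded_iff by (metis imageI real_norm_def)
  define N where "N = real (m + 2) ^ (m + 2)"
  have N: "N \<ge> 0" by (simp add: N_def)
  have B0: "B \<ge> 0" using B[of 0] by auto
  show ?thesis
  proof (intro exI[of _ "B * N"] allI impI)
    fix x x0 :: real assume x0: "x0 \<le> 0 \<or> 1 \<le> x0"
    show "\<bar>bump p m x\<bar> \<le> B * N * (x - x0)\<^sup>2"
    proof (cases "0 < x \<and> x < 1")
      case True
      define q where "q = x * (1 - x)"
      have q: "q > 0" using True by (simp add: q_def)
      have "q \<le> \<bar>x - x0\<bar>"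
        using x0
      proof
        assume "x0 \<le> 0"
        moreover have "q \<le> x" using True by (simp add: q_def mult_left_le)
        ultimately show ?thesis using True by simp
      next
        assume "1 \<le> x0"
        moreover have "q \<le> 1 - x" using True by (simp add: q_def mult_left_le_one_le)
        ultimately show ?thesis using True by simp
      qed
      then have q2: "q\<^sup>2 \<le> (x - x0)\<^sup>2" using q by (metis abs_le_square_iff abs_of_pos abs_abs)
      have "(1/q)^m * exp (- 1/q) = q\<^sup>2 * ((1/q)^(m+2) * exp (- (1/q)))"
        using q by (simp add: power_add power2_eq_square field_simps)
      also have "\<dots> \<le> q\<^sup>2 * N" unfolding N_def using q by (intro mult_left_mono power_mult_exp_minus_le) auto
      also have "\<dots> \<le> (x - x0)\<^sup>2 * N" using q2 N by (intro mult_right_mono) auto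
      finally have "(1/q)^m * exp (- 1/q) \<le> (x - x0)\<^sup>2 * N" .
      moreover have "\<bar>bump p m x\<bar> = \<bar>poly p x\<bar> * ((1/q)^m * exp (- 1/q))"
        using True q by (simp add: bump_def q_def[symmetric] abs_mult)
      ultimately have "\<bar>bump p m x\<bar> \<le> B * ((x - x0)\<^sup>2 * N)"
        using True B[of x] q B0 by (auto intro!: mult_mono)
      then show ?thesis by (simp add: mult_ac)
    qed (use B0 N in \<open>auto simp: bump_def\<close>)
  qed
qed

lemma DERIV_zero_if_quadratic:
  fixes f :: "real \<Rightarrow> real"
  assumes "\<And>x. \<bar>f x\<bar> \<le> C * (x - a)\<^sup>2"
  shows "(f has_real_derivative 0) (at a)"
proof -
  have fa: "f a = 0" using assms[of a] by simp
  have "((\<lambda>h. (f (a + h) - f a) / h) \<longlongrightarrow> 0) (at 0)"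
  proof (rule Lim_null_comparison)
    show "\<forall>\<^sub>F h in at 0. norm ((f (a + h) - f a) / h) \<le> C * \<bar>h\<bar>"
    proof (rule always_eventually, rule allI)
      fix h :: real
      show "norm ((f (a + h) - f a) / h) \<le> C * \<bar>h\<bar>"
        using assms[of "a + h"] fa by (cases "h = 0") (auto simp: divide_le_eq power2_eq_square abs_mult)
    qed
    have "((\<lambda>h. C * \<bar>h\<bar>) \<longlongrightarrow> C * \<bar>0\<bar>) (at (0::real))" by (intro tendsto_intros)
    then show "((\<lambda>h. C * \<bar>h\<bar>) \<longlongrightarrow> 0) (at (0::real))" by simp
  qed
  then show ?thesis by (simp add: DERIV_def)
qed

lemma bump_DERIV:
  "(bump p m has_real_derivative
     bump (pderiv p * [:0, 1, -1:]\<^sup>2 - smult (of_nat m) (p * [:1, -2:] * [:0, 1, -1:]) + p * [:1, -2:]) (m + 2) x) (at x)"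
  (is "(_ has_real_derivative bump ?r _ _) _")
proof (cases "0 < x \<and> x < 1")
  case True
  define q where "q = x * (1 - x)"
  have q: "q > 0" using True by (simp add: q_def)
  have dq: "((\<lambda>x. x * (1 - x)) has_real_derivative (1 - 2 * x)) (at x)"
    by (auto intro!: derivative_eq_intros)
  have "((\<lambda>x. 1 / (x * (1 - x))) has_real_derivative - (1 - 2 * x) / q\<^sup>2) (at x)"
    using q by (auto intro!: derivative_eq_intros dq simp: q_def power2_eq_square field_simps)
  note dz = this
  have de: "((\<lambda>x. exp (- 1 / (x * (1 - x)))) has_real_derivative exp (- 1 / q) * ((1 - 2 * x) / q\<^sup>2)) (at x)"
  proof -
    have "((\<lambda>x. exp (- (1 / (x * (1 - x))))) has_real_derivative exp (- (1/q)) * - (- (1 - 2 * x) / q\<^sup>2)) (at x)"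
      unfolding q_def by (intro DERIV_chain2[OF DERIV_exp] DERIV_minus dz[unfolded q_def])
    moreover have "exp (- (1/q)) * - (- (1 - 2 * x) / q\<^sup>2) = exp (- 1 / q) * ((1 - 2 * x) / q\<^sup>2)"
      by (simp only: minus_divide_left[symmetric] minus_minus)
    ultimately show ?thesis by simp
  qed
  have dp: "((\<lambda>x. (1 / (x * (1 - x))) ^ m) has_real_derivative real m * (- (1 - 2 * x) / q\<^sup>2) * (1/q) ^ (m - 1)) (at x)"
    using DERIV_power[OF dz, of m] by (simp add: q_def mult_ac)
  have "((\<lambda>x. poly p x * (1 / (x * (1 - x))) ^ m * exp (- 1 / (x * (1 - x)))) has_real_derivative
     (poly (pderiv p) x * (1/q)^m + (real m * (- (1 - 2 * x) / q\<^sup>2) * (1/q) ^ (m - 1)) * poly p x) * exp (- 1/q)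
       + (exp (- 1 / q) * ((1 - 2 * x) / q\<^sup>2)) * (poly p x * (1/q)^m)) (at x)"
    using DERIV_mult[OF DERIV_mult[OF poly_DERIV[of p x] dp] de] by (simp add: q_def)
  also have "(poly (pderiv p) x * (1/q)^m + (real m * (- (1 - 2 * x) / q\<^sup>2) * (1/q) ^ (m - 1)) * poly p x) * exp (- 1/q)
       + (exp (- 1 / q) * ((1 - 2 * x) / q\<^sup>2)) * (poly p x * (1/q)^m)
     = (poly (pderiv p) x * q\<^sup>2 - real m * (poly p x * (1 - 2 * x) * q) + poly p x * (1 - 2 * x)) * (1/q)^(m+2) * exp (- 1/q)"
  proof -
    have "real m * (1/q) ^ (m - 1) = real m * (1/q)^m * q" using q by (cases m) auto
    then have "real m * (- (1 - 2 * x) / q\<^sup>2) * (1/q) ^ (m - 1) = (- (1 - 2 * x) / q\<^sup>2) * (real m * (1/q)^m * q)"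
      by (metis mult.assoc mult.commute)
    then show ?thesis using q by (simp only:) (simp add: power_add power2_eq_square field_simps)
  qed
  also have "\<dots> = bump ?r (m + 2) x"
    using True by (simp add: bump_def q_def algebra_simps)
  finally show ?thesis
    by (rule has_field_derivative_transform_within_open[where S = "{0<..<1}"]) (use True in \<open>auto simp: bump_def\<close>)
next
  case False
  then have "bump ?r (m + 2) x = 0" by (auto simp: bump_def)
  moreover obtain C where "\<And>y. \<bar>bump p m y\<bar> \<le> C * (y - x)\<^sup>2"
    using bump_quadratic_bound[of p m] False by (metis not_less)
  ultimately show ?thesis using DERIV_zero_if_quadratic by auto
qed

lemma smooth_fun_bump: "smooth_fun (bump p m)"
proof (rule smooth_fun_coinduct[where X = "\<lambda>f. \<exists>p m. f = bump p m"])
  fix f assume "\<exists>p m. f = bump p m"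
  then obtain p m where f: "f = bump p m" by blast
  have "deriv f = bump (pderiv p * [:0, 1, -1:]\<^sup>2 - smult (of_nat m) (p * [:1, -2:] * [:0, 1, -1:]) + p * [:1, -2:]) (m + 2)"
    unfolding f using bump_DERIV DERIV_imp_deriv by blast
  moreover have "f differentiable_on UNIV"
    unfolding f using bump_DERIV by (auto simp: differentiable_on_eq_differentiable_at real_differentiable_def)
  ultimately show "f differentiable_on UNIV \<and> (\<exists>p m. deriv f = bump p m)" by blast
qed blast

text \<open>The normalised primitive of the bump function.\<close>

lemma smooth_step:
  obtains \<theta> :: "real \<Rightarrow> real"
  where "smooth_fun \<theta>" "\<And>x. x \<le> 0 \<Longrightarrow> \<theta> x = 0" "\<And>x. 1 \<le> x \<Longrightarrow> \<theta> x = 1"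
    "\<And>x. 0 \<le> \<theta> x \<and> \<theta> x \<le> 1" "\<And>x. 0 \<le> deriv \<theta> x" "\<And>x. x \<le> 0 \<or> 1 \<le> x \<Longrightarrow> deriv \<theta> x = 0"
proof -
  define b where "b = bump 1 0"
  have b: "b x \<ge> 0" "0 < x \<Longrightarrow> x < 1 \<Longrightarrow> b x > 0" "x \<le> 0 \<or> 1 \<le> x \<Longrightarrow> b x = 0" for x
    by (auto simp: b_def bump_def)
  have bs: "smooth_fun b" by (simp add: b_def smooth_fun_bump)
  have bc: "continuous_on UNIV b"
    using smooth_fun_DERIV[OF bs] by (meson DERIV_continuous_on DERIV_subset UNIV_I subset_UNIV)
  define P where "P x = (LBINT y=0..ereal x. b y)" for x
  have P: "(P has_real_derivative b x) (at x)" for x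
    unfolding P_def[abs_def] by (rule interval_integral_has_derivative[OF bc])
  have Pm: "P x \<le> P y" if "x \<le> y" for x y
    by (rule DERIV_nonneg_imp_nondecreasing[OF that]) (use P b(1) in blast)
  have P0: "P 0 = 0" by (simp add: P_def zero_ereal_def)
  have Pc: "continuous_on S P" for S
    using P by (meson DERIV_continuous_on DERIV_subset subset_UNIV)
  have "P 0 < P 1"
    by (rule DERIV_pos_imp_increasing_open) (use P b(2) Pc in \<open>auto\<close>)
  then have Z: "P 1 > 0" using P0 by simp
  have Pl: "P x = 0" if "x \<le> 0" for x
    using DERIV_nonpos_imp_nonincreasing[OF that, of P] P b(3) Pm[OF that] P0 by (metis order.antisym order.refl)
  have Pr: "P x = P 1" if "1 \<le> x" for x
    using DERIV_nonpos_imp_nonincreasing[OF that, of P] P b(3) Pm[OF that] by (metis order.antisym order.refl)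
  define \<theta> where "\<theta> x = P x / P 1" for x
  have d: "(\<theta> has_real_derivative b x / P 1) (at x)" for x
    unfolding \<theta>_def by (rule DERIV_cdivide[OF P])
  have dd: "deriv \<theta> x = b x / P 1" for x using d DERIV_imp_deriv by blast
  have "smooth_fun \<theta>"
  proof (rule smooth_fun_coinduct[where X = "\<lambda>f. f = \<theta> \<or> smooth_fun f"])
    fix f assume "f = \<theta> \<or> smooth_fun f"
    then show "f differentiable_on UNIV \<and> (deriv f = \<theta> \<or> smooth_fun (deriv f))"
    proof
      assume f: "f = \<theta>"
      have "deriv \<theta> = (\<lambda>x. (1 / P 1) * b ((x - 0) / 1) + 0 * b ((x - 0) / 1))" using dd by auto
      then have "smooth_fun (deriv \<theta>)" using smooth_fun_rescaled_combination[OF bs bs] by metis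
      then show ?thesis using d f by (auto simp: differentiable_on_eq_differentiable_at real_differentiable_def)
    next
      assume f: "smooth_fun f"
      then have "f differentiable_on UNIV" unfolding smooth_fun_def by (metis funpow_0)
      then show ?thesis using smooth_fun_deriv[OF f] by simp
    qed
  qed simp
  moreover have "0 \<le> \<theta> x \<and> \<theta> x \<le> 1" for x
  proof -
    have "0 \<le> P x" using Pl[of x] Pm[of 0 x] P0 by (cases "x \<le> 0") auto
    moreover have "P x \<le> P 1" using Pr[of x] Pm[of x 1] by (cases "x \<le> 1") auto
    ultimately show ?thesis using Z by (simp add: \<theta>_def)
  qed
  moreover have "\<theta> x = 0" if "x \<le> 0" for x using Pl[OF that] by (simp add: \<theta>_def)
  moreover have "\<theta> x = 1" if "1 \<le> x" for x using Pr[OF that] Z by (simp add: \<theta>_def)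
  moreover have "0 \<le> deriv \<theta> x" for x using b(1)[of x] Z by (simp add: dd)
  moreover have "deriv \<theta> x = 0" if "x \<le> 0 \<or> 1 \<le> x" for x using b(3)[OF that] by (simp add: dd)
  ultimately show thesis by (intro that[of \<theta>])
qed

text \<open>A weak derivative of a continuous function is a derivative in integrated form. The test functions
  are smooth approximations of the indicator function of \<open>{r..t}\<close>; their derivatives concentrate at
  \<open>r\<close> and, with the opposite sign, at \<open>t\<close>.\<close>

lemma du_Bois_Reymond:
  fixes p q :: "real \<Rightarrow> real"
  assumes rt: "0 < r" "r \<le> t" "t < t'" "ereal t' < T"
    and p: "continuous_on {r..t'} p"
    and q: "q absolutely_integrable_on {r..t'}"
    and weak: "\<And>\<psi>. test_fun T \<psi> \<Longrightarrow>
      (LINT t:open_time T|lebesgue. deriv \<psi> t * p t) = - (LINT t:open_time T|lebesgue. \<psi> t * q t)"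
  shows "p t - p r = integral {r..t} q"
proof -
  obtain \<theta> :: "real \<Rightarrow> real" where \<theta>: "smooth_fun \<theta>" "\<And>x. x \<le> 0 \<Longrightarrow> \<theta> x = 0" "\<And>x. 1 \<le> x \<Longrightarrow> \<theta> x = 1"
    "\<And>x. 0 \<le> \<theta> x \<and> \<theta> x \<le> 1" "\<And>x. 0 \<le> deriv \<theta> x" "\<And>x. x \<le> 0 \<or> 1 \<le> x \<Longrightarrow> deriv \<theta> x = 0"
    by (rule smooth_step) blast
  define e where "e n = (t' - t) / real (n + 1)" for n
  have e: "0 < e n" "e n \<le> t' - t" for n using rt by (auto simp: e_def divide_le_eq mult_left_le)
  have e0: "e \<longlonglongrightarrow> 0"
    unfolding e_def using LIMSEQ_Suc[OF lim_const_over_n[of "t' - t"]] by simp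
  define S where "S = {r..t'}"
  define \<psi> where "\<psi> n x = \<theta> ((x - r) / e n) - \<theta> ((x - t) / e n)" for n x
  define \<psi>' where "\<psi>' n a x = deriv \<theta> ((x - a) / e n) / e n" for n a x
  have sm: "smooth_fun (\<psi> n)" for n
    using smooth_fun_rescaled_combination[OF \<theta>(1) \<theta>(1), of 1 r "e n" "-1" t] by (simp add: \<psi>_def[abs_def])
  have d1: "((\<lambda>x. \<theta> ((x - a) / e n)) has_real_derivative \<psi>' n a x) (at x)" for n a x
    unfolding \<psi>'_def
    using DERIV_chain2[OF smooth_fun_DERIV[OF \<theta>(1)] DERIV_cdivide[OF DERIV_diff[OF DERIV_ident DERIV_const]]]
    by simp
  have d: "deriv (\<psi> n) x = \<psi>' n r x - \<psi>' n t x" for n x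
    unfolding \<psi>_def[abs_def] by (rule DERIV_imp_deriv, rule DERIV_diff[OF d1 d1])
  have out: "\<psi> n x = 0" "deriv (\<psi> n) x = 0" if "x \<notin> S" for n x
  proof -
    have "x \<le> r \<or> t + e n \<le> x" using that e(2)[of n] by (auto simp: S_def)
    then have "((x - r) / e n \<le> 0 \<and> (x - t) / e n \<le> 0) \<or> (1 \<le> (x - r) / e n \<and> 1 \<le> (x - t) / e n)"
      using e(1)[of n] rt by (auto simp: divide_le_0_iff le_divide_eq)
    then show "\<psi> n x = 0" "deriv (\<psi> n) x = 0" unfolding d \<psi>_def \<psi>'_def using \<theta> by auto
  qed
  have ST: "S \<subseteq> open_time T"
    using rt by (auto simp: S_def open_time_def) (metis ereal_less_eq(3) order.strict_trans1)
  have test: "test_fun T (\<psi> n)" for n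
    unfolding test_fun_def using sm[of n] out(1) ST unfolding smooth_fun_def S_def by blast
  have red: "(LINT t:open_time T|lebesgue. k t * w t) = (LINT t:S|lebesgue. k t * w t)"
    if "\<And>x. x \<notin> S \<Longrightarrow> k x = 0" for k w :: "real \<Rightarrow> real"
    unfolding set_lebesgue_integral_def
    by (rule Bochner_Integration.integral_cong) (use that ST in \<open>auto simp: indicator_def\<close>)
  have main: "(LINT t:S|lebesgue. deriv (\<psi> n) t * p t) = - (LINT t:S|lebesgue. \<psi> n t * q t)" for n
    using weak[OF test[of n]] red[of "deriv (\<psi> n)" p] red[of "\<psi> n" q] out by simp
  have cd: "continuous_on UNIV (deriv \<theta>)" "continuous_on UNIV \<theta>"
    using smooth_fun_DERIV[OF smooth_fun_deriv[OF \<theta>(1)]] smooth_fun_DERIV[OF \<theta>(1)]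
    by (meson DERIV_continuous_on DERIV_subset UNIV_I subset_UNIV)+
  have c\<psi>: "continuous_on S (\<psi>' n a)" for n a
    unfolding \<psi>'_def using e(1)[of n]
    by (intro continuous_intros continuous_on_compose2[OF cd(1)]) auto
  \<comment> \<open>Each of the two parts of the derivative of the cut-off tends to a Dirac mass.\<close>
  have lim1: "(\<lambda>n. integral S (\<lambda>x. \<psi>' n a x * p x)) \<longlonglongrightarrow> p a" if a: "a = r \<or> a = t" for a
  proof (rule LIMSEQ_I)
    fix \<omega> :: real assume \<omega>: "0 < \<omega>"
    have aS: "a \<in> S" using a rt by (auto simp: S_def)
    then obtain \<delta> where \<delta>: "\<delta> > 0" "\<And>x. x \<in> S \<Longrightarrow> \<bar>x - a\<bar> < \<delta> \<Longrightarrow> \<bar>p x - p a\<bar> < \<omega> / 2"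
      using p \<omega> unfolding S_def continuous_on_iff dist_real_def by (metis half_gt_zero)
    obtain N where N: "\<And>n. N \<le> n \<Longrightarrow> e n < \<delta>"
      using order_tendstoD(2)[OF e0 \<delta>(1)] by (auto simp: eventually_sequentially)
    show "\<exists>N. \<forall>n\<ge>N. norm (integral S (\<lambda>x. \<psi>' n a x * p x) - p a) < \<omega>"
    proof (intro exI allI impI)
      fix n assume n: "N \<le> n"
      have "((\<psi>' n a) has_integral (\<theta> ((t' - a) / e n) - \<theta> ((r - a) / e n))) {r..t'}"
        by (rule fundamental_theorem_of_calculus)
          (use rt d1 in \<open>auto simp: has_real_derivative_iff_has_vector_derivative[symmetric] intro: DERIV_subset\<close>)
      moreover have "1 \<le> (t' - a) / e n" "(r - a) / e n \<le> 0"
        using a e[of n] rt by (auto simp: le_divide_eq divide_le_0_iff)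
      ultimately have one: "(\<psi>' n a has_integral 1) S" using \<theta> by (simp add: S_def)
      have i1: "(\<lambda>x. \<psi>' n a x * p x) integrable_on S" "(\<lambda>x. \<psi>' n a x * (p x - p a)) integrable_on S"
        unfolding S_def using c\<psi>[of n a] p
        by (auto simp: S_def intro!: integrable_continuous_real continuous_intros)
      have "integral S (\<lambda>x. \<psi>' n a x * p x) - p a = integral S (\<lambda>x. \<psi>' n a x * p x - \<psi>' n a x * p a)"
        using one i1 has_integral_integrable_integral[of "\<psi>' n a" 1 S]
        by (subst Henstock_Kurzweil_Integration.integral_diff) (auto intro: integrable_on_mult_left)
      also have "\<dots> = integral S (\<lambda>x. \<psi>' n a x * (p x - p a))" by (simp add: right_diff_distrib)
      also have "norm \<dots> \<le> integral S (\<lambda>x. \<psi>' n a x * (\<omega> / 2))"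
      proof (rule integral_norm_bound_integral[OF i1(2)])
        show "(\<lambda>x. \<psi>' n a x * (\<omega> / 2)) integrable_on S" using one by (auto intro: integrable_on_mult_left)
        fix x assume x: "x \<in> S"
        show "norm (\<psi>' n a x * (p x - p a)) \<le> \<psi>' n a x * (\<omega> / 2)"
        proof (cases "0 < (x - a) / e n \<and> (x - a) / e n < 1")
          case True
          then have "\<bar>x - a\<bar> < \<delta>" using e(1)[of n] N[OF n] by (auto simp: divide_less_eq zero_less_divide_iff)
          then have "\<bar>p x - p a\<bar> \<le> \<omega> / 2" using \<delta>(2)[OF x] by simp
          moreover have "\<psi>' n a x \<ge> 0" using \<theta>(5) e(1)[of n] by (simp add: \<psi>'_def)
          ultimately show ?thesis by (simp only: abs_mult real_norm_def abs_of_nonneg) (intro mult_left_mono)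
        next
          case False
          then have "\<psi>' n a x = 0" using \<theta>(6) by (auto simp: \<psi>'_def not_less)
          then show ?thesis by simp
        qed
      qed
      also have "\<dots> = \<omega> / 2" using one by (simp add: integral_unique)
      finally show "norm (integral S (\<lambda>x. \<psi>' n a x * p x) - p a) < \<omega>" using \<omega> by simp
    qed
  qed
  have L: "(LINT t:S|lebesgue. deriv (\<psi> n) t * p t) = integral S (\<lambda>x. \<psi>' n r x * p x) - integral S (\<lambda>x. \<psi>' n t x * p x)" for n
  proof -
    have c: "continuous_on S (\<lambda>x. \<psi>' n a x * p x)" for a
      using c\<psi>[of n a] p by (auto simp: S_def intro!: continuous_intros)
    have "(\<lambda>x. \<psi>' n r x * p x - \<psi>' n t x * p x) absolutely_integrable_on S"
      using c[of r] c[of t] unfolding S_def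
      by (intro absolutely_integrable_continuous_real continuous_on_diff)
    then have "(LINT x:S|lebesgue. \<psi>' n r x * p x - \<psi>' n t x * p x) = integral S (\<lambda>x. \<psi>' n r x * p x - \<psi>' n t x * p x)"
      by (rule set_lebesgue_integral_eq_integral)
    also have "\<dots> = integral S (\<lambda>x. \<psi>' n r x * p x) - integral S (\<lambda>x. \<psi>' n t x * p x)"
      using c[of r] c[of t] unfolding S_def
      by (intro Henstock_Kurzweil_Integration.integral_diff integrable_continuous_real)
    finally show ?thesis by (simp add: d left_diff_distrib)
  qed
  have "(\<lambda>n. LINT t:S|lebesgue. deriv (\<psi> n) t * p t) \<longlonglongrightarrow> p r - p t"
    unfolding L by (intro tendsto_diff lim1) auto
  moreover have "(\<lambda>n. LINT x:S|lebesgue. \<psi> n x * q x) \<longlonglongrightarrow> (LINT x:{r..t}|lebesgue. q x)"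
  proof -
    have qi: "integrable lebesgue (\<lambda>x. indicator S x * q x)"
      using q by (simp add: S_def set_integrable_def)
    have *: "(\<lambda>n. LINT x|lebesgue. \<psi> n x * (indicator S x * q x)) \<longlonglongrightarrow> (LINT x|lebesgue. indicator {r..t} x * (indicator S x * q x))"
    proof (rule integral_dominated_convergence[where w = "\<lambda>x. \<bar>indicator S x * q x\<bar>"])
      show "(\<lambda>x. indicator {r..t} x * (indicator S x * q x)) \<in> borel_measurable lebesgue"
        by (rule borel_measurable_times[OF borel_measurable_indicator borel_measurable_integrable[OF qi]]) auto
      have "continuous_on UNIV (\<psi> n)" for n
        unfolding \<psi>_def using e(1)[of n]
        by (intro continuous_intros continuous_on_compose2[OF cd(2)]) auto
      then have "\<psi> n \<in> borel_measurable lebesgue" for n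
        by (intro measurable_completion) (simp add: borel_measurable_continuous_onI)
      then show "(\<lambda>x. \<psi> n x * (indicator S x * q x)) \<in> borel_measurable lebesgue" for n
        by (rule borel_measurable_times[OF _ borel_measurable_integrable[OF qi]])
      show "integrable lebesgue (\<lambda>x. \<bar>indicator S x * q x\<bar>)" using qi by simp
      show "AE x in lebesgue. norm (\<psi> n x * (indicator S x * q x)) \<le> \<bar>indicator S x * q x\<bar>" for n
      proof (rule AE_I2)
        fix x
        have "\<bar>\<psi> n x\<bar> \<le> 1" using \<theta>(4)[of "(x - r) / e n"] \<theta>(4)[of "(x - t) / e n"] by (auto simp: \<psi>_def)
        then show "norm (\<psi> n x * (indicator S x * q x)) \<le> \<bar>indicator S x * q x\<bar>"
          by (simp add: abs_mult mult_left_le_one_le)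
      qed
      have "AE x in lebesgue. x \<noteq> r" by (rule AE_not_in[of "{r}", simplified]) simp
      then show "AE x in lebesgue. (\<lambda>n. \<psi> n x * (indicator S x * q x)) \<longlonglongrightarrow> indicator {r..t} x * (indicator S x * q x)"
      proof eventually_elim
        fix x assume xr: "x \<noteq> r"
        have ev: "\<forall>\<^sub>F n in sequentially. \<theta> ((x - a) / e n) = (if a < x then 1 else 0)" for a
        proof (cases "a < x")
          case True
          have "\<forall>\<^sub>F n in sequentially. e n < x - a" using order_tendstoD(2)[OF e0, of "x - a"] True by simp
          then show ?thesis
          proof eventually_elim
            fix n assume "e n < x - a"
            then have "1 \<le> (x - a) / e n" using e(1)[of n] by (simp add: le_divide_eq)
            then show "\<theta> ((x - a) / e n) = (if a < x then 1 else 0)" using \<theta>(3) True by simp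
          qed
        next
          case False
          then have "(x - a) / e n \<le> 0" for n using e(1)[of n] by (simp add: divide_le_0_iff)
          then show ?thesis using \<theta>(2) False by simp
        qed
        have "\<forall>\<^sub>F n in sequentially. \<psi> n x = indicator {r..t} x"
          using ev[of r] ev[of t]
        proof eventually_elim
          fix n assume "\<theta> ((x - r) / e n) = (if r < x then 1 else 0)" "\<theta> ((x - t) / e n) = (if t < x then 1 else 0)"
          then show "\<psi> n x = indicator {r..t} x" using xr rt(2) by (auto simp: \<psi>_def indicator_def)
        qed
        then have "(\<lambda>n. \<psi> n x) \<longlonglongrightarrow> indicator {r..t} x" by (rule tendsto_eventually)
        then show "(\<lambda>n. \<psi> n x * (indicator S x * q x)) \<longlonglongrightarrow> indicator {r..t} x * (indicator S x * q x)"
          by (intro tendsto_intros)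
      qed
    qed
    have 1: "(LINT x|lebesgue. indicator {r..t} x * (indicator S x * q x)) = (LINT x:{r..t}|lebesgue. q x)"
      unfolding set_lebesgue_integral_def
      by (rule Bochner_Integration.integral_cong) (use rt in \<open>auto simp: S_def indicator_def\<close>)
    have 2: "(LINT x|lebesgue. \<psi> n x * (indicator S x * q x)) = (LINT x:S|lebesgue. \<psi> n x * q x)" for n
      unfolding set_lebesgue_integral_def
      by (rule Bochner_Integration.integral_cong) (auto simp: mult_ac)
    show ?thesis using * unfolding 1 2 .
  qed
  then have "(\<lambda>n. - (LINT x:S|lebesgue. \<psi> n x * q x)) \<longlonglongrightarrow> - (LINT x:{r..t}|lebesgue. q x)" by (rule tendsto_minus)
  ultimately have "p r - p t = - (LINT x:{r..t}|lebesgue. q x)"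
    unfolding main by (rule LIMSEQ_unique)
  moreover have "(LINT x:{r..t}|lebesgue. q x) = integral {r..t} q"
    by (rule set_lebesgue_integral_eq_integral)
      (rule set_integrable_subset[OF q], use rt in auto)
  ultimately show ?thesis by simp
qed

section \<open>The squared norm along a curve with a weak derivative\<close>

text \<open>Along the approximating simple functions a continuous functional takes finitely many values on
  measurable sets.\<close>

lemma bochner_measurable_compose:
  assumes v: "bochner_measurable J X nX v" and J: "J \<in> sets lebesgue"
    and cont: "\<And>S w. (\<And>n. S n \<in> X) \<Longrightarrow> w \<in> X \<Longrightarrow> (\<lambda>n. nX (\<lambda>x. S n x - w x)) \<longlonglongrightarrow> 0
      \<Longrightarrow> (\<lambda>n. \<Theta> (S n)) \<longlonglongrightarrow> (\<Theta> w :: real)"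
  shows "(\<lambda>t. indicator J t * \<Theta> (v t)) \<in> borel_measurable (lebesgue :: real measure)"
proof -
  obtain S :: "nat \<Rightarrow> real \<Rightarrow> 'a \<Rightarrow> real" where
    S: "\<And>n. S n ` J \<subseteq> X" "\<And>n. finite (S n ` J)" "\<And>n w. {t\<in>J. S n t = w} \<in> sets lebesgue"
    and ae: "AE t in lebesgue. t \<in> J \<longrightarrow> v t \<in> X \<and> (\<lambda>n. nX (\<lambda>x. S n t x - v t x)) \<longlonglongrightarrow> 0"
    using v unfolding bochner_measurable_def by blast
  define s where "s n t = (\<Sum>w\<in>S n ` J. indicator {t\<in>J. S n t = w} t * \<Theta> w)" for n t
  have s: "s n t = indicator J t * \<Theta> (S n t)" for n t
  proof (cases "t \<in> J")
    case True
    then have "s n t = (\<Sum>w\<in>S n ` J. if S n t = w then \<Theta> w else 0)"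
      unfolding s_def by (intro sum.cong) (auto simp: indicator_def)
    then show ?thesis using True S(2)[of n] by simp
  qed (simp add: s_def indicator_def)
  have sm: "s n \<in> borel_measurable lebesgue" for n
    unfolding s_def[abs_def] using S(3) by (intro borel_measurable_sum borel_measurable_times) auto
  have lim: "AE t in lebesgue. (\<lambda>n. s n t) \<longlonglongrightarrow> indicator J t * \<Theta> (v t)"
    using ae
  proof eventually_elim
    fix t assume a: "t \<in> J \<longrightarrow> v t \<in> X \<and> (\<lambda>n. nX (\<lambda>x. S n t x - v t x)) \<longlonglongrightarrow> 0"
    show "(\<lambda>n. s n t) \<longlonglongrightarrow> indicator J t * \<Theta> (v t)"
    proof (cases "t \<in> J")
      case True
      then show ?thesis unfolding s using a S(1) by (intro tendsto_mult tendsto_const cont) auto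
    qed (simp add: s)
  qed
  have "(\<lambda>t. lim (\<lambda>n. s n t)) \<in> borel_measurable lebesgue"
    by (rule borel_measurable_lim_metric[OF sm])
  moreover have "AE t in lebesgue. lim (\<lambda>n. s n t) = indicator J t * \<Theta> (v t)"
    using lim by eventually_elim (rule limI)
  ultimately show ?thesis by (rule borel_measurable_AE)
qed

lemma integral_le_AE:
  fixes f g :: "real \<Rightarrow> real"
  assumes f: "f integrable_on S" and g: "g integrable_on S"
    and le: "AE t in lebesgue. t \<in> S \<longrightarrow> f t \<le> g t"
  shows "integral S f \<le> integral S g"
proof -
  define N where "N = {t. \<not> (t \<in> S \<longrightarrow> f t \<le> g t)}"
  have N: "negligible N"
    using le by (simp add: N_def completion.AE_iff_null_sets negligible_iff_null_sets)
  have eq: "min (f t) (g t) = f t" if "t \<in> S - N" for t using that by (auto simp: N_def)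
  have "integral S f = integral S (\<lambda>t. min (f t) (g t))"
    by (rule integral_spike[OF N]) (use eq in auto)
  also have "\<dots> \<le> integral S g"
    by (rule integral_le) (use integrable_spike[OF f N] eq g in auto)
  finally show ?thesis .
qed

lemma open_time_ereal: "open_time (ereal T) = {0<..<T}" by (auto simp: open_time_def)

locale L2_curve =
  fixes \<Omega> :: "'a::euclidean_space set" and u v :: "real \<Rightarrow> 'a \<Rightarrow> real" and T :: real
  assumes T: "0 < T"
    and u_L2: "\<And>t. 0 \<le> t \<Longrightarrow> t \<le> T \<Longrightarrow> u t \<in> L2_space \<Omega>"
    and u_cont: "\<And>t. 0 \<le> t \<Longrightarrow> t \<le> T \<Longrightarrow> ((\<lambda>\<tau>. L2_norm \<Omega> (\<lambda>x. u \<tau> x - u t x)) \<longlongrightarrow> 0) (at t within {0..T})"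
    and v_L2: "bochner_L2 (open_time (ereal T)) (L2_space \<Omega>) (L2_norm \<Omega>) v"
    and weak: "weak_time_deriv (ereal T) \<Omega> u v"
begin

abbreviation ip :: "('a \<Rightarrow> real) \<Rightarrow> ('a \<Rightarrow> real) \<Rightarrow> real" where
  "ip a b \<equiv> (LINT x|lebesgue_on \<Omega>. a x * b x)"

lemma v_AE: "AE t in lebesgue. t \<in> {0<..<T} \<longrightarrow> v t \<in> L2_space \<Omega>"
proof -
  have "AE t in lebesgue. t \<in> {0<..<T} \<longrightarrow> v t \<in> L2_space \<Omega> \<and> True"
    using v_L2 unfolding bochner_L2_def bochner_measurable_def open_time_ereal
    by (auto elim!: eventually_mono)
  then show ?thesis by simp
qed

lemma u_cont_on: "a \<in> {0..T} \<Longrightarrow> 0 < e \<Longrightarrow> \<exists>d>0. \<forall>\<tau>\<in>{0..T}. \<bar>\<tau> - a\<bar> < d \<longrightarrow> L2_norm \<Omega> (\<lambda>x. u \<tau> x - u a x) < e"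
proof -
  assume a: "a \<in> {0..T}" and e: "0 < e"
  have "\<forall>\<^sub>F \<tau> in at a within {0..T}. L2_norm \<Omega> (\<lambda>x. u \<tau> x - u a x) < e"
    using order_tendstoD(2)[OF u_cont[of a], of e] a e by auto
  then obtain d where d: "d > 0" "\<And>\<tau>. \<tau> \<in> {0..T} \<Longrightarrow> \<tau> \<noteq> a \<Longrightarrow> dist \<tau> a < d \<Longrightarrow> L2_norm \<Omega> (\<lambda>x. u \<tau> x - u a x) < e"
    unfolding eventually_at by auto
  moreover have "L2_norm \<Omega> (\<lambda>x. u a x - u a x) < e" using e by (simp add: L2_norm_def)
  ultimately show ?thesis by (intro exI[of _ d]) (metis dist_real_def)
qed

lemma pairing_cont: "continuous_on {0..T} (\<lambda>t. ip (u t) \<phi>)" if \<phi>: "\<phi> \<in> L2_space \<Omega>"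
  unfolding continuous_on_def
proof
  fix t assume t: "t \<in> {0..T}"
  have "((\<lambda>\<tau>. ip (u \<tau>) \<phi> - ip (u t) \<phi>) \<longlongrightarrow> 0) (at t within {0..T})"
  proof (rule Lim_null_comparison)
    show "((\<lambda>\<tau>. L2_norm \<Omega> (\<lambda>x. u \<tau> x - u t x) * L2_norm \<Omega> \<phi>) \<longlongrightarrow> 0) (at t within {0..T})"
      using tendsto_mult_left_zero[OF u_cont[of t]] t by simp
    show "\<forall>\<^sub>F \<tau> in at t within {0..T}. norm (ip (u \<tau>) \<phi> - ip (u t) \<phi>) \<le> L2_norm \<Omega> (\<lambda>x. u \<tau> x - u t x) * L2_norm \<Omega> \<phi>"
      unfolding eventually_at_topological
    proof (intro exI[of _ UNIV] conjI ballI impI)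
      fix \<tau> assume \<tau>: "\<tau> \<in> {0..T}"
      have "ip (u \<tau>) \<phi> - ip (u t) \<phi> = ip (\<lambda>x. u \<tau> x - u t x) \<phi>"
        using L2_integrable_mult[OF u_L2 \<phi>] \<tau> t by (simp add: left_diff_distrib)
      then show "norm (ip (u \<tau>) \<phi> - ip (u t) \<phi>) \<le> L2_norm \<Omega> (\<lambda>x. u \<tau> x - u t x) * L2_norm \<Omega> \<phi>"
        using L2_Cauchy_Schwarz[OF L2_space_diff[OF u_L2 u_L2] \<phi>, of \<tau> t] \<tau> t by simp
    qed auto
  qed
  then show "((\<lambda>\<tau>. ip (u \<tau>) \<phi>) \<longlongrightarrow> ip (u t) \<phi>) (at t within {0..T})" by (rule LIM_zero_cancel)
qed

lemma norm_cont: "continuous_on {0..T} (\<lambda>t. L2_norm \<Omega> (u t))"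
  unfolding continuous_on_def
proof
  fix t assume t: "t \<in> {0..T}"
  have "((\<lambda>\<tau>. L2_norm \<Omega> (u \<tau>) - L2_norm \<Omega> (u t)) \<longlongrightarrow> 0) (at t within {0..T})"
  proof (rule Lim_null_comparison)
    show "((\<lambda>\<tau>. L2_norm \<Omega> (\<lambda>x. u \<tau> x - u t x)) \<longlongrightarrow> 0) (at t within {0..T})"
      using u_cont[of t] t by simp
    show "\<forall>\<^sub>F \<tau> in at t within {0..T}. norm (L2_norm \<Omega> (u \<tau>) - L2_norm \<Omega> (u t)) \<le> L2_norm \<Omega> (\<lambda>x. u \<tau> x - u t x)"
      unfolding eventually_at_topological
    proof (intro exI[of _ UNIV] conjI ballI impI)
      fix \<tau> assume "\<tau> \<in> {0..T}"
      then show "norm (L2_norm \<Omega> (u \<tau>) - L2_norm \<Omega> (u t)) \<le> L2_norm \<Omega> (\<lambda>x. u \<tau> x - u t x)"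
        using L2_norm_triangle_diff[OF u_L2 u_L2, of \<tau> t] t by simp
    qed auto
  qed
  then show "((\<lambda>\<tau>. L2_norm \<Omega> (u \<tau>)) \<longlongrightarrow> L2_norm \<Omega> (u t)) (at t within {0..T})" by (rule LIM_zero_cancel)
qed

lemma v_norm_measurable: "(\<lambda>t. indicator {0<..<T} t * L2_norm \<Omega> (v t)) \<in> borel_measurable lebesgue"
proof (rule bochner_measurable_compose[where \<Theta> = "L2_norm \<Omega>" and X = "L2_space \<Omega>" and nX = "L2_norm \<Omega>"])
  show "bochner_measurable {0<..<T} (L2_space \<Omega>) (L2_norm \<Omega>) v"
    using v_L2 unfolding bochner_L2_def open_time_ereal by simp
  fix S :: "nat \<Rightarrow> 'a \<Rightarrow> real" and w
  assume S: "\<And>n. S n \<in> L2_space \<Omega>" and w: "w \<in> L2_space \<Omega>" and lim: "(\<lambda>n. L2_norm \<Omega> (\<lambda>x. S n x - w x)) \<longlonglongrightarrow> 0"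
  have "(\<lambda>n. L2_norm \<Omega> (S n) - L2_norm \<Omega> w) \<longlonglongrightarrow> 0"
    by (rule Lim_null_comparison[OF _ lim]) (use L2_norm_triangle_diff[OF S w] in auto)
  then show "(\<lambda>n. L2_norm \<Omega> (S n)) \<longlonglongrightarrow> L2_norm \<Omega> w" by (rule LIM_zero_cancel)
qed simp

lemma v_pairing_measurable:
  assumes \<phi>: "\<phi> \<in> L2_space \<Omega>"
  shows "(\<lambda>t. indicator {0<..<T} t * ip (v t) \<phi>) \<in> borel_measurable lebesgue"
proof (rule bochner_measurable_compose[where \<Theta> = "\<lambda>w. ip w \<phi>" and X = "L2_space \<Omega>" and nX = "L2_norm \<Omega>"])
  show "bochner_measurable {0<..<T} (L2_space \<Omega>) (L2_norm \<Omega>) v"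
    using v_L2 unfolding bochner_L2_def open_time_ereal by simp
  fix S :: "nat \<Rightarrow> 'a \<Rightarrow> real" and w
  assume S: "\<And>n. S n \<in> L2_space \<Omega>" and w: "w \<in> L2_space \<Omega>" and lim: "(\<lambda>n. L2_norm \<Omega> (\<lambda>x. S n x - w x)) \<longlonglongrightarrow> 0"
  have "(\<lambda>n. ip (S n) \<phi> - ip w \<phi>) \<longlonglongrightarrow> 0"
  proof (rule Lim_null_comparison[OF _ tendsto_mult_left_zero[OF lim]])
    have "norm (ip (S n) \<phi> - ip w \<phi>) \<le> L2_norm \<Omega> (\<lambda>x. S n x - w x) * L2_norm \<Omega> \<phi>" for n
      using L2_Cauchy_Schwarz[OF L2_space_diff[OF S w] \<phi>, of n] L2_integrable_mult[OF S \<phi>] L2_integrable_mult[OF w \<phi>]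
      by (simp add: left_diff_distrib)
    then show "\<forall>\<^sub>F n in sequentially. norm (ip (S n) \<phi> - ip w \<phi>) \<le> L2_norm \<Omega> (\<lambda>x. S n x - w x) * L2_norm \<Omega> \<phi>" by simp
  qed
  then show "(\<lambda>n. ip (S n) \<phi>) \<longlonglongrightarrow> ip w \<phi>" by (rule LIM_zero_cancel)
qed simp

lemma v_norm_sq_integrable: "(\<lambda>t. (L2_norm \<Omega> (v t))\<^sup>2) absolutely_integrable_on {0..T}"
proof -
  have "integrable lebesgue (\<lambda>t. (indicator {0<..<T} t * L2_norm \<Omega> (v t))\<^sup>2)"
  proof (rule integrableI_bounded)
    show "(\<lambda>t. (indicator {0<..<T} t * L2_norm \<Omega> (v t))\<^sup>2) \<in> borel_measurable lebesgue"
      using v_norm_measurable by measurable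
    have "(\<integral>\<^sup>+ x. ennreal (norm ((indicator {0<..<T} x * L2_norm \<Omega> (v x))\<^sup>2)) \<partial>lebesgue)
      = (\<integral>\<^sup>+ t\<in>{0<..<T}. ennreal ((L2_norm \<Omega> (v t))\<^sup>2) \<partial>lebesgue)"
      by (rule nn_integral_cong) (auto simp: indicator_def)
    also have "\<dots> < \<infinity>" using v_L2 unfolding bochner_L2_def open_time_ereal by simp
    finally show "(\<integral>\<^sup>+ x. ennreal (norm ((indicator {0<..<T} x * L2_norm \<Omega> (v x))\<^sup>2)) \<partial>lebesgue) < \<infinity>" .
  qed
  moreover have "(\<lambda>t. (indicator {0<..<T} t * L2_norm \<Omega> (v t))\<^sup>2) = (\<lambda>t. indicator {0<..<T} t *\<^sub>R (L2_norm \<Omega> (v t))\<^sup>2)"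
    by (auto simp: indicator_def)
  ultimately have *: "(\<lambda>t. (L2_norm \<Omega> (v t))\<^sup>2) absolutely_integrable_on {0<..<T}"
    by (simp add: set_integrable_def)
  show ?thesis
    by (rule absolutely_integrable_spike_set[OF *]) (rule negligible_subset[of "{0,T}"], auto)+
qed

lemma v_norm_integrable: "(\<lambda>t. L2_norm \<Omega> (v t)) absolutely_integrable_on {0..T}"
proof -
  have *: "(\<lambda>t. L2_norm \<Omega> (v t)) absolutely_integrable_on {0<..<T}"
    unfolding set_integrable_def
  proof (rule Bochner_Integration.integrable_bound)
    have "(\<lambda>t. (L2_norm \<Omega> (v t))\<^sup>2 + 1) absolutely_integrable_on {0..T}"
      by (intro set_integral_add v_norm_sq_integrable) (auto intro: absolutely_integrable_continuous_real)
    then show "integrable lebesgue (\<lambda>t. indicator {0..T} t *\<^sub>R ((L2_norm \<Omega> (v t))\<^sup>2 + 1))"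
      by (simp add: set_integrable_def)
    show "(\<lambda>x. indicator {0<..<T} x *\<^sub>R L2_norm \<Omega> (v x)) \<in> borel_measurable lebesgue"
      using v_norm_measurable by simp
    have "y \<le> y\<^sup>2 + 1" for y :: real
    proof -
      have "0 \<le> (y - 1/2)\<^sup>2" by simp
      then show ?thesis by (simp add: power2_eq_square algebra_simps)
    qed
    then show "AE x in lebesgue. norm (indicator {0<..<T} x *\<^sub>R L2_norm \<Omega> (v x)) \<le> norm (indicator {0..T} x *\<^sub>R ((L2_norm \<Omega> (v x))\<^sup>2 + 1))"
      by (auto simp: indicator_def L2_norm_nonneg abs_of_nonneg)
  qed
  show ?thesis
    by (rule absolutely_integrable_spike_set[OF *]) (rule negligible_subset[of "{0,T}"], auto)+
qed

lemma v_pairing_integrable: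
  assumes \<phi>: "\<phi> \<in> L2_space \<Omega>"
  shows "(\<lambda>t. ip (v t) \<phi>) absolutely_integrable_on {0..T}"
proof -
  have *: "(\<lambda>t. ip (v t) \<phi>) absolutely_integrable_on {0<..<T}"
    unfolding set_integrable_def
  proof (rule Bochner_Integration.integrable_bound)
    have "(\<lambda>t. L2_norm \<Omega> (v t) * L2_norm \<Omega> \<phi>) absolutely_integrable_on {0..T}"
      using v_norm_integrable by (rule set_integrable_mult_left)
    then show "integrable lebesgue (\<lambda>t. indicator {0..T} t *\<^sub>R (L2_norm \<Omega> (v t) * L2_norm \<Omega> \<phi>))"
      by (simp add: set_integrable_def)
    show "(\<lambda>x. indicator {0<..<T} x *\<^sub>R ip (v x) \<phi>) \<in> borel_measurable lebesgue"
      using v_pairing_measurable[OF \<phi>] by simp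
    show "AE x in lebesgue. norm (indicator {0<..<T} x *\<^sub>R ip (v x) \<phi>) \<le> norm (indicator {0..T} x *\<^sub>R (L2_norm \<Omega> (v x) * L2_norm \<Omega> \<phi>))"
      using v_AE
    proof eventually_elim
      fix t assume t: "t \<in> {0<..<T} \<longrightarrow> v t \<in> L2_space \<Omega>"
      show "norm (indicator {0<..<T} t *\<^sub>R ip (v t) \<phi>) \<le> norm (indicator {0..T} t *\<^sub>R (L2_norm \<Omega> (v t) * L2_norm \<Omega> \<phi>))"
      proof (cases "t \<in> {0<..<T}")
        case True
        then show ?thesis using L2_Cauchy_Schwarz[of "v t" \<Omega> \<phi>] t \<phi> by (simp add: L2_norm_nonneg abs_of_nonneg)
      qed auto
    qed
  qed
  show ?thesis
    by (rule absolutely_integrable_spike_set[OF *]) (rule negligible_subset[of "{0,T}"], auto)+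
qed

text \<open>The weak derivative is tested with \<open>\<phi>\<close> on compact subintervals of \<open>{0<..<T}\<close>; the left endpoint
  \<open>0\<close> is included by continuity of both sides.\<close>

lemma increment:
  assumes \<phi>: "\<phi> \<in> L2_space \<Omega>" and ab: "0 \<le> a" "a \<le> b" "b < T"
  shows "ip (u b) \<phi> - ip (u a) \<phi> = integral {a..b} (\<lambda>t. ip (v t) \<phi>)"
proof -
  let ?q = "\<lambda>t. ip (v t) \<phi>"
  have q: "?q absolutely_integrable_on S" if "S \<subseteq> {0..T}" "S \<in> sets lebesgue" for S
    by (rule set_integrable_subset[OF v_pairing_integrable[OF \<phi>] that(2,1)])
  have int: "?q integrable_on {c..d}" if "0 \<le> c" "d \<le> T" for c d
    using q[of "{c..d}"] that by (auto simp: set_lebesgue_integral_eq_integral(1))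
  have pos: "ip (u b) \<phi> - ip (u a) \<phi> = integral {a..b} ?q" if "0 < a" "a \<le> b" "b < T" for a b
  proof (rule du_Bois_Reymond[where T = "ereal T" and t' = "(b + T) / 2"])
    show "continuous_on {a..(b + T) / 2} (\<lambda>t. ip (u t) \<phi>)"
      by (rule continuous_on_subset[OF pairing_cont[OF \<phi>]]) (use that in auto)
    show "?q absolutely_integrable_on {a..(b + T) / 2}" by (rule q) (use that in auto)
    show "(LINT t:open_time (ereal T)|lebesgue. deriv \<psi> t * ip (u t) \<phi>)
        = - (LINT t:open_time (ereal T)|lebesgue. \<psi> t * ip (v t) \<phi>)" if "test_fun (ereal T) \<psi>" for \<psi>
      using weak \<phi> that unfolding weak_time_deriv_def by blast
  qed (use that in auto)
  show ?thesis
  proof (cases "a = 0 \<and> 0 < b")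
    case False
    then show ?thesis using pos ab by (cases "a = 0") auto
  next
    case True
    define Q where "Q t = integral {0..t} ?q" for t
    have Qc: "continuous_on {0..b} Q"
      unfolding Q_def by (rule indefinite_integral_continuous_1) (use int ab in auto)
    define D where "D t = ip (u b) \<phi> - ip (u t) \<phi> - (Q b - Q t)" for t
    have Dc: "continuous_on {0..b} D"
      unfolding D_def using ab
      by (intro continuous_intros Qc continuous_on_subset[OF pairing_cont[OF \<phi>]]) auto
    have D0: "D t = 0" if "t \<in> {0<..b}" for t
    proof -
      have "Q t + integral {t..b} ?q = Q b"
        unfolding Q_def by (rule Henstock_Kurzweil_Integration.integral_combine) (use that int ab in auto)
      then show ?thesis using pos[of t b] that ab by (simp add: D_def)
    qed
    have "D 0 = 0"
    proof (rule continuous_constant_on_closure[where S = "{0<..<b}" and f = D and x = 0])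
      show "continuous_on (closure {0<..<b}) D" using Dc True by simp
      show "D x = 0" if "x \<in> {0<..<b}" for x using D0[of x] that by simp
      show "0 \<in> closure {0<..<b}" using True by simp
    qed
    then show ?thesis using True by (simp add: D_def Q_def)
  qed
qed

text \<open>The derivative of \<open>\<parallel>u\<parallel>\<^sup>2\<close> is \<open>2 (v, u)\<close>. Over a short interval \<open>{c..e}\<close> the increment of
  \<open>\<parallel>u\<parallel>\<^sup>2\<close> is exactly the integral of \<open>(v, u c + u e)\<close>, and replacing \<open>u c + u e\<close> by \<open>2 u t\<close> costs at
  most \<open>2 \<omega> \<parallel>v\<parallel>\<close>, where \<open>\<omega>\<close> is the oscillation of \<open>u\<close>. The bisection principle of Bolzano adds these
  estimates up. The sign \<open>\<sigma>\<close> covers lower and upper bounds at once; stating bounds instead of the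
  identity avoids integrating \<open>(v, u)\<close> itself.\<close>

lemma norm_sq_increment_ge:
  assumes ab: "0 \<le> a" "a \<le> b" "b < T" and \<sigma>: "\<sigma> = 1 \<or> \<sigma> = - 1"
    and k: "k absolutely_integrable_on {a..b}"
    and le: "AE t in lebesgue. t \<in> {a..b} \<longrightarrow> k t \<le> \<sigma> * ip (v t) (u t)"
  shows "2 * integral {a..b} k \<le> \<sigma> * ((L2_norm \<Omega> (u b))\<^sup>2 - (L2_norm \<Omega> (u a))\<^sup>2)"
proof -
  let ?n = "\<lambda>t. L2_norm \<Omega> (v t)" and ?W = "\<lambda>t. (L2_norm \<Omega> (u t))\<^sup>2"
  have n_int: "?n integrable_on {c..d}" if "a \<le> c" "d \<le> b" for c d
    using set_lebesgue_integral_eq_integral(1)[OF set_integrable_subset[OF v_norm_integrable, of "{c..d}"]] that ab by auto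
  have k_int: "k integrable_on {c..d}" if "a \<le> c" "d \<le> b" for c d
    using set_lebesgue_integral_eq_integral(1)[OF set_integrable_subset[OF k, of "{c..d}"]] that ab by auto
  define N where "N = integral {a..b} ?n"
  have N: "0 \<le> N" unfolding N_def by (rule Henstock_Kurzweil_Integration.integral_nonneg) (use n_int in \<open>auto simp: L2_norm_nonneg\<close>)
  have step: "2 * integral {a..b} k \<le> \<sigma> * (?W b - ?W a) + 2 * \<omega> * N" if \<omega>: "0 < \<omega>" for \<omega>
  proof -
    \<comment> \<open>Such bounds add up over adjacent intervals, as bisection requires.\<close>
    define P where "P c d \<longleftrightarrow> (a \<le> c \<longrightarrow> d \<le> b \<longrightarrow>
      integral {c..d} (\<lambda>t. 2 * k t - 2 * \<omega> * ?n t) \<le> \<sigma> * (?W d - ?W c))" for c d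
    have kn: "(\<lambda>t. 2 * k t - 2 * \<omega> * ?n t) integrable_on {c..d}" if "a \<le> c" "d \<le> b" for c d
      using n_int[OF that] k_int[OF that] by (intro integrable_diff integrable_on_mult_right) auto
    have "P a b"
    proof (rule Bolzano[OF ab(2)])
      fix c d e assume *: "P c d" "P d e" "c \<le> d" "d \<le> e"
      show "P c e" unfolding P_def
      proof (intro impI)
        assume ce: "a \<le> c" "e \<le> b"
        have "integral {c..d} (\<lambda>t. 2 * k t - 2 * \<omega> * ?n t) + integral {d..e} (\<lambda>t. 2 * k t - 2 * \<omega> * ?n t)
          = integral {c..e} (\<lambda>t. 2 * k t - 2 * \<omega> * ?n t)"
          by (rule Henstock_Kurzweil_Integration.integral_combine) (use * ce kn in auto)
        moreover have "integral {c..d} (\<lambda>t. 2 * k t - 2 * \<omega> * ?n t) \<le> \<sigma> * (?W d - ?W c)"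
          "integral {d..e} (\<lambda>t. 2 * k t - 2 * \<omega> * ?n t) \<le> \<sigma> * (?W e - ?W d)"
          using * ce unfolding P_def by auto
        ultimately show "integral {c..e} (\<lambda>t. 2 * k t - 2 * \<omega> * ?n t) \<le> \<sigma> * (?W e - ?W c)"
          by (simp add: right_diff_distrib)
      qed
    next
      fix x assume x: "a \<le> x" "x \<le> b"
      obtain \<delta> where \<delta>: "\<delta> > 0" "\<And>\<tau>. \<tau> \<in> {0..T} \<Longrightarrow> \<bar>\<tau> - x\<bar> < \<delta> \<Longrightarrow> L2_norm \<Omega> (\<lambda>y. u \<tau> y - u x y) < \<omega> / 2"
        using u_cont_on[of x "\<omega>/2"] x ab \<omega> by auto
      show "\<exists>d>0. \<forall>c e. c \<le> x \<and> x \<le> e \<and> e - c < d \<longrightarrow> P c e"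
      proof (intro exI[of _ \<delta>] conjI allI impI \<delta>(1))
        fix c e assume ce: "c \<le> x \<and> x \<le> e \<and> e - c < \<delta>"
        show "P c e" unfolding P_def
        proof (intro impI)
          assume abce: "a \<le> c" "e \<le> b"
          have close: "L2_norm \<Omega> (\<lambda>y. u \<tau> y - u \<rho> y) \<le> \<omega>" if "\<tau> \<in> {c..e}" "\<rho> \<in> {c..e}" for \<tau> \<rho>
          proof -
            have m: "u \<tau> \<in> L2_space \<Omega>" "u \<rho> \<in> L2_space \<Omega>" "u x \<in> L2_space \<Omega>"
              using that abce ab x by (auto intro!: u_L2)
            have "L2_norm \<Omega> (\<lambda>y. u \<tau> y - u \<rho> y) \<le> L2_norm \<Omega> (\<lambda>y. u \<tau> y - u x y) + L2_norm \<Omega> (\<lambda>y. u x y - u \<rho> y)"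
              using L2_norm_triangle[OF L2_space_diff[OF m(1,3)] L2_space_diff[OF m(3,2)]] by simp
            also have "\<dots> \<le> \<omega> / 2 + \<omega> / 2"
            proof (rule add_mono)
              have "\<tau> \<in> {0..T}" "\<bar>\<tau> - x\<bar> < \<delta>" "\<rho> \<in> {0..T}" "\<bar>\<rho> - x\<bar> < \<delta>"
                using that ce abce ab by auto
              from \<delta>(2)[OF this(1,2)] \<delta>(2)[OF this(3,4)]
              show "L2_norm \<Omega> (\<lambda>y. u \<tau> y - u x y) \<le> \<omega> / 2" "L2_norm \<Omega> (\<lambda>y. u x y - u \<rho> y) \<le> \<omega> / 2"
                by (simp_all add: L2_norm_minus_commute[of \<Omega> "u x" "u \<rho>"])
            qed
            finally show ?thesis by simp
          qed
          have cL: "u c \<in> L2_space \<Omega>" and eL: "u e \<in> L2_space \<Omega>" using ce abce ab by (auto intro!: u_L2)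
          define \<phi> where "\<phi> y = u c y + u e y" for y
          have \<phi>: "\<phi> \<in> L2_space \<Omega>" unfolding \<phi>_def using L2_space_add[OF cL eL] .
          have sq: "(L2_norm \<Omega> w)\<^sup>2 = ip w w" for w
            unfolding L2_norm_sq by (simp only: power2_eq_square)
          have "?W e - ?W c = ip (u e) \<phi> - ip (u c) \<phi>"
            using L2_integrable_mult[OF cL cL] L2_integrable_mult[OF eL eL] L2_integrable_mult[OF cL eL] L2_integrable_mult[OF eL cL]
            by (simp add: \<phi>_def distrib_left sq mult.commute)
          also have "\<dots> = integral {c..e} (\<lambda>t. ip (v t) \<phi>)"
            by (rule increment[OF \<phi>]) (use ce abce ab in auto)
          finally have W: "\<sigma> * (?W e - ?W c) = integral {c..e} (\<lambda>t. \<sigma> * ip (v t) \<phi>)" by simp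
          have v\<phi>: "(\<lambda>t. ip (v t) \<phi>) integrable_on {c..e}"
            using set_lebesgue_integral_eq_integral(1)[OF set_integrable_subset[OF v_pairing_integrable[OF \<phi>], of "{c..e}"]]
              abce ab by auto
          have ne0: "AE t in lebesgue. t \<noteq> (0::real)"
            by (rule AE_I'[of "{0}"]) auto
          have bad: "AE t in lebesgue. t \<in> {c..e} \<longrightarrow> 2 * k t - 2 * \<omega> * ?n t \<le> \<sigma> * ip (v t) \<phi>"
            using v_AE le ne0
          proof (eventually_elim, intro impI)
            fix t assume t: "t \<in> {0<..<T} \<longrightarrow> v t \<in> L2_space \<Omega>" "t \<in> {a..b} \<longrightarrow> k t \<le> \<sigma> * ip (v t) (u t)" "t \<noteq> 0"
              and tce: "t \<in> {c..e}"
            have vt: "v t \<in> L2_space \<Omega>" using t tce abce ab by auto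
            have ut: "u t \<in> L2_space \<Omega>" using tce abce ab by (auto intro!: u_L2)
            have kt: "k t \<le> \<sigma> * ip (v t) (u t)" using t tce abce by auto
            have d: "ip (v t) \<phi> = 2 * ip (v t) (u t) + ip (v t) (\<lambda>y. u c y - u t y) + ip (v t) (\<lambda>y. u e y - u t y)"
              using L2_integrable_mult[OF vt ut] L2_integrable_mult[OF vt cL] L2_integrable_mult[OF vt eL]
              by (simp add: \<phi>_def distrib_left right_diff_distrib)
            have "\<bar>ip (v t) (\<lambda>y. u r y - u t y)\<bar> \<le> \<omega> * ?n t" if "r \<in> {c, e}" for r
            proof -
              have "u r \<in> L2_space \<Omega>" "r \<in> {c..e}" using that cL eL ce by auto
              then have "\<bar>ip (v t) (\<lambda>y. u r y - u t y)\<bar> \<le> ?n t * L2_norm \<Omega> (\<lambda>y. u r y - u t y)"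
                by (intro L2_Cauchy_Schwarz[OF vt] L2_space_diff ut) auto
              also have "\<dots> \<le> ?n t * \<omega>" using close[of r t] \<open>r \<in> {c..e}\<close> tce by (intro mult_left_mono) (auto simp: L2_norm_nonneg)
              finally show ?thesis by (simp add: mult.commute)
            qed
            from this[of c] this[of e] show "2 * k t - 2 * \<omega> * ?n t \<le> \<sigma> * ip (v t) \<phi>"
              using \<sigma> kt unfolding d by (auto simp: abs_le_iff algebra_simps)
          qed
          show "integral {c..e} (\<lambda>t. 2 * k t - 2 * \<omega> * ?n t) \<le> \<sigma> * (?W e - ?W c)"
            unfolding W
            by (rule integral_le_AE[OF kn[OF abce] integrable_on_mult_right[OF v\<phi>] bad])
        qed
      qed
    qed
    then have "integral {a..b} (\<lambda>t. 2 * k t - 2 * \<omega> * ?n t) \<le> \<sigma> * (?W b - ?W a)" unfolding P_def by simp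
    moreover have "integral {a..b} (\<lambda>t. 2 * k t - 2 * \<omega> * ?n t) = 2 * integral {a..b} k - 2 * \<omega> * N"
      unfolding N_def using n_int[of a b] k_int[of a b]
      by (subst Henstock_Kurzweil_Integration.integral_diff) (auto intro!: integrable_on_mult_right)
    ultimately show ?thesis by linarith
  qed
  show ?thesis
  proof (rule field_le_epsilon)
    fix e :: real assume e: "0 < e"
    define \<omega> where "\<omega> = e / (2 * (N + 1))"
    have "\<omega> > 0" "2 * \<omega> * N \<le> e" using e N by (auto simp: \<omega>_def field_simps)
    with step[of \<omega>] show "2 * integral {a..b} k \<le> \<sigma> * (?W b - ?W a) + e" by linarith
  qed
qed
end

section \<open>The nonlocal space\<close>

text \<open>A Caratheodory function is jointly measurable, so its integral over an interval is measurable in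
  the parameter.\<close>

lemma measurable_primitive:
  fixes k :: "'b \<Rightarrow> real \<Rightarrow> real"
  assumes k: "\<And>t. (\<lambda>z. k z t) \<in> borel_measurable M"
    and cont: "\<And>z. z \<in> space M \<Longrightarrow> continuous_on UNIV (k z)"
  shows "(\<lambda>z. LBINT \<tau>=0..ereal t. k z \<tau>) \<in> borel_measurable M"
proof -
  have joint: "(\<lambda>p. k (fst p) (snd p)) \<in> borel_measurable (M \<Otimes>\<^sub>M lborel)"
    by (rule caratheodory_measurable[where k = "\<lambda>p. k (fst p)"])
      (use cont in \<open>auto simp: space_pair_measure intro: measurable_compose[OF measurable_fst k]\<close>)
  have "(\<lambda>z. LBINT \<tau>:einterval a b. k z \<tau>) \<in> borel_measurable M" for a b
    unfolding set_lebesgue_integral_def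
  proof (rule lborel.borel_measurable_lebesgue_integral)
    have "(\<lambda>p. indicator (einterval a b) (snd p) *\<^sub>R k (fst p) (snd p)) \<in> borel_measurable (M \<Otimes>\<^sub>M lborel)"
      by (intro borel_measurable_scaleR joint measurable_compose[OF measurable_snd]) auto
    then show "(\<lambda>(z, \<tau>). indicator (einterval a b) \<tau> *\<^sub>R k z \<tau>) \<in> borel_measurable (M \<Otimes>\<^sub>M lborel)"
      by (simp add: split_def)
  qed
  then show ?thesis unfolding interval_lebesgue_integral_def by (simp add: borel_measurable_uminus)
qed

text \<open>A null set times the whole space is a null set.\<close>

lemma AE_lebesgue_fst_snd:
  assumes "AE x in (lebesgue :: 'a::euclidean_space measure). R x"
  shows "AE z in (lebesgue :: ('a \<times> 'a) measure). R (fst z) \<and> R (snd z)"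
proof -
  have "AE x in (lborel :: 'a measure). R x" using assms by (simp add: AE_completion_iff)
  then obtain N :: "'a set" where N: "N \<in> null_sets lborel" "{x. \<not> R x} \<subseteq> N" by (auto simp: eventually_ae_filter)
  have "N \<times> UNIV \<in> null_sets (lborel \<Otimes>\<^sub>M lborel)" "UNIV \<times> N \<in> null_sets (lborel \<Otimes>\<^sub>M lborel)"
    using N(1) by (auto simp: null_sets_def lborel.emeasure_pair_measure_Times)
  then have "N \<times> UNIV \<union> UNIV \<times> N \<in> null_sets (lborel \<Otimes>\<^sub>M lborel)"
    by (rule null_sets.Un)
  then have "N \<times> UNIV \<union> UNIV \<times> N \<in> null_sets (lborel :: ('a \<times> 'a) measure)"
    by (simp only: lborel_prod)
  moreover have "{z. \<not> (R (fst z) \<and> R (snd z))} \<subseteq> N \<times> UNIV \<union> UNIV \<times> N" using N(2) by auto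
  ultimately have "AE z in (lborel :: ('a \<times> 'a) measure). R (fst z) \<and> R (snd z)"
    by (auto simp: eventually_ae_filter)
  then show ?thesis by (rule AE_completion)
qed

text \<open>A Lebesgue measurable function agrees almost everywhere with a Borel function, for which the claim
  is clear; the exceptional set stays null in the product.\<close>

lemma measurable_lebesgue_proj:
  fixes w :: "'a::euclidean_space \<Rightarrow> real"
  assumes w: "w \<in> borel_measurable lebesgue"
  shows "(\<lambda>z. w (fst z)) \<in> borel_measurable (lebesgue :: ('a \<times> 'a) measure)"
    "(\<lambda>z. w (snd z)) \<in> borel_measurable (lebesgue :: ('a \<times> 'a) measure)"
proof -
  obtain w' where w': "w' \<in> borel_measurable lborel" "AE x in lborel. w x = w' x"
    using completion_ex_borel_measurable_real[OF w] by blast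
  have ae: "AE z in (lebesgue :: ('a \<times> 'a) measure). w (fst z) = w' (fst z) \<and> w (snd z) = w' (snd z)"
    by (rule AE_lebesgue_fst_snd[of "\<lambda>x. w x = w' x"]) (use w'(2) in \<open>simp add: AE_completion_iff\<close>)
  have b: "w' \<in> borel_measurable borel" using w'(1) by simp
  have "(\<lambda>z::'a\<times>'a. w' (fst z)) \<in> borel_measurable borel" "(\<lambda>z::'a\<times>'a. w' (snd z)) \<in> borel_measurable borel"
    by (rule measurable_compose[OF _ b], rule borel_measurable_continuous_onI, intro continuous_intros)+
  then have "(\<lambda>z::'a\<times>'a. w' (fst z)) \<in> borel_measurable lebesgue" "(\<lambda>z::'a\<times>'a. w' (snd z)) \<in> borel_measurable lebesgue"
    by (simp_all add: measurable_completion)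
  note m = this
  have ae1: "AE z in (lebesgue :: ('a \<times> 'a) measure). w' (fst z) = w (fst z)"
    using ae by eventually_elim simp
  have ae2: "AE z in (lebesgue :: ('a \<times> 'a) measure). w' (snd z) = w (snd z)"
    using ae by eventually_elim simp
  show "(\<lambda>z. w (fst z)) \<in> borel_measurable (lebesgue :: ('a \<times> 'a) measure)"
    by (rule borel_measurable_AE[OF m(1) ae1])
  show "(\<lambda>z. w (snd z)) \<in> borel_measurable (lebesgue :: ('a \<times> 'a) measure)"
    by (rule borel_measurable_AE[OF m(2) ae2])
qed

locale nonlocal_problem =
  fixes \<Omega> :: "'a::euclidean_space set"
    and g :: "'a \<Rightarrow> 'a \<Rightarrow> real \<Rightarrow> real" and f :: "'a \<Rightarrow> real \<Rightarrow> real"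
    and h1 h2 :: "'a \<Rightarrow> real" and s gm gp \<alpha> :: real
  assumes \<Omega>: "open \<Omega>" "bounded \<Omega>" "\<Omega> \<noteq> {}"
    and g_meas: "\<And>t. (\<lambda>(x, y). g x y t) \<in> borel_measurable lebesgue"
    and g_N: "\<And>x y. N_function (g x y) (G_fun g x y) gm gp"
    and f_meas: "\<And>t. (\<lambda>x. f x t) \<in> borel_measurable (lebesgue_on \<Omega>)"
    and f_source: "\<And>x. x \<in> \<Omega> \<Longrightarrow> source_term (f x) (F_fun f x) (deriv (f x)) (h1 x) (h2 x) \<alpha>"
    and h2_meas: "h2 \<in> borel_measurable (lebesgue_on \<Omega>)"
    and h_bdd: "bounded (h1 ` \<Omega>)" "bounded (h2 ` \<Omega>)"
    and \<alpha>: "2 < \<alpha>" "gp \<le> \<alpha>"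
    and h_range: "2 < (INF x\<in>\<Omega>. h2 x)" "gp < (INF x\<in>\<Omega>. h1 x)"
begin

abbreviation "\<mu> \<equiv> mu_Q \<Omega>"
definition g_pair :: "'a \<times> 'a \<Rightarrow> real \<Rightarrow> real" where "g_pair z = g (fst z) (snd z)"
definition G_pair :: "'a \<times> 'a \<Rightarrow> real \<Rightarrow> real" where "G_pair z = G_fun g (fst z) (snd z)"

sublocale N: N_function "g_pair z" "G_pair z" gm gp for z
  unfolding g_pair_def G_pair_def by (rule g_N)

lemma gp_pos: "0 < gp"
  using N.bounds[of 1 undefined] N.gm by auto

lemma \<Omega>_sets: "\<Omega> \<in> sets lebesgue" using \<Omega>(1) by auto

lemma Q_sets: "Q_set \<Omega> \<in> sets lebesgue"
proof -
  have "closed ((UNIV - \<Omega>) \<times> (UNIV - \<Omega>))" using \<Omega>(1) by (intro closed_Times) (auto simp: Compl_eq_Diff_UNIV[symmetric])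
  then have "open (Q_set \<Omega>)" unfolding Q_set_def by (simp add: Compl_eq_Diff_UNIV[symmetric] open_Compl)
  then show ?thesis by auto
qed

lemma sets_mu: "sets \<mu> = sets (restrict_space lebesgue (Q_set \<Omega>))"
  unfolding mu_Q_def by (rule sets_restrict_space_cong) simp

lemma mu_measurable: "w \<in> borel_measurable lebesgue \<Longrightarrow> (w :: _ \<Rightarrow> real) \<in> borel_measurable \<mu>"
  unfolding measurable_cong_sets[OF sets_mu refl] by (rule measurable_restrict_space1)

lemma kernel_measurable: "(\<lambda>(x, y). ennreal (1 / norm (x - y) ^ DIM('a))) \<in> borel_measurable (lebesgue :: ('a \<times> 'a) measure)"
proof -
  have "(\<lambda>z::'a\<times>'a. ennreal (1 / norm (fst z - snd z) ^ DIM('a))) \<in> borel_measurable (borel \<Otimes>\<^sub>M borel)"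
    by measurable
  then show ?thesis by (simp add: split_def borel_prod measurable_completion)
qed

lemma AE_mu:
  assumes "AE x in lebesgue. R x"
  shows "AE z in \<mu>. R (fst z) \<and> R (snd z)"
proof -
  have "AE z in (lebesgue :: ('a \<times> 'a) measure). R (fst z) \<and> R (snd z)" by (rule AE_lebesgue_fst_snd[OF assms])
  then have "AE z in density lebesgue (\<lambda>(x, y). ennreal (1 / norm (x - y :: 'a) ^ DIM('a))). R (fst z) \<and> R (snd z)"
    by (subst AE_density[OF kernel_measurable]) (auto elim: eventually_mono)
  then show ?thesis unfolding mu_Q_def
    by (subst AE_restrict_space_iff) (use Q_sets in \<open>auto elim: eventually_mono\<close>)
qed

text \<open>For almost every \<open>x\<close> in \<open>\<Omega>\<close> the value \<open>w x\<close> equals \<open>w y\<close> for almost every \<open>y\<close> outside \<open>\<Omega>\<close>,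
  where \<open>w\<close> vanishes; the complement of the bounded set \<open>\<Omega>\<close> is not null.\<close>

lemma AE_Ds_zero:
  assumes D: "AE z in \<mu>. Ds s w z = 0" and out: "AE x in lebesgue. x \<notin> \<Omega> \<longrightarrow> w x = 0"
  shows "AE x in lebesgue. w x = 0"
proof -
  have "AE z in (lebesgue :: ('a \<times> 'a) measure). fst z \<in> \<Omega> \<longrightarrow> snd z \<notin> \<Omega> \<longrightarrow> w (fst z) = w (snd z)"
  proof -
    have "AE z in density lebesgue (\<lambda>(x, y). ennreal (1 / norm (x - y :: 'a) ^ DIM('a))). z \<in> Q_set \<Omega> \<longrightarrow> Ds s w z = 0"
      using D unfolding mu_Q_def by (subst (asm) AE_restrict_space_iff) (use Q_sets in auto)
    then have "AE z in lebesgue. 0 < (case z of (x, y) \<Rightarrow> ennreal (1 / norm (x - y :: 'a) ^ DIM('a))) \<longrightarrow> z \<in> Q_set \<Omega> \<longrightarrow> Ds s w z = 0"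
      by (subst (asm) AE_density[OF kernel_measurable])
    then show ?thesis
    proof eventually_elim
      fix z :: "'a \<times> 'a"
      assume a: "0 < (case z of (x, y) \<Rightarrow> ennreal (1 / norm (x - y) ^ DIM('a))) \<longrightarrow> z \<in> Q_set \<Omega> \<longrightarrow> Ds s w z = 0"
      show "fst z \<in> \<Omega> \<longrightarrow> snd z \<notin> \<Omega> \<longrightarrow> w (fst z) = w (snd z)"
      proof (intro impI)
        assume z: "fst z \<in> \<Omega>" "snd z \<notin> \<Omega>"
        then have "fst z \<noteq> snd z" by auto
        then have "0 < (case z of (x, y) \<Rightarrow> ennreal (1 / norm (x - y) ^ DIM('a)))" "norm (fst z - snd z) powr s > 0"
          by (auto simp: split_def)
        moreover have "z \<in> Q_set \<Omega>" using z by (cases z) (auto simp: Q_set_def)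
        ultimately show "w (fst z) = w (snd z)" using a by (auto simp: Ds_def split_def)
      qed
    qed
  qed
  then have "AE z in (lborel \<Otimes>\<^sub>M lborel :: ('a \<times> 'a) measure). fst z \<in> \<Omega> \<longrightarrow> snd z \<notin> \<Omega> \<longrightarrow> w (fst z) = w (snd z)"
    by (subst lborel_prod) (simp add: AE_completion_iff)
  then have "AE x in lborel. AE y in lborel. x \<in> \<Omega> \<longrightarrow> y \<notin> \<Omega> \<longrightarrow> w x = w y"
    using lborel_pair.AE_pair by fastforce
  moreover have ou: "AE x in lborel. x \<notin> \<Omega> \<longrightarrow> w x = 0" using out by (simp add: AE_completion_iff)
  ultimately have "AE x in lborel. w x = 0"
  proof eventually_elim
    fix x assume a: "AE y in lborel. x \<in> \<Omega> \<longrightarrow> y \<notin> \<Omega> \<longrightarrow> w x = w y" and b: "x \<notin> \<Omega> \<longrightarrow> w x = 0"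
    show "w x = 0"
    proof (rule ccontr)
      assume "w x \<noteq> 0"
      then have "AE y in lborel. y \<in> \<Omega>" using a ou b by (auto elim: eventually_elim2)
      then have "emeasure lborel (UNIV - \<Omega>) = 0"
        using \<Omega>(1) by (subst (asm) AE_iff_measurable[of "UNIV - \<Omega>"]) auto
      moreover have "emeasure lborel (UNIV :: 'a set) \<le> emeasure lborel (UNIV - \<Omega>) + emeasure lborel \<Omega>"
        using \<Omega>(1) by (intro order_trans[OF emeasure_mono emeasure_subadditive]) auto
      moreover have "emeasure lborel \<Omega> < \<infinity>" using \<Omega>(2) by (rule emeasure_bounded_finite)
      ultimately show False by (simp add: emeasure_lborel_UNIV)
    qed
  qed
  then show ?thesis by (rule AE_completion)
qed

lemma g_pair_meas: "(\<lambda>z. g_pair z t) \<in> borel_measurable \<mu>"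
  using mu_measurable[OF g_meas[of t]] by (simp add: g_pair_def split_def)

lemma G_pair_meas: "(\<lambda>z. G_pair z t) \<in> borel_measurable \<mu>"
  unfolding N.G_eq by (rule measurable_primitive) (use g_pair_meas N.cont in auto)

lemma g_pair_comp: "a \<in> borel_measurable \<mu> \<Longrightarrow> (\<lambda>z. g_pair z (a z)) \<in> borel_measurable \<mu>"
  by (rule caratheodory_measurable[OF g_pair_meas N.cont])

lemma G_pair_comp: "a \<in> borel_measurable \<mu> \<Longrightarrow> (\<lambda>z. G_pair z (a z)) \<in> borel_measurable \<mu>"
  by (rule caratheodory_measurable[OF G_pair_meas N.G_cont])

text \<open>By the doubling property of \<open>G\<close>, a function belongs to the Musielak--Orlicz space if and only if
  its own modular is finite, without any rescaling.\<close>

definition finite_modular :: "('a \<times> 'a \<Rightarrow> real) \<Rightarrow> bool" where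
  "finite_modular a \<longleftrightarrow> a \<in> borel_measurable \<mu> \<and> integrable \<mu> (\<lambda>z. G_pair z (a z))"

lemma finite_modular_I: "finite_modular a" if a: "a \<in> borel_measurable \<mu>" and b: "integrable \<mu> b" and le: "\<And>z. G_pair z (a z) \<le> b z"
proof -
  have "integrable \<mu> (\<lambda>z. G_pair z (a z))"
    by (rule Bochner_Integration.integrable_bound[OF b G_pair_comp[OF a]])
      (use le N.G_nonneg in \<open>auto intro!: AE_I2 simp: abs_of_nonneg order_trans[OF _ abs_ge_self]\<close>)
  with a show ?thesis by (simp add: finite_modular_def)
qed

text \<open>Young's inequality with \<open>\<epsilon> = 1\<close> replaces Hoelder's inequality for the conjugate spaces.\<close>

lemma finite_modular_mult:
  assumes a: "finite_modular a" and b: "finite_modular b"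
  shows "integrable \<mu> (\<lambda>z. g_pair z (a z) * b z)"
proof (rule Bochner_Integration.integrable_bound)
  show "integrable \<mu> (\<lambda>z. gp * (G_pair z (a z) + G_pair z (b z)))" using a b by (simp add: finite_modular_def)
  show "(\<lambda>z. g_pair z (a z) * b z) \<in> borel_measurable \<mu>"
    using a b by (intro borel_measurable_times g_pair_comp) (auto simp: finite_modular_def)
  have "\<bar>g_pair z (a z) * b z\<bar> \<le> gp * (G_pair z (a z) + G_pair z (b z))" for z
    using N.young_self[of 1 z "a z" "b z"] N.kt_bounds(2)[of z "a z"] N.kt_bounds(2)[of z "b z"]
    by (simp add: distrib_left)
  then show "AE z in \<mu>. norm (g_pair z (a z) * b z) \<le> norm (gp * (G_pair z (a z) + G_pair z (b z)))"
    by (auto intro!: AE_I2 order_trans[OF _ abs_ge_self])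
qed

lemma finite_modular_scale: "finite_modular (\<lambda>z. l * a z)" if "finite_modular a" "0 < l" "l \<le> 1"
proof (rule finite_modular_I)
  show "integrable \<mu> (\<lambda>z. G_pair z (a z))" "(\<lambda>z. l * a z) \<in> borel_measurable \<mu>" using that by (auto simp: finite_modular_def)
  show "G_pair z (l * a z) \<le> G_pair z (a z)" for z
    by (rule N.G_mono) (use that in \<open>simp add: abs_mult mult_left_le_one_le\<close>)
qed

lemma finite_modular_dilate: "finite_modular (\<lambda>z. l * a z)" if "finite_modular a" "1 \<le> l"
proof (rule finite_modular_I)
  show "integrable \<mu> (\<lambda>z. l powr gp * G_pair z (a z))" "(\<lambda>z. l * a z) \<in> borel_measurable \<mu>" using that by (auto simp: finite_modular_def)
  show "G_pair z (l * a z) \<le> l powr gp * G_pair z (a z)" for z by (rule N.G_dilate[OF that(2)])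
qed

text \<open>Pointwise convergence and a bound on the modulars suffice for convergence of the linear form
  \<open>b \<mapsto> \<integral> g(a) b\<close>, because the modulars of \<open>b\<close> enter with a small factor.\<close>

lemma pairing_conv_test:
  assumes a: "finite_modular a" and bn: "\<And>n. finite_modular (bn n)" and b: "finite_modular b"
    and lim: "AE z in \<mu>. (\<lambda>n. bn n z) \<longlonglongrightarrow> b z"
    and C: "\<And>n. (LINT z|\<mu>. G_pair z (bn n z)) \<le> C"
  shows "(\<lambda>n. LINT z|\<mu>. g_pair z (a z) * bn n z) \<longlonglongrightarrow> (LINT z|\<mu>. g_pair z (a z) * b z)"
proof (rule integral_tendsto_if_bounded[where e = "\<lambda>n z. G_pair z (bn n z)" and C = C])
  show "AE z in \<mu>. (\<lambda>n. g_pair z (a z) * bn n z) \<longlonglongrightarrow> g_pair z (a z) * b z"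
    using lim by eventually_elim (intro tendsto_intros)
  fix \<epsilon> :: real assume \<epsilon>: "0 < \<epsilon>"
  \<comment> \<open>the scale at which the coefficient \<open>gp * d powr (gm - 1)\<close> of the Young inequality is at most \<open>\<epsilon>\<close>\<close>
  define d where "d = min 1 ((\<epsilon> / gp) powr (1 / (gm - 1)))"
  have d: "0 < d" "d \<le> 1" using \<epsilon> gp_pos by (auto simp: d_def)
  have "d powr (gm - 1) \<le> ((\<epsilon> / gp) powr (1 / (gm - 1))) powr (gm - 1)"
    using d N.gm by (intro powr_mono2) (auto simp: d_def)
  also have "\<dots> = \<epsilon> / gp" using \<epsilon> gp_pos N.gm by (simp add: powr_powr)
  finally have d2: "gp * d powr (gm - 1) \<le> \<epsilon>" using gp_pos by (simp add: field_simps)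
  show "\<exists>H. integrable \<mu> H \<and> (\<forall>n. AE z in \<mu>. \<bar>g_pair z (a z) * bn n z\<bar> \<le> H z + \<epsilon> * G_pair z (bn n z))"
  proof (intro exI[of _ "\<lambda>z. g_pair z (a z) * a z / d"] conjI allI AE_I2)
    show "integrable \<mu> (\<lambda>z. g_pair z (a z) * a z / d)" using finite_modular_mult[OF a a] by simp
    fix n z
    have "gp * d powr (gm - 1) * G_pair z (bn n z) \<le> \<epsilon> * G_pair z (bn n z)"
      by (rule mult_right_mono[OF d2 N.G_nonneg])
    then show "\<bar>g_pair z (a z) * bn n z\<bar> \<le> g_pair z (a z) * a z / d + \<epsilon> * G_pair z (bn n z)"
      using N.young_small[OF d, of z "a z" "bn n z"] by linarith
  qed
qed (use assms finite_modular_mult in \<open>auto simp: finite_modular_def N.G_nonneg\<close>)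

text \<open>The same for the nonlinear dependence on \<open>a\<close>: now \<open>b\<close> is fixed, and the terms \<open>g(a) a\<close> enter
  with a small factor.\<close>

lemma pairing_conv_coeff:
  assumes an: "\<And>n. finite_modular (an n)" and a: "finite_modular a" and b: "finite_modular b"
    and lim: "AE z in \<mu>. (\<lambda>n. an n z) \<longlonglongrightarrow> a z"
    and C: "\<And>n. (LINT z|\<mu>. G_pair z (an n z)) \<le> C"
  shows "(\<lambda>n. LINT z|\<mu>. g_pair z (an n z) * b z) \<longlonglongrightarrow> (LINT z|\<mu>. g_pair z (a z) * b z)"
proof (rule integral_tendsto_if_bounded[where e = "\<lambda>n z. g_pair z (an n z) * an n z" and C = "gp * C"])
  show "AE z in \<mu>. (\<lambda>n. g_pair z (an n z) * b z) \<longlonglongrightarrow> g_pair z (a z) * b z"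
    using lim
  proof eventually_elim
    fix z assume "(\<lambda>n. an n z) \<longlonglongrightarrow> a z"
    then have "(\<lambda>n. g_pair z (an n z)) \<longlonglongrightarrow> g_pair z (a z)"
      using N.cont[of z] by (metis continuous_on_eq_continuous_at isCont_tendsto_compose open_UNIV UNIV_I)
    then show "(\<lambda>n. g_pair z (an n z) * b z) \<longlonglongrightarrow> g_pair z (a z) * b z" by (intro tendsto_intros)
  qed
  show "(LINT z|\<mu>. g_pair z (an n z) * an n z) \<le> gp * C" for n
  proof -
    have "(LINT z|\<mu>. g_pair z (an n z) * an n z) \<le> (LINT z|\<mu>. gp * G_pair z (an n z))"
      by (rule integral_mono) (use finite_modular_mult[OF an an] an N.kt_bounds(2) in \<open>auto simp: finite_modular_def\<close>)
    also have "\<dots> \<le> gp * C" using C[of n] gp_pos by simp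
    finally show ?thesis .
  qed
  fix \<epsilon> :: real assume \<epsilon>: "0 < \<epsilon>"
  show "\<exists>H. integrable \<mu> H \<and> (\<forall>n. AE z in \<mu>. \<bar>g_pair z (an n z) * b z\<bar> \<le> H z + \<epsilon> * (g_pair z (an n z) * an n z))"
  proof (intro exI[of _ "\<lambda>z. g_pair z (b z / \<epsilon>) * b z"] conjI allI AE_I2)
    have "finite_modular (\<lambda>z. (1/\<epsilon>) * b z)" using finite_modular_scale[OF b, of "1/\<epsilon>"] finite_modular_dilate[OF b, of "1/\<epsilon>"] \<epsilon> by (cases "\<epsilon> \<le> 1") auto
    from finite_modular_mult[OF this b] show "integrable \<mu> (\<lambda>z. g_pair z (b z / \<epsilon>) * b z)" by simp
    show "\<bar>g_pair z (an n z) * b z\<bar> \<le> g_pair z (b z / \<epsilon>) * b z + \<epsilon> * (g_pair z (an n z) * an n z)" for n z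
      using N.young_self[OF \<epsilon>, of z "an n z" "b z"] by simp
  qed
qed (use assms finite_modular_mult in \<open>auto simp: finite_modular_def N.kt_nonneg\<close>)

lemma Ds_finite_modular: "finite_modular (Ds s w)" if w: "w \<in> W0 s \<Omega> g"
proof -
  have m: "Ds s w \<in> borel_measurable \<mu>" using w by (auto simp: W0_def MO_space_def)
  obtain c where c: "c > 0" "modular \<mu> (\<lambda>(x, y). G_fun g x y) (\<lambda>z. Ds s w z / c) < \<infinity>"
    using w by (auto simp: W0_def MO_space_def)
  have "finite_modular (\<lambda>z. Ds s w z / c)"
    unfolding finite_modular_def
  proof
    show m': "(\<lambda>z. Ds s w z / c) \<in> borel_measurable \<mu>" using m by simp
    show "integrable \<mu> (\<lambda>z. G_pair z (Ds s w z / c))"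
      by (rule integrableI_bounded[OF G_pair_comp[OF m']])
        (use c(2) in \<open>simp add: modular_def split_def G_pair_def[symmetric] N.G_abs N.G_nonneg abs_of_nonneg del: abs_divide\<close>)
  qed
  then have "finite_modular (\<lambda>z. c * (Ds s w z / c))"
    using finite_modular_scale[of "\<lambda>z. Ds s w z / c" c] finite_modular_dilate[of "\<lambda>z. Ds s w z / c" c] c(1) by (cases "c \<le> 1") auto
  then show ?thesis using c(1) by simp
qed

lemma Ds_MO: "finite_modular (Ds s w) \<Longrightarrow> Ds s w \<in> MO_space \<mu> (\<lambda>(x, y). G_fun g x y)"
  unfolding MO_space_def
  by (auto simp: finite_modular_def modular_def split_def G_pair_def[symmetric] N.G_abs intro!: exI[of _ 1] simp: nn_integral_eq_integral N.G_nonneg)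

definition grad_energy :: "('a \<Rightarrow> real) \<Rightarrow> real" where "grad_energy w = (LINT z|\<mu>. G_pair z (Ds s w z))"

lemma grad_energy_nonneg: "0 \<le> grad_energy w" unfolding grad_energy_def by (simp add: N.G_nonneg)

text \<open>The Luxemburg norm is an infimum over scaling factors. This set of factors is not empty, since
  a finite modular is made small by a large factor, and dilation returns to the unscaled modular at the
  cost of a power.\<close>

lemma grad_energy_le_if_W0_norm_le:
  assumes w: "w \<in> W0 s \<Omega> g" and C: "W0_norm s \<Omega> g w \<le> C"
  shows "grad_energy w \<le> (max C 0 + 2) powr gp"
proof -
  let ?S = "{c. c > 0 \<and> modular \<mu> (\<lambda>(x, y). G_fun g x y) (\<lambda>z. Ds s w z / c) \<le> 1}"
  have finite_modular: "finite_modular (Ds s w)" by (rule Ds_finite_modular[OF w])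
  have mod: "modular \<mu> (\<lambda>(x, y). G_fun g x y) (\<lambda>z. Ds s w z / c) = ennreal (LINT z|\<mu>. G_pair z (Ds s w z / c))" if "c > 0" for c
  proof -
    have "finite_modular (\<lambda>z. (1/c) * Ds s w z)"
      using finite_modular_scale[OF finite_modular, of "1/c"] finite_modular_dilate[OF finite_modular, of "1/c"] that by (cases "c \<ge> 1") auto
    then show ?thesis
      by (simp add: modular_def split_def G_pair_def[symmetric] N.G_abs finite_modular_def nn_integral_eq_integral N.G_nonneg del: abs_divide)
  qed
  have "?S \<noteq> {}"
  proof -
    define c where "c = grad_energy w + 1"
    have c: "c \<ge> 1" using grad_energy_nonneg by (simp add: c_def)
    have "(LINT z|\<mu>. G_pair z (Ds s w z / c)) \<le> (LINT z|\<mu>. G_pair z (Ds s w z) / c)"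
    proof (rule integral_mono)
      show "integrable \<mu> (\<lambda>z. G_pair z (Ds s w z / c))"
        using finite_modular_scale[OF finite_modular, of "1/c"] c by (simp add: finite_modular_def)
      show "integrable \<mu> (\<lambda>z. G_pair z (Ds s w z) / c)" using finite_modular by (simp add: finite_modular_def)
    qed (rule N.G_contract[OF c])
    also have "\<dots> = grad_energy w / c" by (simp add: grad_energy_def)
    also have "\<dots> \<le> 1" using grad_energy_nonneg[of w] by (simp add: c_def divide_le_eq)
    finally have "c \<in> ?S" using c by (simp add: mod)
    then show ?thesis by blast
  qed
  moreover have "Inf ?S < max C 0 + 1" using C by (simp add: W0_norm_def lux_norm_def)
  ultimately obtain c where c: "c \<in> ?S" "c < max C 0 + 1" by (rule cInf_lessD[THEN bexE]) blast
  have fc: "integrable \<mu> (\<lambda>z. G_pair z (Ds s w z / c))"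
  proof -
    have "finite_modular (\<lambda>z. (1/c) * Ds s w z)"
      using finite_modular_scale[OF finite_modular, of "1/c"] finite_modular_dilate[OF finite_modular, of "1/c"] c by (cases "c \<ge> 1") auto
    then show ?thesis by (simp add: finite_modular_def)
  qed
  define m where "m = max C 0 + 2"
  have m: "m \<ge> 1" "c \<le> m" using c by (auto simp: m_def)
  have "grad_energy w \<le> (LINT z|\<mu>. m powr gp * G_pair z (Ds s w z / c))"
    unfolding grad_energy_def
  proof (rule integral_mono)
    fix z
    have "G_pair z (Ds s w z) \<le> G_pair z (m * (Ds s w z / c))"
    proof (rule N.G_mono)
      have "\<bar>Ds s w z\<bar> * 1 \<le> \<bar>Ds s w z\<bar> * (m / c)" using c m by (intro mult_left_mono) auto
      then show "\<bar>Ds s w z\<bar> \<le> \<bar>m * (Ds s w z / c)\<bar>" using c m by (simp add: abs_mult mult.commute)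
    qed
    also have "\<dots> \<le> m powr gp * G_pair z (Ds s w z / c)" by (rule N.G_dilate[OF m(1)])
    finally show "G_pair z (Ds s w z) \<le> m powr gp * G_pair z (Ds s w z / c)" .
  qed (use finite_modular fc in \<open>auto simp: finite_modular_def\<close>)
  also have "\<dots> \<le> m powr gp * 1"
    using c mod[of c] by (simp only: Bochner_Integration.integral_mult_right_zero) (rule mult_left_mono, auto)
  finally show ?thesis by (simp add: m_def)
qed

text \<open>The functions \<open>x \<mapsto> g x x t\<close> live on the diagonal, a null set of the product, and may fail to be
  measurable; the modular of a sum is then not controlled by the modulars of the summands. Hence \<open>w\<close> is
  dominated by the single function \<open>w1\<close>, whereas the difference quotient may be dominated by a sum.\<close>

lemma W0_I:
  assumes w: "w \<in> borel_measurable lebesgue" and out: "AE x in lebesgue. x \<notin> \<Omega> \<longrightarrow> w x = 0"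
    and w1: "w1 \<in> W0 s \<Omega> g" and le1: "\<And>x. \<bar>w x\<bar> \<le> \<bar>w1 x\<bar>"
    and w2: "w2 \<in> W0 s \<Omega> g" and le2: "\<And>z. \<bar>Ds s w z\<bar> \<le> \<bar>Ds s w1 z\<bar> + \<bar>Ds s w2 z\<bar>"
  shows "w \<in> W0 s \<Omega> g" "grad_energy w \<le> 2 powr gp * (grad_energy w1 + grad_energy w2)"
proof -
  obtain c where c: "c > 0" "modular lebesgue (G_hat g) (\<lambda>x. w1 x / c) < \<infinity>"
    using w1 by (auto simp: W0_def MO_space_def)
  have "modular lebesgue (G_hat g) (\<lambda>x. w x / c) \<le> modular lebesgue (G_hat g) (\<lambda>x. w1 x / c)"
    unfolding modular_def
  proof (intro nn_integral_mono ennreal_leI)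
    fix x
    have "G_pair (x, x) (\<bar>w x / c\<bar>) \<le> G_pair (x, x) (\<bar>w1 x / c\<bar>)"
      by (rule N.G_mono) (use le1[of x] c in \<open>simp add: divide_right_mono\<close>)
    then show "G_hat g x \<bar>w x / c\<bar> \<le> G_hat g x \<bar>w1 x / c\<bar>" by (simp add: G_hat_def G_pair_def)
  qed
  with c have 1: "w \<in> MO_space lebesgue (G_hat g)"
    using w by (auto simp: MO_space_def intro: le_less_trans)
  have bound: "G_pair z (Ds s w z) \<le> 2 powr gp * (G_pair z (Ds s w1 z) + G_pair z (Ds s w2 z))" for z
  proof -
    have "G_pair z (Ds s w z) \<le> G_pair z (\<bar>Ds s w1 z\<bar> + \<bar>Ds s w2 z\<bar>)" by (rule N.G_mono) (use le2[of z] in simp)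
    also have "\<dots> \<le> 2 powr gp * (G_pair z \<bar>Ds s w1 z\<bar> + G_pair z \<bar>Ds s w2 z\<bar>)" by (rule N.G_add)
    finally show ?thesis by (simp add: N.G_abs)
  qed
  have i: "integrable \<mu> (\<lambda>z. G_pair z (Ds s w1 z))" "integrable \<mu> (\<lambda>z. G_pair z (Ds s w2 z))"
    using Ds_finite_modular[OF w1] Ds_finite_modular[OF w2] by (auto simp: finite_modular_def)
  have "(\<lambda>z. w (fst z)) \<in> borel_measurable \<mu>" "(\<lambda>z. w (snd z)) \<in> borel_measurable \<mu>"
    by (rule mu_measurable, rule measurable_lebesgue_proj[OF w])+
  moreover have "(\<lambda>z. norm (fst z - snd z) powr s) \<in> borel_measurable \<mu>"
  proof (rule mu_measurable)
    have "(\<lambda>z::'a\<times>'a. norm (fst z - snd z) powr s) \<in> borel_measurable (borel \<Otimes>\<^sub>M borel)" by measurable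
    then show "(\<lambda>z::'a\<times>'a. norm (fst z - snd z) powr s) \<in> borel_measurable lebesgue"
      by (simp add: borel_prod measurable_completion)
  qed
  ultimately have m: "Ds s w \<in> borel_measurable \<mu>" unfolding Ds_def split_def by measurable
  have fw: "finite_modular (Ds s w)"
    by (rule finite_modular_I[OF m _ bound]) (use i in auto)
  show "w \<in> W0 s \<Omega> g" using 1 out Ds_MO[OF fw] by (simp add: W0_def)
  have "grad_energy w \<le> (LINT z|\<mu>. 2 powr gp * (G_pair z (Ds s w1 z) + G_pair z (Ds s w2 z)))"
    unfolding grad_energy_def by (rule integral_mono[OF _ _ bound]) (use fw i in \<open>auto simp: finite_modular_def\<close>)
  also have "\<dots> = 2 powr gp * (grad_energy w1 + grad_energy w2)" using i by (simp add: grad_energy_def)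
  finally show "grad_energy w \<le> 2 powr gp * (grad_energy w1 + grad_energy w2)" .
qed

lemma W0_D:
  assumes "w \<in> W0 s \<Omega> g"
  shows "w \<in> borel_measurable lebesgue" "AE x in lebesgue. x \<notin> \<Omega> \<longrightarrow> w x = 0"
  using assms by (auto simp: W0_def MO_space_def)

lemma W0_scale: "(\<lambda>x. l * w x) \<in> W0 s \<Omega> g" if w: "w \<in> W0 s \<Omega> g" and l: "0 < l"
proof -
  obtain c where c: "c > 0" "modular lebesgue (G_hat g) (\<lambda>x. w x / c) < \<infinity>"
    using w by (auto simp: W0_def MO_space_def)
  have "modular lebesgue (G_hat g) (\<lambda>x. l * w x / (l * c)) < \<infinity>" using c l by simp
  moreover have "l * c > 0" using c l by simp
  ultimately have 1: "(\<lambda>x. l * w x) \<in> MO_space lebesgue (G_hat g)"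
    using W0_D(1)[OF w] unfolding MO_space_def by (auto intro!: exI[of _ "l * c"])
  have D: "Ds s (\<lambda>x. l * w x) = (\<lambda>z. l * Ds s w z)" by (auto simp: Ds_def fun_eq_iff algebra_simps)
  have "finite_modular (\<lambda>z. l * Ds s w z)"
    using finite_modular_scale[OF Ds_finite_modular[OF w]] finite_modular_dilate[OF Ds_finite_modular[OF w]] l by (cases "l \<le> 1") auto
  then show ?thesis using 1 W0_D(2)[OF w] Ds_MO[of "\<lambda>x. l * w x"] by (auto simp: W0_def D elim: eventually_mono)
qed

definition signed_part :: "real \<Rightarrow> ('a \<Rightarrow> real) \<Rightarrow> 'a \<Rightarrow> real" where "signed_part \<sigma> w x = max 0 (\<sigma> * w x)"

text \<open>For \<open>\<sigma> = 1\<close> this is the minimum of the positive parts of \<open>w\<close> and \<open>w'\<close>, for \<open>\<sigma> = - 1\<close> the minimum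
  of the negative parts. Such functions are the test functions that lead to the solution itself.\<close>

definition common_part :: "real \<Rightarrow> ('a \<Rightarrow> real) \<Rightarrow> ('a \<Rightarrow> real) \<Rightarrow> 'a \<Rightarrow> real" where
  "common_part \<sigma> w w' x = min (signed_part \<sigma> w x) (signed_part \<sigma> w' x)"

lemma common_part_W0:
  assumes w: "w \<in> W0 s \<Omega> g" "w' \<in> W0 s \<Omega> g" and \<sigma>: "\<bar>\<sigma>\<bar> = 1"
  shows "common_part \<sigma> w w' \<in> W0 s \<Omega> g" "grad_energy (common_part \<sigma> w w') \<le> 2 powr gp * (grad_energy w + grad_energy w')"
proof -
  have m: "common_part \<sigma> w w' \<in> borel_measurable lebesgue"
    unfolding common_part_def[abs_def] signed_part_def using W0_D(1)[OF w(1)] W0_D(1)[OF w(2)] by measurable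
  have out: "AE x in lebesgue. x \<notin> \<Omega> \<longrightarrow> common_part \<sigma> w w' x = 0"
    using W0_D(2)[OF w(1)] by eventually_elim (auto simp: common_part_def signed_part_def)
  have le: "\<bar>common_part \<sigma> w w' x\<bar> \<le> \<bar>w x\<bar>" for x
    using \<sigma> by (auto simp: common_part_def signed_part_def abs_if split: if_splits)
  have "\<bar>common_part \<sigma> w w' x - common_part \<sigma> w w' y\<bar> \<le> \<bar>w x - w y\<bar> + \<bar>w' x - w' y\<bar>" for x y
    using \<sigma> by (auto simp: common_part_def signed_part_def min_def max_def abs_if split: if_splits)
  then have "\<bar>Ds s (common_part \<sigma> w w') z\<bar> \<le> \<bar>Ds s w z\<bar> + \<bar>Ds s w' z\<bar>" for z
    by (auto simp: Ds_def split_def abs_divide add_divide_distrib[symmetric] intro!: divide_right_mono)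
  from W0_I[OF m out w(1) le w(2) this] show "common_part \<sigma> w w' \<in> W0 s \<Omega> g" "grad_energy (common_part \<sigma> w w') \<le> 2 powr gp * (grad_energy w + grad_energy w')" .
qed

lemma Ds_tendsto:
  assumes "AE x in lebesgue. (\<lambda>n. wn n x) \<longlonglongrightarrow> w x"
  shows "AE z in \<mu>. (\<lambda>n. Ds s (wn n) z) \<longlonglongrightarrow> Ds s w z"
  using AE_mu[OF assms] by eventually_elim (auto simp: Ds_def split_def divide_inverse intro!: tendsto_intros)

lemma AE_lebesgue_if_AE_on:
  assumes "AE x in lebesgue_on \<Omega>. R x" "AE x in lebesgue. x \<notin> \<Omega> \<longrightarrow> R x"
  shows "AE x in lebesgue. R x"
proof -
  have "AE x in lebesgue. x \<in> \<Omega> \<longrightarrow> R x" using assms(1) \<Omega>_sets by (subst (asm) AE_restrict_space_iff) auto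
  with assms(2) show ?thesis by eventually_elim blast
qed

lemma AE_on_if_AE_lebesgue: "AE x in lebesgue. R x \<Longrightarrow> AE x in lebesgue_on \<Omega>. R x"
  using \<Omega>_sets by (subst AE_restrict_space_iff) (auto elim: eventually_mono)

lemma h2_gt2: "2 < h2 x" if "x \<in> \<Omega>"
  using h_range(1) cINF_lower[OF bounded_imp_bdd_below[OF h_bdd(2)] that] by linarith

text \<open>The exponents exceed \<open>2\<close> and \<open>\<Omega>\<close> has finite measure, so \<open>t\<^sup>2 \<le> 1 + t powr h2 x\<close> bounds the square
  integral by the modular.\<close>

lemma L_Phi_L2_aux:
  assumes w: "w \<in> borel_measurable (lebesgue_on \<Omega>)" and c: "0 < c"
    and mod: "modular (lebesgue_on \<Omega>) (Phi_fun h2) (\<lambda>x. w x / c) \<le> ennreal K" and K: "0 \<le> K"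
  shows "w \<in> L2_space \<Omega>" "(L2_norm \<Omega> w)\<^sup>2 \<le> c\<^sup>2 * (measure lebesgue \<Omega> + K)"
proof -
  have fm: "emeasure lebesgue \<Omega> < \<infinity>"
    using fmeasurableD2[OF bounded_set_imp_lmeasurable[OF \<Omega>(2) \<Omega>_sets]] by (simp add: less_top)
  have "emeasure (lebesgue_on \<Omega>) (space (lebesgue_on \<Omega>)) = emeasure lebesgue \<Omega>"
    using \<Omega>_sets by (simp add: emeasure_restrict_space)
  also have "\<dots> = ennreal (measure lebesgue \<Omega>)"
    by (rule emeasure_eq_ennreal_measure) (use fm in auto)
  finally have em: "emeasure (lebesgue_on \<Omega>) (space (lebesgue_on \<Omega>)) = ennreal (measure lebesgue \<Omega>)" .
  have le: "t\<^sup>2 \<le> c\<^sup>2 * (1 + Phi_fun h2 x \<bar>t / c\<bar>)" if "x \<in> \<Omega>" for x t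
  proof -
    have "(t/c)\<^sup>2 \<le> 1 + \<bar>t/c\<bar> powr h2 x"
    proof (cases "\<bar>t/c\<bar> \<le> 1")
      case True
      then have "(t/c)\<^sup>2 \<le> 1" by (simp add: abs_square_le_1)
      then show ?thesis by (simp add: add_increasing2)
    next
      case False
      then have "\<bar>t/c\<bar> powr 2 \<le> \<bar>t/c\<bar> powr h2 x" using h2_gt2[OF that] by (intro powr_mono) auto
      moreover have "\<bar>t/c\<bar> powr 2 = (t/c)\<^sup>2" using False by (simp add: powr_numeral del: abs_divide)
      ultimately show ?thesis by linarith
    qed
    then have "c\<^sup>2 * (t/c)\<^sup>2 \<le> c\<^sup>2 * (1 + \<bar>t/c\<bar> powr h2 x)" by (rule mult_left_mono) simp
    then show ?thesis using c by (simp add: Phi_fun_def power_divide)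
  qed
  have pm: "(\<lambda>x. Phi_fun h2 x \<bar>w x / c\<bar>) \<in> borel_measurable (lebesgue_on \<Omega>)"
    unfolding Phi_fun_def using w h2_meas by measurable
  have "(\<integral>\<^sup>+x. ennreal ((w x)\<^sup>2) \<partial>lebesgue_on \<Omega>) \<le> (\<integral>\<^sup>+x. ennreal (c\<^sup>2) * (1 + ennreal (Phi_fun h2 x \<bar>w x / c\<bar>)) \<partial>lebesgue_on \<Omega>)"
  proof (rule nn_integral_mono)
    fix x assume "x \<in> space (lebesgue_on \<Omega>)"
    then have "ennreal ((w x)\<^sup>2) \<le> ennreal (c\<^sup>2 * (1 + Phi_fun h2 x \<bar>w x / c\<bar>))" by (intro ennreal_leI le) simp
    also have "\<dots> = ennreal (c\<^sup>2) * (1 + ennreal (Phi_fun h2 x \<bar>w x / c\<bar>))"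
      by (simp add: ennreal_mult ennreal_plus Phi_fun_def)
    finally show "ennreal ((w x)\<^sup>2) \<le> ennreal (c\<^sup>2) * (1 + ennreal (Phi_fun h2 x \<bar>w x / c\<bar>))" .
  qed
  also have "\<dots> = ennreal (c\<^sup>2) * (emeasure (lebesgue_on \<Omega>) (space (lebesgue_on \<Omega>)) + modular (lebesgue_on \<Omega>) (Phi_fun h2) (\<lambda>x. w x / c))"
    using pm by (simp add: nn_integral_cmult nn_integral_add modular_def)
  also have "\<dots> \<le> ennreal (c\<^sup>2) * (ennreal (measure lebesgue \<Omega>) + ennreal K)"
    unfolding em by (intro mult_left_mono add_mono mod order_refl) simp
  also have "\<dots> = ennreal (c\<^sup>2 * (measure lebesgue \<Omega> + K))" using K by (simp add: ennreal_mult ennreal_plus)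
  finally have b: "(\<integral>\<^sup>+x. ennreal ((w x)\<^sup>2) \<partial>lebesgue_on \<Omega>) \<le> ennreal (c\<^sup>2 * (measure lebesgue \<Omega> + K))" .
  have i: "integrable (lebesgue_on \<Omega>) (\<lambda>x. (w x)\<^sup>2)"
    by (rule integrableI_bounded) (use w b in \<open>auto intro: le_less_trans\<close>)
  then show "w \<in> L2_space \<Omega>" using w by (simp add: L2_space_def)
  have "ennreal ((L2_norm \<Omega> w)\<^sup>2) \<le> ennreal (c\<^sup>2 * (measure lebesgue \<Omega> + K))"
    using b i by (simp add: L2_norm_sq nn_integral_eq_integral)
  then show "(L2_norm \<Omega> w)\<^sup>2 \<le> c\<^sup>2 * (measure lebesgue \<Omega> + K)" using K by simp
qed

lemma Phi_meas: "(\<lambda>x. Phi_fun h2 x \<bar>w x / c\<bar>) \<in> borel_measurable (lebesgue_on \<Omega>)"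
  if "w \<in> borel_measurable (lebesgue_on \<Omega>)"
  unfolding Phi_fun_def using that h2_meas by measurable

lemma L_Phi_L2: "w \<in> L2_space \<Omega>" if wL: "w \<in> L_Phi \<Omega> h2"
proof -
  obtain c where c: "c > 0" "modular (lebesgue_on \<Omega>) (Phi_fun h2) (\<lambda>x. w x / c) < \<infinity>"
    and w: "w \<in> borel_measurable (lebesgue_on \<Omega>)"
    using wL by (auto simp: L_Phi_def MO_space_def)
  then show ?thesis
    by (intro L_Phi_L2_aux(1)[OF w c(1), where K = "enn2real (modular (lebesgue_on \<Omega>) (Phi_fun h2) (\<lambda>x. w x / c))"]) auto
qed

lemma L_Phi_diff: "(\<lambda>x. a x - b x) \<in> L_Phi \<Omega> h2" if a: "a \<in> L_Phi \<Omega> h2" and b: "b \<in> L_Phi \<Omega> h2"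
proof -
  obtain c d where c: "c > 0" "modular (lebesgue_on \<Omega>) (Phi_fun h2) (\<lambda>x. a x / c) < \<infinity>" "a \<in> borel_measurable (lebesgue_on \<Omega>)"
    and d: "d > 0" "modular (lebesgue_on \<Omega>) (Phi_fun h2) (\<lambda>x. b x / d) < \<infinity>" "b \<in> borel_measurable (lebesgue_on \<Omega>)"
    using a b by (auto simp: L_Phi_def MO_space_def)
  have "modular (lebesgue_on \<Omega>) (Phi_fun h2) (\<lambda>x. (a x - b x) / (c + d))
    \<le> (\<integral>\<^sup>+x. ennreal (Phi_fun h2 x \<bar>a x / c\<bar>) + ennreal (Phi_fun h2 x \<bar>b x / d\<bar>) \<partial>lebesgue_on \<Omega>)"
    unfolding modular_def
  proof (rule nn_integral_mono)
    fix x assume "x \<in> space (lebesgue_on \<Omega>)"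
    then have h: "h2 x > 0" using h2_gt2[of x] by simp
    define m where "m = max \<bar>a x / c\<bar> \<bar>b x / d\<bar>"
    have "\<bar>a x\<bar> \<le> c * m" "\<bar>b x\<bar> \<le> d * m"
    proof -
      have "\<bar>a x\<bar> / c \<le> m" "\<bar>b x\<bar> / d \<le> m" using c d by (auto simp: m_def)
      then show "\<bar>a x\<bar> \<le> c * m" "\<bar>b x\<bar> \<le> d * m" using c d by (simp_all add: pos_divide_le_eq mult.commute)
    qed
    then have "\<bar>a x - b x\<bar> \<le> (c + d) * m" by (simp add: distrib_right)
    then have "\<bar>(a x - b x) / (c + d)\<bar> \<le> m" using c d by (simp add: pos_divide_le_eq mult.commute)
    then have "\<bar>(a x - b x) / (c + d)\<bar> powr h2 x \<le> m powr h2 x" using h by (intro powr_mono2) auto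
    also have "\<dots> \<le> \<bar>a x / c\<bar> powr h2 x + \<bar>b x / d\<bar> powr h2 x" by (auto simp: m_def max_def)
    finally show "ennreal (Phi_fun h2 x \<bar>(a x - b x) / (c + d)\<bar>) \<le> ennreal (Phi_fun h2 x \<bar>a x / c\<bar>) + ennreal (Phi_fun h2 x \<bar>b x / d\<bar>)"
      unfolding Phi_fun_def by (simp add: ennreal_plus[symmetric] ennreal_leI del: ennreal_plus abs_divide)
  qed
  also have "\<dots> = modular (lebesgue_on \<Omega>) (Phi_fun h2) (\<lambda>x. a x / c) + modular (lebesgue_on \<Omega>) (Phi_fun h2) (\<lambda>x. b x / d)"
    unfolding modular_def
    by (intro nn_integral_add measurable_compose[OF _ measurable_ennreal] Phi_meas c d)
  also have "\<dots> < \<infinity>" using c d by simp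
  finally have "modular (lebesgue_on \<Omega>) (Phi_fun h2) (\<lambda>x. (a x - b x) / (c + d)) < \<infinity>" .
  then show ?thesis using c d by (auto simp: L_Phi_def MO_space_def intro!: exI[of _ "c + d"])
qed

lemma L2_norm_le_L_Phi_norm:
  assumes w: "w \<in> L_Phi \<Omega> h2" and lt: "L_Phi_norm \<Omega> h2 w < e"
  shows "L2_norm \<Omega> w \<le> e * sqrt (measure lebesgue \<Omega> + 1)"
proof -
  let ?S = "{c. c > 0 \<and> modular (lebesgue_on \<Omega>) (Phi_fun h2) (\<lambda>x. w x / c) \<le> 1}"
  obtain c where c: "c > 0" "modular (lebesgue_on \<Omega>) (Phi_fun h2) (\<lambda>x. w x / c) < \<infinity>"
    and wm: "w \<in> borel_measurable (lebesgue_on \<Omega>)"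
    using w by (auto simp: L_Phi_def MO_space_def)
  define m where "m = enn2real (modular (lebesgue_on \<Omega>) (Phi_fun h2) (\<lambda>x. w x / c))"
  have m: "m \<ge> 0" "modular (lebesgue_on \<Omega>) (Phi_fun h2) (\<lambda>x. w x / c) = ennreal m" using c by (auto simp: m_def)
  have "modular (lebesgue_on \<Omega>) (Phi_fun h2) (\<lambda>x. w x / (c * (m + 1)))
    \<le> (\<integral>\<^sup>+x. ennreal (1 / (m + 1)) * ennreal (Phi_fun h2 x \<bar>w x / c\<bar>) \<partial>lebesgue_on \<Omega>)"
    unfolding modular_def
  proof (rule nn_integral_mono)
    fix x assume "x \<in> space (lebesgue_on \<Omega>)"
    then have h: "h2 x > 2" using h2_gt2[of x] by simp
    have "\<bar>w x / (c * (m + 1))\<bar> powr h2 x = (1 / (m + 1)) powr h2 x * \<bar>w x / c\<bar> powr h2 x"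
      using m(1) c(1) by (simp add: powr_mult[symmetric] abs_mult mult_ac)
    also have "\<dots> \<le> (1 / (m + 1)) powr 1 * \<bar>w x / c\<bar> powr h2 x"
      using h m(1) by (intro mult_right_mono powr_mono') auto
    finally show "ennreal (Phi_fun h2 x \<bar>w x / (c * (m + 1))\<bar>) \<le> ennreal (1 / (m + 1)) * ennreal (Phi_fun h2 x \<bar>w x / c\<bar>)"
      unfolding Phi_fun_def using m(1) by (subst ennreal_mult[symmetric]) (auto intro!: ennreal_leI)
  qed
  also have "\<dots> = ennreal (1 / (m + 1)) * ennreal m"
    unfolding m(2)[symmetric] modular_def
    by (intro nn_integral_cmult measurable_compose[OF _ measurable_ennreal] Phi_meas wm)
  also have "\<dots> = ennreal (m / (m + 1))" using m(1) by (simp add: ennreal_mult[symmetric])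
  also have "\<dots> \<le> 1" using m(1) by (simp add: ennreal_le_1 divide_le_eq)
  finally have "c * (m + 1) \<in> ?S" using c m(1) by simp
  then have "?S \<noteq> {}" by blast
  moreover have "Inf ?S < e" using lt by (simp add: L_Phi_norm_def lux_norm_def)
  ultimately obtain c where c: "c \<in> ?S" "c < e" by (rule cInf_lessD[THEN bexE]) blast
  then have "(L2_norm \<Omega> w)\<^sup>2 \<le> c\<^sup>2 * (measure lebesgue \<Omega> + 1)"
    by (intro L_Phi_L2_aux(2)[OF wm]) auto
  then have "L2_norm \<Omega> w \<le> sqrt (c\<^sup>2 * (measure lebesgue \<Omega> + 1))"
    by (rule real_le_rsqrt)
  also have "\<dots> = c * sqrt (measure lebesgue \<Omega> + 1)" using c by (simp add: real_sqrt_mult)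
  also have "\<dots> \<le> e * sqrt (measure lebesgue \<Omega> + 1)" using c by (intro mult_right_mono) auto
  finally show ?thesis .
qed

end

section \<open>The potential well\<close>

context nonlocal_problem begin

lemma F_cont: "x \<in> \<Omega> \<Longrightarrow> continuous_on UNIV (F_fun f x)"
  using source_term.F_deriv[OF f_source] by (meson DERIV_continuous_on DERIV_subset UNIV_I subset_UNIV)

lemma f_comp: "w \<in> borel_measurable (lebesgue_on \<Omega>) \<Longrightarrow> (\<lambda>x. f x (w x)) \<in> borel_measurable (lebesgue_on \<Omega>)"
  by (rule caratheodory_measurable[OF f_meas]) (use source_term.f_cont[OF f_source] in auto)

lemma F_comp:
  assumes w: "w \<in> borel_measurable (lebesgue_on \<Omega>)"
  shows "(\<lambda>x. F_fun f x (w x)) \<in> borel_measurable (lebesgue_on \<Omega>)"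
proof (rule caratheodory_measurable[OF _ _ w])
  show "(\<lambda>x. F_fun f x t) \<in> borel_measurable (lebesgue_on \<Omega>)" for t
    unfolding F_fun_def by (rule measurable_primitive) (use f_meas source_term.f_cont[OF f_source] in auto)
qed (use F_cont in auto)

lemma F_nonneg: "x \<in> \<Omega> \<Longrightarrow> 0 \<le> F_fun f x t"
  by (rule source_term.F_nonneg[OF f_source])

lemma ft_nonneg: "x \<in> \<Omega> \<Longrightarrow> 0 \<le> f x t * t"
  by (rule source_term.ft_nonneg[OF f_source])

text \<open>Integrability of \<open>F(x, w)\<close> is an additional condition: \<open>F(x, 1)\<close> may be unbounded in \<open>x\<close>, and
  the integral of a function that is not integrable would be \<open>0\<close>.\<close>

definition admissible :: "('a \<Rightarrow> real) \<Rightarrow> bool" where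
  "admissible w \<longleftrightarrow> w \<in> W0 s \<Omega> g \<and> integrable (lebesgue_on \<Omega>) (\<lambda>x. F_fun f x (w x))"

abbreviation "E \<equiv> energy_E s \<Omega> g f"
abbreviation "I \<equiv> nehari_I s \<Omega> g f"
abbreviation "d \<equiv> depth_d s \<Omega> g f"
definition "source_energy w = (LINT x|lebesgue_on \<Omega>. F_fun f x (w x))"
definition "h2_sup = (SUP x\<in>\<Omega>. h2 x)"

lemma h2_sup: "x \<in> \<Omega> \<Longrightarrow> h2 x \<le> h2_sup" "1 \<le> h2_sup"
proof -
  show *: "h2 x \<le> h2_sup" if "x \<in> \<Omega>" for x
    unfolding h2_sup_def by (rule cSUP_upper[OF that bounded_imp_bdd_above[OF h_bdd(2)]])
  obtain x where x: "x \<in> \<Omega>" using \<Omega>(3) by blast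
  show "1 \<le> h2_sup" using *[OF x] h2_gt2[OF x] by simp
qed

lemma W0_on: "w \<in> W0 s \<Omega> g \<Longrightarrow> w \<in> borel_measurable (lebesgue_on \<Omega>)"
  using W0_D(1) measurable_restrict_space1 by blast

lemma source_energy_nonneg: "0 \<le> source_energy w"
  unfolding source_energy_def by (rule Bochner_Integration.integral_nonneg) (simp add: F_nonneg)

lemma E_eq: "E w = grad_energy w - source_energy w"
  by (simp add: energy_E_def grad_energy_def source_energy_def G_pair_def split_def)

lemma I_eq: "I w = (LINT z|\<mu>. g_pair z (Ds s w z) * Ds s w z) - (LINT x|lebesgue_on \<Omega>. f x (w x) * w x)"
  by (simp add: nehari_I_def g_pair_def split_def)

lemma ft_le: "x \<in> \<Omega> \<Longrightarrow> f x t * t \<le> h2_sup * F_fun f x t"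
  using source_term.bounds(2)[OF f_source, of x t] mult_right_mono[OF h2_sup(1)[of x] F_nonneg[of x t]]
  by (simp add: mult.commute)

lemma admissible_f_int: "integrable (lebesgue_on \<Omega>) (\<lambda>x. f x (w x) * w x)" if "admissible w"
proof (rule Bochner_Integration.integrable_bound)
  show "integrable (lebesgue_on \<Omega>) (\<lambda>x. h2_sup * F_fun f x (w x))" using that by (simp add: admissible_def)
  show "(\<lambda>x. f x (w x) * w x) \<in> borel_measurable (lebesgue_on \<Omega>)"
    using that W0_on[of w] by (intro borel_measurable_times f_comp) (auto simp: admissible_def)
  show "AE x in lebesgue_on \<Omega>. norm (f x (w x) * w x) \<le> norm (h2_sup * F_fun f x (w x))"
    by (rule AE_I2) (use ft_nonneg ft_le F_nonneg h2_sup(2) in \<open>simp add: abs_of_nonneg\<close>)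
qed

lemma f_int_le: "(LINT x|lebesgue_on \<Omega>. f x (w x) * w x) \<le> h2_sup * source_energy w" if "admissible w"
proof -
  have "(LINT x|lebesgue_on \<Omega>. f x (w x) * w x) \<le> (LINT x|lebesgue_on \<Omega>. h2_sup * F_fun f x (w x))"
    by (rule integral_mono) (use that admissible_f_int ft_le in \<open>auto simp: admissible_def\<close>)
  then show ?thesis by (simp add: source_energy_def)
qed

definition defect_G :: "('a \<Rightarrow> real) \<Rightarrow> 'a \<times> 'a \<Rightarrow> real" where
  "defect_G w z = \<alpha> * G_pair z (Ds s w z) - g_pair z (Ds s w z) * Ds s w z"
definition defect_F :: "('a \<Rightarrow> real) \<Rightarrow> 'a \<Rightarrow> real" where
  "defect_F w x = f x (w x) * w x - \<alpha> * F_fun f x (w x)"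

lemma defect_G_nonneg: "0 \<le> defect_G w z"
proof -
  have "g_pair z (Ds s w z) * Ds s w z \<le> gp * G_pair z (Ds s w z)" by (rule N.kt_bounds(2))
  also have "\<dots> \<le> \<alpha> * G_pair z (Ds s w z)" by (rule mult_right_mono[OF \<alpha>(2) N.G_nonneg])
  finally show ?thesis by (simp add: defect_G_def)
qed

lemma defect_F_nonneg: "x \<in> \<Omega> \<Longrightarrow> 0 \<le> defect_F w x"
  using source_term.defect_nonneg[OF f_source] by (simp add: defect_F_def)

lemma defect_integrable: "integrable \<mu> (defect_G w)" "integrable (lebesgue_on \<Omega>) (defect_F w)" if "admissible w"
proof -
  have "finite_modular (Ds s w)" using that Ds_finite_modular by (simp add: admissible_def)
  then show "integrable \<mu> (defect_G w)" using finite_modular_mult[of "Ds s w" "Ds s w"] by (simp add: defect_G_def[abs_def] finite_modular_def)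
  show "integrable (lebesgue_on \<Omega>) (defect_F w)" using that admissible_f_int[OF that] by (simp add: defect_F_def[abs_def] admissible_def)
qed

lemma defect_eq: "\<alpha> * E w - I w = integral\<^sup>L \<mu> (defect_G w) + integral\<^sup>L (lebesgue_on \<Omega>) (defect_F w)" if "admissible w"
proof -
  have fw: "finite_modular (Ds s w)" using that Ds_finite_modular by (simp add: admissible_def)
  then have 1: "integral\<^sup>L \<mu> (defect_G w) = \<alpha> * grad_energy w - (LINT z|\<mu>. g_pair z (Ds s w z) * Ds s w z)"
    using finite_modular_mult[OF fw fw] by (simp add: defect_G_def[abs_def] finite_modular_def grad_energy_def)
  have 2: "integral\<^sup>L (lebesgue_on \<Omega>) (defect_F w) = (LINT x|lebesgue_on \<Omega>. f x (w x) * w x) - \<alpha> * source_energy w"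
    using that admissible_f_int[OF that] by (simp add: defect_F_def[abs_def] admissible_def source_energy_def)
  show ?thesis unfolding 1 2 E_eq I_eq by (simp add: algebra_simps)
qed

lemma I_cong: "I w = I w'" if w: "w \<in> W0 s \<Omega> g" "w' \<in> W0 s \<Omega> g" and eq: "AE x in lebesgue. w x = w' x"
proof -
  have D: "AE z in \<mu>. Ds s w z = Ds s w' z"
    using AE_mu[OF eq] by eventually_elim (simp add: Ds_def split_def)
  have m: "Ds s w \<in> borel_measurable \<mu>" "Ds s w' \<in> borel_measurable \<mu>"
    using Ds_finite_modular w by (auto simp: finite_modular_def)
  have "(LINT z|\<mu>. g_pair z (Ds s w z) * Ds s w z) = (LINT z|\<mu>. g_pair z (Ds s w' z) * Ds s w' z)"
  proof (rule integral_cong_AE)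
    show "(\<lambda>z. g_pair z (Ds s w z) * Ds s w z) \<in> borel_measurable \<mu>" "(\<lambda>z. g_pair z (Ds s w' z) * Ds s w' z) \<in> borel_measurable \<mu>"
      by (intro borel_measurable_times g_pair_comp m)+
    show "AE z in \<mu>. g_pair z (Ds s w z) * Ds s w z = g_pair z (Ds s w' z) * Ds s w' z"
      using D by eventually_elim simp
  qed
  moreover have "(LINT x|lebesgue_on \<Omega>. f x (w x) * w x) = (LINT x|lebesgue_on \<Omega>. f x (w' x) * w' x)"
  proof (rule integral_cong_AE)
    show "(\<lambda>x. f x (w x) * w x) \<in> borel_measurable (lebesgue_on \<Omega>)" "(\<lambda>x. f x (w' x) * w' x) \<in> borel_measurable (lebesgue_on \<Omega>)"
      by (intro borel_measurable_times f_comp W0_on w)+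
    show "AE x in lebesgue_on \<Omega>. f x (w x) * w x = f x (w' x) * w' x"
      using AE_on_if_AE_lebesgue[OF eq] by eventually_elim simp
  qed
  ultimately show ?thesis by (simp add: I_eq)
qed

lemma I_nonneg_if_zero: "0 \<le> I w" if "w \<in> W0 s \<Omega> g" "AE x in lebesgue. w x = 0"
proof -
  have "(LINT x|lebesgue_on \<Omega>. f x (w x) * w x) = 0"
    by (rule integral_eq_zero_AE) (use AE_on_if_AE_lebesgue[OF that(2)] in \<open>auto elim: eventually_mono\<close>)
  then show ?thesis unfolding I_eq by (simp add: N.kt_nonneg)
qed

text \<open>If the modular vanishes, then so does the difference quotient, and then \<open>w\<close>.\<close>

lemma grad_energy_pos: "0 < grad_energy w" if w: "w \<in> W0 s \<Omega> g" and nz: "\<not> (AE x in lebesgue. w x = 0)"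
proof (rule ccontr)
  assume "\<not> 0 < grad_energy w"
  then have "grad_energy w = 0" using grad_energy_nonneg[of w] by simp
  then have "AE z in \<mu>. G_pair z (Ds s w z) = 0"
    using Ds_finite_modular[OF w] by (subst (asm) grad_energy_def, subst (asm) integral_nonneg_eq_0_iff_AE) (auto simp: finite_modular_def N.G_nonneg)
  then have "AE z in \<mu>. Ds s w z = 0" by eventually_elim (metis N.G_pos less_irrefl)
  then show False using AE_Ds_zero[OF _ W0_D(2)[OF w]] nz by blast
qed

text \<open>An infimum of real numbers is a lower bound only if the set is bounded below. On the Nehari manifold
  the energy is nonnegative, since \<open>\<alpha> E\<close> is the defect; and if \<open>F(x, w)\<close> is not integrable, its integral is
  \<open>0\<close> by convention and \<open>E w\<close> is the nonnegative gradient part.\<close>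

lemma depth_le: "d \<le> E w" if "w \<in> nehari_manifold s \<Omega> g f"
proof -
  have "0 \<le> E w" if w: "w \<in> nehari_manifold s \<Omega> g f" for w
  proof (cases "integrable (lebesgue_on \<Omega>) (\<lambda>x. F_fun f x (w x))")
    case True
    then have a: "admissible w" and I0: "I w = 0" using w by (auto simp: admissible_def nehari_manifold_def)
    have "0 \<le> \<alpha> * E w"
      using defect_eq[OF a] I0 Bochner_Integration.integral_nonneg[of \<mu> "defect_G w"] defect_G_nonneg
        Bochner_Integration.integral_nonneg[of "lebesgue_on \<Omega>" "defect_F w"] defect_F_nonneg by simp
    then show ?thesis using \<alpha> by (simp add: zero_le_mult_iff)
  next
    case False
    then show ?thesis using grad_energy_nonneg by (simp add: E_eq source_energy_def not_integrable_integral_eq)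
  qed
  then have "bdd_below (E ` nehari_manifold s \<Omega> g f)" by (auto intro!: bdd_belowI)
  then show ?thesis unfolding depth_d_def using that by (intro cInf_lower) auto
qed

lemma Ds_scale: "Ds s (\<lambda>x. l * w x) = (\<lambda>z. l * Ds s w z)"
  by (auto simp: Ds_def fun_eq_iff algebra_simps)

lemma admissible_scale: "admissible (\<lambda>x. l * w x)" if a: "admissible w" and l: "0 < l" "l \<le> 1"
proof -
  have w: "w \<in> W0 s \<Omega> g" using a by (simp add: admissible_def)
  have "integrable (lebesgue_on \<Omega>) (\<lambda>x. F_fun f x (l * w x))"
  proof (rule Bochner_Integration.integrable_bound)
    show "integrable (lebesgue_on \<Omega>) (\<lambda>x. F_fun f x (w x))" using a by (simp add: admissible_def)
    show "(\<lambda>x. F_fun f x (l * w x)) \<in> borel_measurable (lebesgue_on \<Omega>)"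
      by (rule F_comp) (use W0_on[OF w] in auto)
    show "AE x in lebesgue_on \<Omega>. norm (F_fun f x (l * w x)) \<le> norm (F_fun f x (w x))"
    proof (rule AE_I2)
      fix x assume "x \<in> space (lebesgue_on \<Omega>)"
      then have x: "x \<in> \<Omega>" by simp
      interpret S: source_term "f x" "F_fun f x" "deriv (f x)" "h1 x" "h2 x" \<alpha> by (rule f_source[OF x])
      have "F_fun f x (l * w x) \<le> l powr h1 x * F_fun f x (w x)" by (rule S.F_scale[OF l])
      also have "\<dots> \<le> 1 * F_fun f x (w x)"
        using l S.p by (intro mult_right_mono powr_le1 S.F_nonneg) auto
      finally show "norm (F_fun f x (l * w x)) \<le> norm (F_fun f x (w x))"
        using S.F_nonneg by (simp add: abs_of_nonneg)
    qed
  qed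
  then show ?thesis using W0_scale[OF w l(1)] by (simp add: admissible_def)
qed

lemma admissible_multiple: "admissible (\<lambda>x. l * w x)" if a: "admissible w" and l: "0 < l"
proof (cases "l \<le> 1")
  case False
  then have l1: "1 \<le> l" by simp
  have w: "w \<in> W0 s \<Omega> g" using a by (simp add: admissible_def)
  have "integrable (lebesgue_on \<Omega>) (\<lambda>x. F_fun f x (l * w x))"
  proof (rule Bochner_Integration.integrable_bound)
    show "integrable (lebesgue_on \<Omega>) (\<lambda>x. l powr h2_sup * F_fun f x (w x))" using a by (simp add: admissible_def)
    show "(\<lambda>x. F_fun f x (l * w x)) \<in> borel_measurable (lebesgue_on \<Omega>)"
      by (rule F_comp) (use W0_on[OF w] in auto)
    show "AE x in lebesgue_on \<Omega>. norm (F_fun f x (l * w x)) \<le> norm (l powr h2_sup * F_fun f x (w x))"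
    proof (rule AE_I2)
      fix x assume "x \<in> space (lebesgue_on \<Omega>)"
      then have x: "x \<in> \<Omega>" by simp
      have "F_fun f x (l * w x) \<le> l powr h2 x * F_fun f x (w x)" by (rule source_term.F_dilate[OF f_source[OF x] l1])
      also have "\<dots> \<le> l powr h2_sup * F_fun f x (w x)"
        using l1 h2_sup(1)[OF x] by (intro mult_right_mono powr_mono F_nonneg x)
      finally show "norm (F_fun f x (l * w x)) \<le> norm (l powr h2_sup * F_fun f x (w x))"
        using F_nonneg[OF x] by (simp add: abs_of_nonneg)
    qed
  qed
  then show ?thesis using W0_scale[OF w l] by (simp add: admissible_def)
qed (rule admissible_scale[OF a l])

text \<open>Both integrands of \<open>I\<close> increase along a ray, so their values at \<open>w\<close> dominate.\<close>

lemma I_scale_cont: "continuous_on {l..1} (\<lambda>r. I (\<lambda>x. r * w x))" if a: "admissible w" and l: "0 < l"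
proof (rule continuous_on_sequentiallyI)
  fix r :: "nat \<Rightarrow> real" and r0 assume r: "\<forall>n. r n \<in> {l..1}" "r0 \<in> {l..1}" "r \<longlonglongrightarrow> r0"
  have w: "w \<in> W0 s \<Omega> g" using a by (simp add: admissible_def)
  have fw: "finite_modular (Ds s w)" by (rule Ds_finite_modular[OF w])
  have r01: "0 < r n \<and> r n \<le> 1" "0 < r0 \<and> r0 \<le> 1" for n using r l by (auto intro: less_le_trans)
  have "(\<lambda>n. LINT z|\<mu>. g_pair z (r n * Ds s w z) * (r n * Ds s w z)) \<longlonglongrightarrow> (LINT z|\<mu>. g_pair z (r0 * Ds s w z) * (r0 * Ds s w z))"
  proof (rule integral_dominated_convergence[where w = "\<lambda>z. g_pair z (Ds s w z) * Ds s w z"])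
    show "integrable \<mu> (\<lambda>z. g_pair z (Ds s w z) * Ds s w z)" by (rule finite_modular_mult[OF fw fw])
    show "(\<lambda>z. g_pair z (r0 * Ds s w z) * (r0 * Ds s w z)) \<in> borel_measurable \<mu>"
      "(\<lambda>z. g_pair z (r n * Ds s w z) * (r n * Ds s w z)) \<in> borel_measurable \<mu>" for n
      using fw by (auto simp: finite_modular_def intro!: borel_measurable_times g_pair_comp)
    show "AE z in \<mu>. (\<lambda>n. g_pair z (r n * Ds s w z) * (r n * Ds s w z)) \<longlonglongrightarrow> g_pair z (r0 * Ds s w z) * (r0 * Ds s w z)"
    proof (rule AE_I2)
      fix z
      have l1: "(\<lambda>n. r n * Ds s w z) \<longlonglongrightarrow> r0 * Ds s w z" by (intro tendsto_intros r)
      then have l2: "(\<lambda>n. g_pair z (r n * Ds s w z)) \<longlonglongrightarrow> g_pair z (r0 * Ds s w z)"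
        using N.cont[of z] by (metis continuous_on_eq_continuous_at isCont_tendsto_compose open_UNIV UNIV_I)
      show "(\<lambda>n. g_pair z (r n * Ds s w z) * (r n * Ds s w z)) \<longlonglongrightarrow> g_pair z (r0 * Ds s w z) * (r0 * Ds s w z)"
        by (rule tendsto_mult[OF l2 l1])
    qed
    show "AE z in \<mu>. norm (g_pair z (r n * Ds s w z) * (r n * Ds s w z)) \<le> g_pair z (Ds s w z) * Ds s w z" for n
      using N.kt_mono[of "r n"] r01(1)[of n] by (auto intro!: AE_I2 simp: abs_of_nonneg N.kt_nonneg)
  qed
  moreover have "(\<lambda>n. LINT x|lebesgue_on \<Omega>. f x (r n * w x) * (r n * w x)) \<longlonglongrightarrow> (LINT x|lebesgue_on \<Omega>. f x (r0 * w x) * (r0 * w x))"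
  proof (rule integral_dominated_convergence[where w = "\<lambda>x. f x (w x) * w x"])
    show "integrable (lebesgue_on \<Omega>) (\<lambda>x. f x (w x) * w x)" by (rule admissible_f_int[OF a])
    show "(\<lambda>x. f x (r0 * w x) * (r0 * w x)) \<in> borel_measurable (lebesgue_on \<Omega>)"
      "(\<lambda>x. f x (r n * w x) * (r n * w x)) \<in> borel_measurable (lebesgue_on \<Omega>)" for n
      using W0_on[OF w] by (auto intro!: borel_measurable_times f_comp)
    show "AE x in lebesgue_on \<Omega>. (\<lambda>n. f x (r n * w x) * (r n * w x)) \<longlonglongrightarrow> f x (r0 * w x) * (r0 * w x)"
    proof (rule AE_I2)
      fix x assume "x \<in> space (lebesgue_on \<Omega>)"
      then have c: "isCont (f x) t" for t using source_term.f_deriv[OF f_source[of x]] DERIV_isCont by auto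
      have l1: "(\<lambda>n. r n * w x) \<longlonglongrightarrow> r0 * w x" by (intro tendsto_intros r)
      then have l2: "(\<lambda>n. f x (r n * w x)) \<longlonglongrightarrow> f x (r0 * w x)" by (rule isCont_tendsto_compose[OF c])
      show "(\<lambda>n. f x (r n * w x) * (r n * w x)) \<longlonglongrightarrow> f x (r0 * w x) * (r0 * w x)"
        by (rule tendsto_mult[OF l2 l1])
    qed
    show "AE x in lebesgue_on \<Omega>. norm (f x (r n * w x) * (r n * w x)) \<le> f x (w x) * w x" for n
    proof (rule AE_I2)
      fix x assume "x \<in> space (lebesgue_on \<Omega>)"
      then show "norm (f x (r n * w x) * (r n * w x)) \<le> f x (w x) * w x"
        using source_term.ft_mono[OF f_source[of x], of "r n" "w x"] ft_nonneg[of x "r n * w x"] r01(1)[of n]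
        by (simp add: abs_of_nonneg)
    qed
  qed
  ultimately show "(\<lambda>n. I (\<lambda>x. r n * w x)) \<longlonglongrightarrow> I (\<lambda>x. r0 * w x)"
    unfolding I_eq Ds_scale by (rule tendsto_diff)
qed

text \<open>Under scaling by a small \<open>l\<close> the gradient part of \<open>I\<close> is at least of order \<open>l powr gp\<close> and the source
  part at most of order \<open>l powr m\<close> with \<open>m > gp\<close>.\<close>

lemma I_pos_small:
  assumes a: "admissible w" and Pw: "0 < grad_energy w"
  shows "\<exists>l. 0 < l \<and> l \<le> 1 \<and> 0 < I (\<lambda>x. l * w x)"
proof -
  define m where "m = (INF x\<in>\<Omega>. h1 x)"
  have m: "gp < m" "\<And>x. x \<in> \<Omega> \<Longrightarrow> m \<le> h1 x"
    using h_range(2) cINF_lower[OF bounded_imp_bdd_below[OF h_bdd(1)]] by (auto simp: m_def)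
  define q where "q = grad_energy w / (2 * (h2_sup * (source_energy w + 1)))"
  have HR: "h2_sup * (source_energy w + 1) > 0" using h2_sup(2) source_energy_nonneg[of w] by (intro mult_pos_pos) auto
  have q: "q > 0" using Pw HR by (simp add: q_def)
  \<comment> \<open>With \<open>l powr (m - gp) \<le> q\<close> the source part is at most half of the gradient part.\<close>
  define l where "l = min 1 (q powr (1 / (m - gp)))"
  have l: "0 < l" "l \<le> 1" using q by (auto simp: l_def)
  have "l powr (m - gp) \<le> (q powr (1 / (m - gp))) powr (m - gp)"
    using l m by (intro powr_mono2) (auto simp: l_def)
  also have "\<dots> = q" using q m by (simp add: powr_powr)
  finally have lq: "l powr (m - gp) \<le> q" .
  have w: "w \<in> W0 s \<Omega> g" using a by (simp add: admissible_def)
  have al: "admissible (\<lambda>x. l * w x)" by (rule admissible_scale[OF a l])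
  have fl: "finite_modular (\<lambda>z. l * Ds s w z)" using finite_modular_scale[OF Ds_finite_modular[OF w] l] .
  have 1: "l powr gp * grad_energy w \<le> (LINT z|\<mu>. g_pair z (l * Ds s w z) * (l * Ds s w z))"
  proof -
    have "l powr gp * grad_energy w = (LINT z|\<mu>. l powr gp * G_pair z (Ds s w z))" by (simp add: grad_energy_def)
    also have "\<dots> \<le> (LINT z|\<mu>. g_pair z (l * Ds s w z) * (l * Ds s w z))"
    proof (rule integral_mono)
      show "integrable \<mu> (\<lambda>z. l powr gp * G_pair z (Ds s w z))" using Ds_finite_modular[OF w] by (simp add: finite_modular_def)
      show "integrable \<mu> (\<lambda>z. g_pair z (l * Ds s w z) * (l * Ds s w z))" by (rule finite_modular_mult[OF fl fl])
      fix z
      have "l powr gp * G_pair z (Ds s w z) \<le> 1 * G_pair z (l * Ds s w z)" using N.G_scale(1)[OF l] by simp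
      also have "\<dots> \<le> gm * G_pair z (l * Ds s w z)" using N.gm by (intro mult_right_mono N.G_nonneg) auto
      also have "\<dots> \<le> g_pair z (l * Ds s w z) * (l * Ds s w z)" by (rule N.kt_bounds)
      finally show "l powr gp * G_pair z (Ds s w z) \<le> g_pair z (l * Ds s w z) * (l * Ds s w z)" .
    qed
    finally show ?thesis .
  qed
  have 2: "(LINT x|lebesgue_on \<Omega>. f x (l * w x) * (l * w x)) \<le> h2_sup * (l powr m * source_energy w)"
  proof -
    have "(LINT x|lebesgue_on \<Omega>. f x (l * w x) * (l * w x)) \<le> h2_sup * source_energy (\<lambda>x. l * w x)" by (rule f_int_le[OF al])
    also have "source_energy (\<lambda>x. l * w x) \<le> (LINT x|lebesgue_on \<Omega>. l powr m * F_fun f x (w x))"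
      unfolding source_energy_def
    proof (rule integral_mono)
      fix x assume "x \<in> space (lebesgue_on \<Omega>)"
      then have x: "x \<in> \<Omega>" by simp
      have "F_fun f x (l * w x) \<le> l powr h1 x * F_fun f x (w x)" by (rule source_term.F_scale[OF f_source[OF x] l])
      also have "\<dots> \<le> l powr m * F_fun f x (w x)"
        using l m(2)[OF x] by (intro mult_right_mono powr_mono' F_nonneg x) auto
      finally show "F_fun f x (l * w x) \<le> l powr m * F_fun f x (w x)" .
    qed (use a al in \<open>auto simp: admissible_def\<close>)
    finally show ?thesis using h2_sup(2) by (simp add: source_energy_def mult_left_mono)
  qed
  have "h2_sup * (l powr m * source_energy w) = l powr gp * (l powr (m - gp) * (h2_sup * source_energy w))"
    using l by (simp add: powr_diff)
  also have "\<dots> < l powr gp * grad_energy w"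
  proof (rule mult_strict_left_mono)
    define K where "K = h2_sup * (source_energy w + 1)"
    have "l powr (m - gp) * (h2_sup * source_energy w) \<le> q * (h2_sup * (source_energy w + 1))"
      using lq q h2_sup(2) source_energy_nonneg[of w] by (intro mult_mono) auto
    also have "\<dots> = grad_energy w / 2"
      using HR unfolding q_def K_def[symmetric] by simp
    finally show "l powr (m - gp) * (h2_sup * source_energy w) < grad_energy w" using Pw by simp
  qed (use l in simp)
  finally have "0 < I (\<lambda>x. l * w x)" unfolding I_eq Ds_scale using 1 2 by linarith
  then show ?thesis using l by blast
qed

text \<open>The estimate that links the depth with states on which \<open>I\<close> is negative: shrink \<open>w\<close> until \<open>I\<close> vanishes.
  At that point the defect equals \<open>\<alpha> E\<close>, which is at least \<open>\<alpha> d\<close>, and on the way it has only decreased.\<close>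

lemma depth_le_defect:
  assumes a: "admissible w" and neg: "I w < 0"
  shows "\<alpha> * d \<le> \<alpha> * E w - I w"
proof -
  have w: "w \<in> W0 s \<Omega> g" using a by (simp add: admissible_def)
  have nz: "\<not> (AE x in lebesgue. w x = 0)" using I_nonneg_if_zero[OF w] neg by auto
  obtain l0 where l0: "0 < l0" "l0 \<le> 1" "0 < I (\<lambda>x. l0 * w x)" using I_pos_small[OF a grad_energy_pos[OF w nz]] by blast
  have "\<exists>l. l0 \<le> l \<and> l \<le> 1 \<and> I (\<lambda>x. l * w x) = 0"
    by (rule IVT2'[OF _ _ l0(2) I_scale_cont[OF a l0(1)]]) (use l0 neg in auto)
  then obtain l where l: "l0 \<le> l" "l \<le> 1" "I (\<lambda>x. l * w x) = 0" by blast
  have lp: "0 < l" using l l0 by simp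
  have al: "admissible (\<lambda>x. l * w x)" by (rule admissible_scale[OF a lp l(2)])
  have "(\<lambda>x. l * w x) \<in> nehari_manifold s \<Omega> g f"
    using al l(3) nz lp by (auto simp: nehari_manifold_def admissible_def)
  then have "\<alpha> * d \<le> \<alpha> * E (\<lambda>x. l * w x)" using depth_le \<alpha> by (intro mult_left_mono) auto
  also have "\<dots> = integral\<^sup>L \<mu> (defect_G (\<lambda>x. l * w x)) + integral\<^sup>L (lebesgue_on \<Omega>) (defect_F (\<lambda>x. l * w x))"
    using defect_eq[OF al] l(3) by simp
  also have "\<dots> \<le> integral\<^sup>L \<mu> (defect_G w) + integral\<^sup>L (lebesgue_on \<Omega>) (defect_F w)"
  proof (intro add_mono integral_mono defect_integrable al a)
    show "defect_G (\<lambda>x. l * w x) z \<le> defect_G w z" for z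
      unfolding defect_G_def Ds_scale by (rule N.defect_mono[OF \<alpha>(2) lp l(2)])
    show "defect_F (\<lambda>x. l * w x) x \<le> defect_F w x" if "x \<in> space (lebesgue_on \<Omega>)" for x
      unfolding defect_F_def by (rule source_term.defect_mono[OF f_source]) (use that lp l in auto)
  qed
  also have "\<dots> = \<alpha> * E w - I w" using defect_eq[OF a] by simp
  finally show ?thesis .
qed

text \<open>Fatou's lemma applies to the defect, an integral of nonnegative functions. This replaces the continuity
  of \<open>I\<close>, which may fail along the flow.\<close>

lemma defect_lsc:
  assumes wn: "\<And>n. admissible (wn n)" and w: "admissible w"
    and lim: "AE x in lebesgue. (\<lambda>n. wn n x) \<longlonglongrightarrow> w x"
    and C: "\<And>n. \<alpha> * E (wn n) - I (wn n) \<le> c n" and c: "c \<longlonglongrightarrow> c0"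
  shows "\<alpha> * E w - I w \<le> c0"
proof (rule field_le_epsilon)
  fix e :: real assume e: "0 < e"
  have ev1: "\<forall>\<^sub>F n in sequentially. (LINT z|\<mu>. - defect_G (wn n) z) \<le> (LINT z|\<mu>. - defect_G w z) + e/3"
  proof (rule integral_limsup_le[where e = "\<lambda>n z. 0" and C = 0])
    show "AE z in \<mu>. (\<lambda>n. - defect_G (wn n) z) \<longlonglongrightarrow> - defect_G w z"
      using Ds_tendsto[OF lim]
    proof eventually_elim
      fix z assume l: "(\<lambda>n. Ds s (wn n) z) \<longlonglongrightarrow> Ds s w z"
      have "(\<lambda>n. g_pair z (Ds s (wn n) z)) \<longlonglongrightarrow> g_pair z (Ds s w z)" "(\<lambda>n. G_pair z (Ds s (wn n) z)) \<longlonglongrightarrow> G_pair z (Ds s w z)"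
        using N.cont[of z] N.G_cont[of z] l by (metis continuous_on_eq_continuous_at isCont_tendsto_compose open_UNIV UNIV_I)+
      then show "(\<lambda>n. - defect_G (wn n) z) \<longlonglongrightarrow> - defect_G w z" unfolding defect_G_def by (intro tendsto_intros l)
    qed
    show "\<exists>H. integrable \<mu> H \<and> (\<forall>n. AE x in \<mu>. - defect_G (wn n) x \<le> H x + \<epsilon> * 0)" for \<epsilon>
      by (rule exI[of _ "\<lambda>_. 0"]) (simp add: defect_G_nonneg)
  qed (use defect_integrable wn w e in auto)
  have ev2: "\<forall>\<^sub>F n in sequentially. (LINT x|lebesgue_on \<Omega>. - defect_F (wn n) x) \<le> (LINT x|lebesgue_on \<Omega>. - defect_F w x) + e/3"
  proof (rule integral_limsup_le[where e = "\<lambda>n z. 0" and C = 0])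
    have "AE x in lebesgue_on \<Omega>. x \<in> \<Omega>" by (rule AE_I2) simp
    then show "AE x in lebesgue_on \<Omega>. (\<lambda>n. - defect_F (wn n) x) \<longlonglongrightarrow> - defect_F w x"
      using AE_on_if_AE_lebesgue[OF lim]
    proof eventually_elim
      fix x assume x: "x \<in> \<Omega>" and l: "(\<lambda>n. wn n x) \<longlonglongrightarrow> w x"
      have "(\<lambda>n. f x (wn n x)) \<longlonglongrightarrow> f x (w x)" "(\<lambda>n. F_fun f x (wn n x)) \<longlonglongrightarrow> F_fun f x (w x)"
        using source_term.f_cont[OF f_source[OF x]] F_cont[OF x] l
        by (metis continuous_on_eq_continuous_at isCont_tendsto_compose open_UNIV UNIV_I)+
      then show "(\<lambda>n. - defect_F (wn n) x) \<longlonglongrightarrow> - defect_F w x" unfolding defect_F_def by (intro tendsto_intros l)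
    qed
    show "\<exists>H. integrable (lebesgue_on \<Omega>) H \<and> (\<forall>n. AE x in lebesgue_on \<Omega>. - defect_F (wn n) x \<le> H x + \<epsilon> * 0)" for \<epsilon>
      by (rule exI[of _ "\<lambda>_. 0"]) (auto simp: defect_F_nonneg intro!: AE_I2)
  qed (use defect_integrable wn w e in auto)
  have ev3: "\<forall>\<^sub>F n in sequentially. c n < c0 + e/3" using order_tendstoD(2)[OF c] e by simp
  obtain n where n: "(LINT z|\<mu>. - defect_G (wn n) z) \<le> (LINT z|\<mu>. - defect_G w z) + e/3"
    "(LINT x|lebesgue_on \<Omega>. - defect_F (wn n) x) \<le> (LINT x|lebesgue_on \<Omega>. - defect_F w x) + e/3" "c n < c0 + e/3"
    using eventually_happens'[OF sequentially_bot eventually_conj[OF ev1 eventually_conj[OF ev2 ev3]]] by auto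
  show "\<alpha> * E w - I w \<le> c0 + e"
    using n C[of n] by (simp add: defect_eq wn w)
qed

lemma grad_energy_lsc:
  assumes wn: "\<And>n. wn n \<in> W0 s \<Omega> g" and w: "w \<in> W0 s \<Omega> g"
    and lim: "AE x in lebesgue. (\<lambda>n. wn n x) \<longlonglongrightarrow> w x" and C: "\<And>n. grad_energy (wn n) \<le> C"
  shows "grad_energy w \<le> C"
proof (rule field_le_epsilon)
  fix e :: real assume e: "0 < e"
  have "\<forall>\<^sub>F n in sequentially. (LINT z|\<mu>. - G_pair z (Ds s (wn n) z)) \<le> (LINT z|\<mu>. - G_pair z (Ds s w z)) + e"
  proof (rule integral_limsup_le[where e = "\<lambda>n z. 0" and C = 0])
    show "AE z in \<mu>. (\<lambda>n. - G_pair z (Ds s (wn n) z)) \<longlonglongrightarrow> - G_pair z (Ds s w z)"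
      using Ds_tendsto[OF lim]
    proof eventually_elim
      fix z assume l: "(\<lambda>n. Ds s (wn n) z) \<longlonglongrightarrow> Ds s w z"
      have "(\<lambda>n. G_pair z (Ds s (wn n) z)) \<longlonglongrightarrow> G_pair z (Ds s w z)"
        using N.G_cont[of z] l by (metis continuous_on_eq_continuous_at isCont_tendsto_compose open_UNIV UNIV_I)
      then show "(\<lambda>n. - G_pair z (Ds s (wn n) z)) \<longlonglongrightarrow> - G_pair z (Ds s w z)" by (rule tendsto_minus)
    qed
    show "\<exists>H. integrable \<mu> H \<and> (\<forall>n. AE z in \<mu>. - G_pair z (Ds s (wn n) z) \<le> H z + \<epsilon> * 0)" for \<epsilon>
      by (rule exI[of _ "\<lambda>_. 0"]) (simp add: N.G_nonneg)
  qed (use Ds_finite_modular wn w e in \<open>auto simp: finite_modular_def\<close>)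
  then obtain n where "(LINT z|\<mu>. - G_pair z (Ds s (wn n) z)) \<le> (LINT z|\<mu>. - G_pair z (Ds s w z)) + e"
    using eventually_happens'[OF sequentially_bot] by blast
  then show "grad_energy w \<le> C + e" using C[of n] by (simp add: grad_energy_def)
qed
end

section \<open>The flow stays outside the well\<close>

lemma AE_interval_ex:
  assumes "a < (b::real)" "AE t in lebesgue. t \<in> {a<..<b} \<longrightarrow> Q t"
  shows "\<exists>t\<in>{a<..<b}. Q t"
proof (rule ccontr)
  assume "\<not> ?thesis"
  then have "AE t in lebesgue. t \<notin> {a<..<b}" using assms(2) by (auto elim: eventually_mono)
  then have "emeasure lebesgue {a<..<b} = 0"
    by (subst (asm) AE_iff_measurable[of "{a<..<b}"]) auto
  then show False using assms(1) by simp
qed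

locale strong_flow = nonlocal_problem \<Omega> g f h1 h2 s gm gp \<alpha>
  for \<Omega> :: "'a::euclidean_space set" and g f h1 h2 s gm gp \<alpha> +
  fixes u0 :: "'a \<Rightarrow> real" and u v :: "real \<Rightarrow> 'a \<Rightarrow> real" and T :: real
  assumes T: "0 < T"
    and weak_sol: "weak_solution_with s \<Omega> g f h2 u0 (ereal T) u v"
    and strong: "\<And>t. 0 \<le> t \<Longrightarrow> t < T \<Longrightarrow> u t \<in> W0 s \<Omega> g \<and> integrable (lebesgue_on \<Omega>) (\<lambda>x. F_fun f x (u t x)) \<and>
        (LINT \<tau>:{0..t}|lebesgue. (L2_norm \<Omega> (v \<tau>))\<^sup>2) + energy_E s \<Omega> g f (u t) = energy_E s \<Omega> g f (u 0)"
    and u0: "u0 \<in> W0 s \<Omega> g" "energy_E s \<Omega> g f u0 < depth_d s \<Omega> g f" "nehari_I s \<Omega> g f u0 < 0"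
begin

lemma u_L_Phi: "u t \<in> L_Phi \<Omega> h2" if "0 \<le> t" "t \<le> T"
  using weak_sol that unfolding weak_solution_with_def continuous_into_def by auto

sublocale L2_curve \<Omega> u v T
proof
  show "0 < T" by (rule T)
  show "bochner_L2 (open_time (ereal T)) (L2_space \<Omega>) (L2_norm \<Omega>) v" "weak_time_deriv (ereal T) \<Omega> u v"
    using weak_sol unfolding weak_solution_with_def by auto
  fix t assume t: "0 \<le> t" "t \<le> T"
  show "u t \<in> L2_space \<Omega>" by (rule L_Phi_L2[OF u_L_Phi[OF t]])
  have set: "{t. 0 \<le> t \<and> ereal t \<le> ereal T} = {0..T}" by auto
  have lim: "((\<lambda>\<tau>. L_Phi_norm \<Omega> h2 (\<lambda>x. u \<tau> x - u t x)) \<longlongrightarrow> 0) (at t within {0..T})"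
    using weak_sol t unfolding weak_solution_with_def continuous_into_def set by auto
  define K where "K = sqrt (measure lebesgue \<Omega> + 1)"
  have K: "0 < K" by (simp add: K_def add_nonneg_pos)
  show "((\<lambda>\<tau>. L2_norm \<Omega> (\<lambda>x. u \<tau> x - u t x)) \<longlongrightarrow> 0) (at t within {0..T})"
  proof (rule tendstoI)
    fix e :: real assume e: "0 < e"
    have "\<forall>\<^sub>F \<tau> in at t within {0..T}. L_Phi_norm \<Omega> h2 (\<lambda>x. u \<tau> x - u t x) < e / (2 * K)"
      using order_tendstoD(2)[OF lim, of "e / (2 * K)"] e K by simp
    moreover have "\<forall>\<^sub>F \<tau> in at t within {0..T}. \<tau> \<in> {0..T}" by (simp add: eventually_at_filter)
    ultimately show "\<forall>\<^sub>F \<tau> in at t within {0..T}. dist (L2_norm \<Omega> (\<lambda>x. u \<tau> x - u t x)) 0 < e"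
    proof eventually_elim
      fix \<tau> assume \<tau>: "L_Phi_norm \<Omega> h2 (\<lambda>x. u \<tau> x - u t x) < e / (2 * K)" "\<tau> \<in> {0..T}"
      have "L2_norm \<Omega> (\<lambda>x. u \<tau> x - u t x) \<le> e / (2 * K) * K"
        unfolding K_def by (rule L2_norm_le_L_Phi_norm[OF L_Phi_diff[OF u_L_Phi u_L_Phi] \<tau>(1)[unfolded K_def]]) (use \<tau> t in auto)
      then show "dist (L2_norm \<Omega> (\<lambda>x. u \<tau> x - u t x)) 0 < e"
        using e K by (simp add: L2_norm_nonneg)
    qed
  qed
qed

lemma u_admissible: "admissible (u t)" if "0 \<le> t" "t < T" using strong that by (simp add: admissible_def)
lemma u_W0: "u t \<in> W0 s \<Omega> g" if "0 \<le> t" "t < T" using strong that by simp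

definition dissipation :: "real \<Rightarrow> real" where "dissipation t = integral {0..t} (\<lambda>\<tau>. (L2_norm \<Omega> (v \<tau>))\<^sup>2)"

lemma dissipation_int: "(\<lambda>\<tau>. (L2_norm \<Omega> (v \<tau>))\<^sup>2) integrable_on {a..b}" if "0 \<le> a" "b \<le> T"
  using set_lebesgue_integral_eq_integral(1)[OF set_integrable_subset[OF v_norm_sq_integrable, of "{a..b}"]] that by auto

lemma dissipation_eq: "(LINT \<tau>:{0..t}|lebesgue. (L2_norm \<Omega> (v \<tau>))\<^sup>2) = dissipation t" if "t \<le> T"
  unfolding dissipation_def by (rule set_lebesgue_integral_eq_integral, rule set_integrable_subset[OF v_norm_sq_integrable]) (use that in auto)

lemma dissipation_cont: "continuous_on {0..T} dissipation"
  unfolding dissipation_def by (rule indefinite_integral_continuous_1) (use dissipation_int T in auto)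

lemma dissipation_nonneg: "0 \<le> dissipation t" if "t \<le> T"
  unfolding dissipation_def by (rule Henstock_Kurzweil_Integration.integral_nonneg) (use dissipation_int that in auto)

lemma dissipation_mono: "dissipation t \<le> dissipation T" if "0 \<le> t" "t \<le> T"
  unfolding dissipation_def by (rule integral_subset_le) (use dissipation_int that in auto)

lemma energy: "E (u t) = E (u 0) - dissipation t" if "0 \<le> t" "t < T"
  using strong[OF that] dissipation_eq[of t] that by simp

text \<open>At some common time both the energy inequality, which starts from \<open>E u0\<close>, and the energy identity,
  which starts from \<open>E (u 0)\<close>, hold.\<close>

lemma energy_0: "E (u 0) \<le> E u0"
proof -
  have "AE t in lebesgue. t \<in> {0<..<T} \<longrightarrow>
        (LINT \<tau>:{0..t}|lebesgue. (L2_norm \<Omega> (v \<tau>))\<^sup>2) + E (u t) \<le> E u0"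
    using weak_sol unfolding weak_solution_with_def open_time_ereal by (auto elim: eventually_mono)
  from AE_interval_ex[OF T this] obtain t where "0 < t" "t < T"
    "(LINT \<tau>:{0..t}|lebesgue. (L2_norm \<Omega> (v \<tau>))\<^sup>2) + E (u t) \<le> E u0" by auto
  then show ?thesis using strong[of t] by simp
qed

lemma energy_le: "E (u t) \<le> E u0" if "0 \<le> t" "t < T"
  using energy[OF that] energy_0 dissipation_nonneg[of t] that by simp

text \<open>Norm convergence gives pointwise convergence of a subsequence; outside \<open>\<Omega>\<close> all functions vanish.\<close>

lemma u_subseq:
  assumes tn: "\<And>n. 0 \<le> tn n \<and> tn n < T" and t: "0 \<le> t" "t < T" and lim: "tn \<longlonglongrightarrow> t"
  obtains r :: "nat \<Rightarrow> nat" where "strict_mono r" "AE x in lebesgue. (\<lambda>n. u (tn (r n)) x) \<longlonglongrightarrow> u t x"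
proof -
  have L2: "u (tn n) \<in> L2_space \<Omega>" "u t \<in> L2_space \<Omega>" for n
    using u_L2[of "tn n"] u_L2[of t] tn[of n] t by auto
  have L2lim: "(\<lambda>n. L2_norm \<Omega> (\<lambda>x. u (tn n) x - u t x)) \<longlonglongrightarrow> 0"
  proof (rule LIMSEQ_I)
    fix e :: real assume e: "0 < e"
    obtain \<delta> where \<delta>: "\<delta> > 0" "\<And>\<tau>. \<tau> \<in> {0..T} \<Longrightarrow> \<bar>\<tau> - t\<bar> < \<delta> \<Longrightarrow> L2_norm \<Omega> (\<lambda>x. u \<tau> x - u t x) < e"
      using u_cont_on[of t e] t e by auto
    obtain N where "\<And>n. N \<le> n \<Longrightarrow> \<bar>tn n - t\<bar> < \<delta>" using LIMSEQ_D[OF lim \<delta>(1)] by auto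
    then show "\<exists>N. \<forall>n\<ge>N. norm (L2_norm \<Omega> (\<lambda>x. u (tn n) x - u t x) - 0) < e"
      using \<delta>(2) tn by (intro exI[of _ N]) (auto simp: L2_norm_nonneg abs_of_nonneg less_imp_le)
  qed
  obtain r :: "nat \<Rightarrow> nat" where r: "strict_mono r" "AE x in lebesgue_on \<Omega>. (\<lambda>n. u (tn (r n)) x) \<longlonglongrightarrow> u t x"
    by (rule L2_subseq_AE[OF L2(1) L2(2) L2lim])
  have "AE x in lebesgue. x \<notin> \<Omega> \<longrightarrow> u (tn (r n)) x = 0" for n
    by (rule W0_D(2)[OF u_W0]) (use tn in auto)
  then have "AE x in lebesgue. \<forall>n. x \<notin> \<Omega> \<longrightarrow> u (tn (r n)) x = 0"
    by (subst AE_all_countable) blast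
  moreover have "AE x in lebesgue. x \<notin> \<Omega> \<longrightarrow> u t x = 0" by (rule W0_D(2)[OF u_W0[OF t]])
  ultimately have "AE x in lebesgue. x \<notin> \<Omega> \<longrightarrow> (\<lambda>n. u (tn (r n)) x) \<longlonglongrightarrow> u t x"
    by eventually_elim simp
  from that[OF r(1) AE_lebesgue_if_AE_on[OF r(2) this]] show thesis .
qed

text \<open>The bound holds for almost every time by hypothesis and extends to every time, because the modular is
  lower semicontinuous under the convergence of \<open>u\<close>.\<close>

lemma grad_energy_bounded: "\<exists>C. \<forall>t. 0 \<le> t \<and> t < T \<longrightarrow> grad_energy (u t) \<le> C"
proof -
  obtain C where "AE t in lebesgue. t \<in> {0<..<T} \<longrightarrow> W0_norm s \<Omega> g (u t) \<le> C"
    using weak_sol unfolding weak_solution_with_def bochner_Linf_def open_time_ereal by auto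
  then have ae: "AE t in lebesgue. t \<in> {0<..<T} \<longrightarrow> grad_energy (u t) \<le> (max C 0 + 2) powr gp"
  proof eventually_elim
    fix t assume "t \<in> {0<..<T} \<longrightarrow> W0_norm s \<Omega> g (u t) \<le> C"
    then show "t \<in> {0<..<T} \<longrightarrow> grad_energy (u t) \<le> (max C 0 + 2) powr gp"
      using grad_energy_le_if_W0_norm_le[OF u_W0, of t C] by auto
  qed
  show ?thesis
  proof (intro exI[of _ "(max C 0 + 2) powr gp"] allI impI)
    fix t assume t: "0 \<le> t \<and> t < T"
    have "\<exists>t'. t' \<in> {t<..<min T (t + 1 / real (Suc n))} \<and> grad_energy (u t') \<le> (max C 0 + 2) powr gp" for n
    proof -
      have "AE r in lebesgue. r \<in> {t<..<min T (t + 1 / real (Suc n))} \<longrightarrow> grad_energy (u r) \<le> (max C 0 + 2) powr gp"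
        using ae by eventually_elim (use t in auto)
      from AE_interval_ex[OF _ this] t show ?thesis by auto
    qed
    then obtain tn where tn: "\<And>n. tn n \<in> {t<..<min T (t + 1 / real (Suc n))}" "\<And>n. grad_energy (u (tn n)) \<le> (max C 0 + 2) powr gp"
      by metis
    have "tn \<longlonglongrightarrow> t"
    proof (rule tendsto_if_dist_le_inverse)
      show "\<bar>tn n - t\<bar> \<le> 1 / real (Suc n)" for n using tn(1)[of n] by (simp del: of_nat_Suc)
    qed
    moreover have tn0: "0 \<le> tn n \<and> tn n < T" for n using tn(1)[of n] t by auto
    ultimately obtain r :: "nat \<Rightarrow> nat" where r: "AE x in lebesgue. (\<lambda>n. u (tn (r n)) x) \<longlonglongrightarrow> u t x"
      using u_subseq[of tn t] t by blast
    show "grad_energy (u t) \<le> (max C 0 + 2) powr gp"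
      by (rule grad_energy_lsc[OF u_W0 u_W0 r tn(2)]) (use tn0 t in auto)
  qed
qed

definition grad_energy_sup :: real where "grad_energy_sup = (SOME C. \<forall>t. 0 \<le> t \<and> t < T \<longrightarrow> grad_energy (u t) \<le> C)"
lemma grad_energy_le: "grad_energy (u t) \<le> grad_energy_sup" if "0 \<le> t" "t < T"
  using someI_ex[OF grad_energy_bounded] that unfolding grad_energy_sup_def by blast

definition tested :: "real \<Rightarrow> ('a \<Rightarrow> real) \<Rightarrow> bool" where
  "tested t \<phi> \<longleftrightarrow> integrable (lebesgue_on \<Omega>) (\<lambda>x. v t x * \<phi> x) \<and>
    integrable (lebesgue_on \<Omega>) (\<lambda>x. f x (u t x) * \<phi> x) \<and>
    ip (v t) \<phi> + (LINT z|\<mu>. g_pair z (Ds s (u t) z) * Ds s \<phi> z) = (LINT x|lebesgue_on \<Omega>. f x (u t x) * \<phi> x)"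

lemma AE_tested: "AE t in lebesgue. t \<in> {0<..<T} \<longrightarrow> tested t \<phi>" if "\<phi> \<in> W0 s \<Omega> g"
proof -
  have "AE t in lebesgue. t \<in> open_time (ereal T) \<longrightarrow>
        integrable (lebesgue_on \<Omega>) (\<lambda>x. v t x * \<phi> x) \<and>
        integrable (mu_Q \<Omega>) (\<lambda>(x, y). g x y (Ds s (u t) (x, y)) * Ds s \<phi> (x, y)) \<and>
        integrable (lebesgue_on \<Omega>) (\<lambda>x. f x (u t x) * \<phi> x) \<and>
        (LINT x|lebesgue_on \<Omega>. v t x * \<phi> x)
          + (LINT (x, y)|mu_Q \<Omega>. g x y (Ds s (u t) (x, y)) * Ds s \<phi> (x, y))
        = (LINT x|lebesgue_on \<Omega>. f x (u t x) * \<phi> x)"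
    using weak_sol that unfolding weak_solution_with_def by blast
  then show ?thesis unfolding open_time_ereal
    by eventually_elim (simp add: tested_def g_pair_def split_def)
qed

text \<open>The two integrals over \<open>\<Omega>\<close> converge by domination with \<open>\<psi>\<close>; the gradient term needs bounded modulars
  only.\<close>

lemma tested_limit:
  assumes t: "t \<in> {0<..<T}" and vt: "v t \<in> L2_space \<Omega>"
    and \<phi>n: "\<And>n. \<phi>n n \<in> W0 s \<Omega> g" "\<And>n. tested t (\<phi>n n)" and \<phi>: "\<phi> \<in> W0 s \<Omega> g"
    and lim: "AE x in lebesgue. (\<lambda>n. \<phi>n n x) \<longlonglongrightarrow> \<phi> x"
    and C: "\<And>n. grad_energy (\<phi>n n) \<le> C"
    and dom: "\<And>n x. \<bar>\<phi>n n x\<bar> \<le> \<bar>\<psi> x\<bar>" and \<psi>: "\<psi> \<in> L2_space \<Omega>"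
    and f\<psi>: "integrable (lebesgue_on \<Omega>) (\<lambda>x. f x (u t x) * \<psi> x)"
  shows "tested t \<phi>"
proof -
  have ut: "u t \<in> W0 s \<Omega> g" using u_W0 t by auto
  have lim': "AE x in lebesgue_on \<Omega>. (\<lambda>n. \<phi>n n x) \<longlonglongrightarrow> \<phi> x" by (rule AE_on_if_AE_lebesgue[OF lim])
  have m: "\<phi>n n \<in> borel_measurable (lebesgue_on \<Omega>)" "\<phi> \<in> borel_measurable (lebesgue_on \<Omega>)" for n
    using W0_on \<phi>n(1) \<phi> by auto
  have conv: "integrable (lebesgue_on \<Omega>) (\<lambda>x. k x * \<phi> x) \<and>
    (\<lambda>n. LINT x|lebesgue_on \<Omega>. k x * \<phi>n n x) \<longlonglongrightarrow> (LINT x|lebesgue_on \<Omega>. k x * \<phi> x)"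
    if k: "k \<in> borel_measurable (lebesgue_on \<Omega>)" "integrable (lebesgue_on \<Omega>) (\<lambda>x. k x * \<psi> x)" for k
  proof (rule conjI)
    have a: "(\<lambda>x. k x * \<phi> x) \<in> borel_measurable (lebesgue_on \<Omega>)"
      "\<And>n. (\<lambda>x. k x * \<phi>n n x) \<in> borel_measurable (lebesgue_on \<Omega>)"
      using k m by (auto intro: borel_measurable_times)
    have b: "AE x in lebesgue_on \<Omega>. (\<lambda>n. k x * \<phi>n n x) \<longlonglongrightarrow> k x * \<phi> x"
      using lim' by eventually_elim (intro tendsto_intros)
    have c: "AE x in lebesgue_on \<Omega>. norm (k x * \<phi>n n x) \<le> \<bar>k x * \<psi> x\<bar>" for n
      by (rule AE_I2) (simp add: abs_mult mult_left_mono dom)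
    have d: "integrable (lebesgue_on \<Omega>) (\<lambda>x. \<bar>k x * \<psi> x\<bar>)" using k(2) by simp
    show "integrable (lebesgue_on \<Omega>) (\<lambda>x. k x * \<phi> x)"
      by (rule integrable_dominated_convergence[OF a d b c])
    show "(\<lambda>n. LINT x|lebesgue_on \<Omega>. k x * \<phi>n n x) \<longlonglongrightarrow> (LINT x|lebesgue_on \<Omega>. k x * \<phi> x)"
      by (rule integral_dominated_convergence[OF a d b c])
  qed
  have c1: "integrable (lebesgue_on \<Omega>) (\<lambda>x. v t x * \<phi> x)" "(\<lambda>n. ip (v t) (\<phi>n n)) \<longlonglongrightarrow> ip (v t) \<phi>"
    using conv[of "v t"] L2_spaceD(1)[OF vt] L2_integrable_mult[OF vt \<psi>] by auto
  have c2: "integrable (lebesgue_on \<Omega>) (\<lambda>x. f x (u t x) * \<phi> x)"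
    "(\<lambda>n. LINT x|lebesgue_on \<Omega>. f x (u t x) * \<phi>n n x) \<longlonglongrightarrow> (LINT x|lebesgue_on \<Omega>. f x (u t x) * \<phi> x)"
    using conv[of "\<lambda>x. f x (u t x)"] f_comp[OF W0_on[OF ut]] f\<psi> by auto
  have c3: "(\<lambda>n. LINT z|\<mu>. g_pair z (Ds s (u t) z) * Ds s (\<phi>n n) z) \<longlonglongrightarrow> (LINT z|\<mu>. g_pair z (Ds s (u t) z) * Ds s \<phi> z)"
    by (rule pairing_conv_test[OF Ds_finite_modular[OF ut] Ds_finite_modular[OF \<phi>n(1)] Ds_finite_modular[OF \<phi>] Ds_tendsto[OF lim] C[unfolded grad_energy_def]])
  have "(\<lambda>n. LINT x|lebesgue_on \<Omega>. f x (u t x) * \<phi>n n x) \<longlonglongrightarrow> ip (v t) \<phi> + (LINT z|\<mu>. g_pair z (Ds s (u t) z) * Ds s \<phi> z)"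
  proof -
    have "(\<lambda>n. ip (v t) (\<phi>n n) + (LINT z|\<mu>. g_pair z (Ds s (u t) z) * Ds s (\<phi>n n) z))
      = (\<lambda>n. LINT x|lebesgue_on \<Omega>. f x (u t x) * \<phi>n n x)"
      using \<phi>n(2) by (simp add: tested_def fun_eq_iff)
    then show ?thesis using tendsto_add[OF c1(2) c3] by simp
  qed
  then have "ip (v t) \<phi> + (LINT z|\<mu>. g_pair z (Ds s (u t) z) * Ds s \<phi> z) = (LINT x|lebesgue_on \<Omega>. f x (u t x) * \<phi> x)"
    using c2(2) by (rule LIMSEQ_unique)
  then show ?thesis using c1(1) c2(1) by (simp add: tested_def)
qed

lemma common_part_abs_le: "\<bar>common_part \<sigma> w w' x\<bar> \<le> \<bar>\<sigma>\<bar> * \<bar>w x\<bar>" "\<bar>common_part \<sigma> w w' x\<bar> \<le> \<bar>common_part \<sigma> w' w' x\<bar>"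
  "\<bar>common_part \<sigma> w w' x\<bar> \<le> \<bar>common_part \<sigma> w w x\<bar>"
  by (auto simp: common_part_def signed_part_def abs_mult[symmetric])

lemma common_part_L2: "common_part \<sigma> w w' \<in> L2_space \<Omega>"
  if w: "w \<in> L2_space \<Omega>" "w' \<in> L2_space \<Omega>" and \<sigma>: "\<bar>\<sigma>\<bar> = 1"
proof -
  have m: "common_part \<sigma> w w' \<in> borel_measurable (lebesgue_on \<Omega>)"
    unfolding common_part_def[abs_def] signed_part_def using L2_spaceD(1)[OF w(1)] L2_spaceD(1)[OF w(2)] by measurable
  have "integrable (lebesgue_on \<Omega>) (\<lambda>x. (common_part \<sigma> w w' x)\<^sup>2)"
  proof (rule Bochner_Integration.integrable_bound[OF L2_spaceD(2)[OF w(1)]])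
    show "(\<lambda>x. (common_part \<sigma> w w' x)\<^sup>2) \<in> borel_measurable (lebesgue_on \<Omega>)" using m by measurable
    show "AE x in lebesgue_on \<Omega>. norm ((common_part \<sigma> w w' x)\<^sup>2) \<le> norm ((w x)\<^sup>2)"
      using common_part_abs_le(1)[of \<sigma> w w'] \<sigma> by (intro AE_I2) (simp add: abs_le_square_iff[symmetric])
  qed
  with m show ?thesis by (simp add: L2_space_def)
qed

lemma common_part_tendsto:
  assumes "AE x in lebesgue. (\<lambda>n. wn n x) \<longlonglongrightarrow> w x"
  shows "AE x in lebesgue. (\<lambda>n. common_part \<sigma> (wn n) w' x) \<longlonglongrightarrow> common_part \<sigma> w w' x"
    "AE x in lebesgue. (\<lambda>n. common_part \<sigma> w' (wn n) x) \<longlonglongrightarrow> common_part \<sigma> w' w x"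
  using assms by (eventually_elim, auto simp: common_part_def signed_part_def intro!: tendsto_intros)+

text \<open>The weak equation may be tested with the solution. For almost every \<open>t\<close> all functions
  \<open>min(u(r)\<^sup>\<plusminus>, u(r')\<^sup>\<plusminus>)\<close> with rational \<open>r\<close> and \<open>r'\<close> are admitted. As \<open>r\<close> tends to \<open>t\<close>, the source term is
  dominated by \<open>f(u(t)) u(r')\<^sup>\<plusminus>\<close>, which is integrable as part of the weak equation for \<open>r = r'\<close>. As \<open>r'\<close>
  tends to \<open>t\<close>, it is dominated by \<open>f(u(t)) u(t)\<close>. Testing directly with \<open>u(r)\<close> would leave the set where
  \<open>u(r)\<close> and \<open>u(t)\<close> have opposite signs, where no integrable majorant is at hand.\<close>

lemma tested_self:
  "AE t in lebesgue. t \<in> {0<..<T} \<longrightarrow> v t \<in> L2_space \<Omega> \<and> ip (v t) (u t) = - I (u t)"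
proof -
  define A where "A = \<rat> \<inter> {0<..<T}"
  have A: "countable A" unfolding A_def using countable_rat by (rule countable_Int1)
  have "AE t in lebesgue. \<forall>\<sigma>\<in>{1,-1}. \<forall>r\<in>A. \<forall>r'\<in>A. t \<in> {0<..<T} \<longrightarrow> tested t (common_part \<sigma> (u r) (u r'))"
  proof (intro AE_ball_countable' A)
    fix \<sigma> r r' assume "\<sigma> \<in> {1, - 1 :: real}" "r \<in> A" "r' \<in> A"
    then show "AE t in lebesgue. t \<in> {0<..<T} \<longrightarrow> tested t (common_part \<sigma> (u r) (u r'))"
      by (intro AE_tested common_part_W0 u_W0) (auto simp: A_def)
  qed auto
  then show ?thesis
    using v_AE
  proof (eventually_elim, intro impI)
    fix t assume test0: "\<forall>\<sigma>\<in>{1,-1}. \<forall>r\<in>A. \<forall>r'\<in>A. t \<in> {0<..<T} \<longrightarrow> tested t (common_part \<sigma> (u r) (u r'))"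
      and vt0: "t \<in> {0<..<T} \<longrightarrow> v t \<in> L2_space \<Omega>" and t: "t \<in> {0<..<T}"
    have vt: "v t \<in> L2_space \<Omega>" using vt0 t by simp
    have test: "tested t (common_part \<sigma> (u r) (u r'))" if "\<sigma> = 1 \<or> \<sigma> = -1" "r \<in> A" "r' \<in> A" for \<sigma> r r'
      using test0 t that by auto
    have ut: "u t \<in> W0 s \<Omega> g" "u t \<in> L2_space \<Omega>" using u_W0[of t] u_L2[of t] t by auto
    have "\<exists>r. r \<in> \<rat> \<and> t < r \<and> r < min T (t + 1 / real (Suc n))" for n
      using Rats_dense_in_real[of t "min T (t + 1 / real (Suc n))"] t by auto
    then obtain q where q: "\<And>n. q n \<in> \<rat>" "\<And>n. t < q n" "\<And>n. q n < min T (t + 1 / real (Suc n))" by metis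
    have qA: "q n \<in> A" for n using q[of n] t by (auto simp: A_def)
    have "q \<longlonglongrightarrow> t"
    proof (rule tendsto_if_dist_le_inverse)
      show "\<bar>q n - t\<bar> \<le> 1 / real (Suc n)" for n using q(2,3)[of n] by (simp del: of_nat_Suc)
    qed
    moreover have "0 \<le> q n \<and> q n < T" for n using qA[of n] by (simp add: A_def)
    moreover have "0 \<le> t" "t < T" using t by auto
    ultimately obtain r :: "nat \<Rightarrow> nat" where "strict_mono r" and r: "AE x in lebesgue. (\<lambda>n. u (q (r n)) x) \<longlonglongrightarrow> u t x"
      using u_subseq[of q t] by blast
    define \<rho> where "\<rho> n = q (r n)" for n
    have \<rho>A: "\<rho> n \<in> A" for n by (simp add: \<rho>_def qA)
    have \<rho>: "0 \<le> \<rho> n" "\<rho> n < T" for n using \<rho>A[of n] by (auto simp: A_def)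
    have lim: "AE x in lebesgue. (\<lambda>n. u (\<rho> n) x) \<longlonglongrightarrow> u t x" using r by (simp add: \<rho>_def)
    have P2: "2 powr gp * (grad_energy (u a) + grad_energy (u b)) \<le> 2 powr gp * (grad_energy_sup + grad_energy_sup)" if "0 \<le> a" "a < T" "0 \<le> b" "b < T" for a b
      using grad_energy_le[of a] grad_energy_le[of b] that by (intro mult_left_mono add_mono) auto
    have signed_part: "tested t (common_part \<sigma> (u t) (u t))" if \<sigma>: "\<sigma> = 1 \<or> \<sigma> = -1" for \<sigma>
    proof -
      have \<sigma>1: "\<bar>\<sigma>\<bar> = 1" using \<sigma> by auto
      have half: "tested t (common_part \<sigma> (u t) (u (\<rho> k)))" for k
      proof (rule tested_limit[OF t vt, where \<phi>n = "\<lambda>n. common_part \<sigma> (u (\<rho> n)) (u (\<rho> k))" and \<psi> = "common_part \<sigma> (u (\<rho> k)) (u (\<rho> k))"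
            and C = "2 powr gp * (grad_energy_sup + grad_energy_sup)"])
        show "common_part \<sigma> (u (\<rho> n)) (u (\<rho> k)) \<in> W0 s \<Omega> g" for n by (rule common_part_W0(1)[OF u_W0 u_W0 \<sigma>1]) (use \<rho> in auto)
        show "tested t (common_part \<sigma> (u (\<rho> n)) (u (\<rho> k)))" for n by (rule test[OF \<sigma> \<rho>A \<rho>A])
        show "common_part \<sigma> (u t) (u (\<rho> k)) \<in> W0 s \<Omega> g" by (rule common_part_W0(1)[OF ut(1) u_W0 \<sigma>1]) (use \<rho> in auto)
        show "AE x in lebesgue. (\<lambda>n. common_part \<sigma> (u (\<rho> n)) (u (\<rho> k)) x) \<longlonglongrightarrow> common_part \<sigma> (u t) (u (\<rho> k)) x"
          by (rule common_part_tendsto(1)[OF lim])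
        show "grad_energy (common_part \<sigma> (u (\<rho> n)) (u (\<rho> k))) \<le> 2 powr gp * (grad_energy_sup + grad_energy_sup)" for n
          by (rule order.trans[OF common_part_W0(2)[OF u_W0 u_W0 \<sigma>1] P2]) (use \<rho> in auto)
        show "\<bar>common_part \<sigma> (u (\<rho> n)) (u (\<rho> k)) x\<bar> \<le> \<bar>common_part \<sigma> (u (\<rho> k)) (u (\<rho> k)) x\<bar>" for n x by (rule common_part_abs_le(2))
        show "common_part \<sigma> (u (\<rho> k)) (u (\<rho> k)) \<in> L2_space \<Omega>" by (rule common_part_L2[OF u_L2 u_L2 \<sigma>1]) (use \<rho>[of k] in auto)
        show "integrable (lebesgue_on \<Omega>) (\<lambda>x. f x (u t x) * common_part \<sigma> (u (\<rho> k)) (u (\<rho> k)) x)"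
          using test[OF \<sigma> \<rho>A \<rho>A, of k k] by (simp add: tested_def)
      qed
      show ?thesis
      proof (rule tested_limit[OF t vt, where \<phi>n = "\<lambda>n. common_part \<sigma> (u t) (u (\<rho> n))" and \<psi> = "common_part \<sigma> (u t) (u t)"
            and C = "2 powr gp * (grad_energy_sup + grad_energy_sup)"])
        show "common_part \<sigma> (u t) (u (\<rho> n)) \<in> W0 s \<Omega> g" for n by (rule common_part_W0(1)[OF ut(1) u_W0 \<sigma>1]) (use \<rho> in auto)
        show "tested t (common_part \<sigma> (u t) (u (\<rho> n)))" for n by (rule half)
        show "common_part \<sigma> (u t) (u t) \<in> W0 s \<Omega> g" by (rule common_part_W0(1)[OF ut(1) ut(1) \<sigma>1])
        show "AE x in lebesgue. (\<lambda>n. common_part \<sigma> (u t) (u (\<rho> n)) x) \<longlonglongrightarrow> common_part \<sigma> (u t) (u t) x"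
          by (rule common_part_tendsto(2)[OF lim])
        show "grad_energy (common_part \<sigma> (u t) (u (\<rho> n))) \<le> 2 powr gp * (grad_energy_sup + grad_energy_sup)" for n
          by (rule order.trans[OF common_part_W0(2)[OF ut(1) u_W0 \<sigma>1] P2]) (use \<rho> t in auto)
        show "\<bar>common_part \<sigma> (u t) (u (\<rho> n)) x\<bar> \<le> \<bar>common_part \<sigma> (u t) (u t) x\<bar>" for n x by (rule common_part_abs_le(3))
        show "common_part \<sigma> (u t) (u t) \<in> L2_space \<Omega>" by (rule common_part_L2[OF ut(2) ut(2) \<sigma>1])
        show "integrable (lebesgue_on \<Omega>) (\<lambda>x. f x (u t x) * common_part \<sigma> (u t) (u t) x)"
        proof (rule Bochner_Integration.integrable_bound)
          show "integrable (lebesgue_on \<Omega>) (\<lambda>x. f x (u t x) * u t x)" by (rule admissible_f_int[OF u_admissible]) (use t in auto)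
          show "(\<lambda>x. f x (u t x) * common_part \<sigma> (u t) (u t) x) \<in> borel_measurable (lebesgue_on \<Omega>)"
            using L2_spaceD(1)[OF common_part_L2[OF ut(2) ut(2) \<sigma>1]] f_comp[OF W0_on[OF ut(1)]] by (rule borel_measurable_times[rotated])
          show "AE x in lebesgue_on \<Omega>. norm (f x (u t x) * common_part \<sigma> (u t) (u t) x) \<le> norm (f x (u t x) * u t x)"
            using common_part_abs_le(1)[of \<sigma> "u t" "u t"] \<sigma>1 by (intro AE_I2) (simp add: abs_mult mult_left_mono)
        qed
      qed
    qed
    have split: "u t x = common_part 1 (u t) (u t) x - common_part (-1) (u t) (u t) x" for x
      by (auto simp: common_part_def signed_part_def)
    have splitD: "Ds s (u t) z = Ds s (common_part 1 (u t) (u t)) z - Ds s (common_part (-1) (u t) (u t)) z" for z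
      using split by (simp add: Ds_def split_def diff_divide_distrib[symmetric] algebra_simps)
    have p: "tested t (common_part 1 (u t) (u t))" "tested t (common_part (-1) (u t) (u t))" using signed_part by auto
    have W: "common_part 1 (u t) (u t) \<in> W0 s \<Omega> g" "common_part (-1) (u t) (u t) \<in> W0 s \<Omega> g"
      using common_part_W0(1)[OF ut(1) ut(1)] by auto
    have 1: "ip (v t) (u t) = ip (v t) (common_part 1 (u t) (u t)) - ip (v t) (common_part (-1) (u t) (u t))"
      using p by (subst split) (simp add: tested_def right_diff_distrib)
    have 2: "(LINT x|lebesgue_on \<Omega>. f x (u t x) * u t x) = (LINT x|lebesgue_on \<Omega>. f x (u t x) * common_part 1 (u t) (u t) x)
        - (LINT x|lebesgue_on \<Omega>. f x (u t x) * common_part (-1) (u t) (u t) x)"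
    proof -
      have "(LINT x|lebesgue_on \<Omega>. f x (u t x) * u t x)
        = (LINT x|lebesgue_on \<Omega>. f x (u t x) * common_part 1 (u t) (u t) x - f x (u t x) * common_part (-1) (u t) (u t) x)"
        by (rule Bochner_Integration.integral_cong) (use split in \<open>simp_all add: right_diff_distrib[symmetric]\<close>)
      then show ?thesis using p by (simp add: tested_def)
    qed
    have 3: "(LINT z|\<mu>. g_pair z (Ds s (u t) z) * Ds s (u t) z)
      = (LINT z|\<mu>. g_pair z (Ds s (u t) z) * Ds s (common_part 1 (u t) (u t)) z) - (LINT z|\<mu>. g_pair z (Ds s (u t) z) * Ds s (common_part (-1) (u t) (u t)) z)"
    proof -
      have "(LINT z|\<mu>. g_pair z (Ds s (u t) z) * Ds s (u t) z)
        = (LINT z|\<mu>. g_pair z (Ds s (u t) z) * Ds s (common_part 1 (u t) (u t)) z - g_pair z (Ds s (u t) z) * Ds s (common_part (-1) (u t) (u t)) z)"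
        by (rule Bochner_Integration.integral_cong) (use splitD in \<open>simp_all add: right_diff_distrib[symmetric]\<close>)
      then show ?thesis
        using finite_modular_mult[OF Ds_finite_modular[OF ut(1)] Ds_finite_modular[OF W(1)]] finite_modular_mult[OF Ds_finite_modular[OF ut(1)] Ds_finite_modular[OF W(2)]] by simp
    qed
    have "ip (v t) (u t) = - I (u t)" unfolding I_eq using 1 2 3 p by (simp add: tested_def)
    then show "v t \<in> L2_space \<Omega> \<and> ip (v t) (u t) = - I (u t)" using vt by simp
  qed
qed

lemma u_0_AE: "AE x in lebesgue. u 0 x = u0 x"
proof (rule AE_lebesgue_if_AE_on)
  show "AE x in lebesgue_on \<Omega>. u 0 x = u0 x" using weak_sol unfolding weak_solution_with_def by blast
  show "AE x in lebesgue. x \<notin> \<Omega> \<longrightarrow> u 0 x = u0 x"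
  proof -
    have "AE x in lebesgue. x \<notin> \<Omega> \<longrightarrow> u 0 x = 0" by (rule W0_D(2)[OF u_W0]) (use T in auto)
    with W0_D(2)[OF u0(1)] show ?thesis by eventually_elim simp
  qed
qed

lemma I_0: "I (u 0) < 0"
  using I_cong[OF u_W0[of 0] u0(1) u_0_AE] u0(3) T by simp

lemma source_energy_bound: "source_energy (u t) \<le> grad_energy_sup - E (u 0) + dissipation T" if "0 \<le> t" "t < T"
  using grad_energy_le[OF that] energy[OF that] dissipation_mono[of t] that E_eq[of "u t"] by simp

text \<open>Let \<open>t0\<close> be the first time with \<open>I \<ge> 0\<close> and \<open>c = u t0\<close>. Before \<open>t0\<close> the potential well gives
  \<open>- I(u) \<ge> \<delta> > 0\<close>. As \<open>t\<close> approaches \<open>t0\<close>, the gradient term with coefficient \<open>u(t)\<close> and test function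
  \<open>c\<close> converges, and the limes superior of the integral of \<open>f(u(t)) c\<close> is at most the integral of
  \<open>f(c) c\<close>, since opposite signs only contribute negative values. So \<open>(v(t), u(t) - c) \<ge> \<delta> / 2\<close>
  shortly before \<open>t0\<close>, which makes \<open>\<parallel>u(t) - c\<parallel>\<^sup>2\<close> increase towards its value \<open>0\<close>.\<close>

lemma invariant: "I (u t) < 0" if t: "0 \<le> t" "t < T"
proof (rule ccontr)
  assume bad: "\<not> I (u t) < 0"
  define A where "A = {t. 0 \<le> t \<and> t < T \<and> 0 \<le> I (u t)}"
  have tA: "t \<in> A" using t bad by (simp add: A_def)
  define t0 where "t0 = Inf A"
  have bdd: "bdd_below A" by (rule bdd_belowI[of _ 0]) (simp add: A_def)
  have "t0 \<le> t" unfolding t0_def by (rule cInf_lower[OF tA bdd])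
  then have t0T: "t0 < T" using t by simp
  have "A \<noteq> {}" "\<And>\<tau>. \<tau> \<in> A \<Longrightarrow> 0 \<le> \<tau>" using tA by (auto simp: A_def)
  then have "0 \<le> t0" unfolding t0_def by (rule cInf_greatest)
  note t0 = this t0T
  have below: "I (u \<tau>) < 0" if \<tau>: "0 \<le> \<tau>" "\<tau> < t0" for \<tau>
  proof (rule ccontr)
    assume "\<not> I (u \<tau>) < 0"
    then have "\<tau> \<in> A" using \<tau> t0 by (simp add: A_def)
    then have "t0 \<le> \<tau>" unfolding t0_def by (rule cInf_lower[OF _ bdd])
    then show False using \<tau> by simp
  qed
  \<comment> \<open>upper semicontinuity of the Nehari functional along the flow\<close>
  have I0: "0 \<le> I (u t0)"
  proof -
    have "\<exists>\<tau>\<in>A. \<tau> < t0 + 1 / real (Suc n)" for n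
      by (rule cInf_lessD[OF \<open>A \<noteq> {}\<close>]) (simp add: t0_def)
    then obtain tn where tn: "\<And>n. tn n \<in> A" "\<And>n. tn n < t0 + 1 / real (Suc n)" by metis
    have tn0: "t0 \<le> tn n" for n unfolding t0_def by (rule cInf_lower[OF tn(1) bdd])
    have tnT: "0 \<le> tn n" "tn n < T" "0 \<le> I (u (tn n))" for n using tn(1)[of n] by (auto simp: A_def)
    have lim: "tn \<longlonglongrightarrow> t0"
    proof (rule tendsto_if_dist_le_inverse)
      show "\<bar>tn n - t0\<bar> \<le> 1 / real (Suc n)" for n using tn(2)[of n] tn0[of n] by (simp del: of_nat_Suc)
    qed
    then obtain r :: "nat \<Rightarrow> nat" where r: "strict_mono r" "AE x in lebesgue. (\<lambda>n. u (tn (r n)) x) \<longlonglongrightarrow> u t0 x"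
      using u_subseq[of tn t0] tnT t0 by blast
    have "\<alpha> * E (u t0) - I (u t0) \<le> \<alpha> * E (u t0)"
    proof (rule defect_lsc[OF _ _ r(2)])
      show "\<alpha> * E (u (tn (r n))) - I (u (tn (r n))) \<le> \<alpha> * E (u (tn (r n)))" for n using tnT by simp
      have "(\<lambda>n. dissipation (tn (r n))) \<longlonglongrightarrow> dissipation t0"
        by (rule continuous_on_tendsto_compose[OF dissipation_cont])
          (use LIMSEQ_subseq_LIMSEQ[OF lim r(1)] tnT t0 in \<open>auto simp: o_def less_imp_le\<close>)
      then show "(\<lambda>n. \<alpha> * E (u (tn (r n)))) \<longlonglongrightarrow> \<alpha> * E (u t0)"
        unfolding energy[OF tnT(1,2)] energy[OF t0] by (intro tendsto_intros)
    qed (use u_admissible tnT t0 in auto)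
    then show ?thesis by simp
  qed
  then have t0p: "0 < t0" using I_0 t0 by (cases "t0 = 0") auto
  define c where "c = u t0"
  have cW: "c \<in> W0 s \<Omega> g" "admissible c" "c \<in> L2_space \<Omega>" using u_W0[OF t0] u_admissible[OF t0] u_L2[of t0] t0 by (auto simp: c_def)
  define \<delta> where "\<delta> = \<alpha> * (d - E u0)"
  have \<delta>: "0 < \<delta>" using u0(2) \<alpha> by (simp add: \<delta>_def)
  define good where "good \<tau> \<longleftrightarrow> v \<tau> \<in> L2_space \<Omega> \<and> ip (v \<tau>) (u \<tau>) = - I (u \<tau>) \<and> tested \<tau> c" for \<tau>
  have goodAE: "AE \<tau> in lebesgue. \<tau> \<in> {0<..<T} \<longrightarrow> good \<tau>"
    using tested_self AE_tested[OF cW(1)] by eventually_elim (auto simp: good_def)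
  \<comment> \<open>just before time t0 the distance to the state at time t0 would have to grow\<close>
  have "\<exists>\<eta>>0. \<forall>\<tau>. t0 - \<eta> < \<tau> \<longrightarrow> \<tau> < t0 \<longrightarrow> 0 < \<tau> \<longrightarrow> good \<tau> \<longrightarrow> \<delta> / 2 + ip (v \<tau>) c \<le> ip (v \<tau>) (u \<tau>)"
  proof (rule ccontr)
    assume neg: "\<not> ?thesis"
    have "\<exists>\<tau>. t0 - 1 / real (Suc n) < \<tau> \<and> \<tau> < t0 \<and> 0 < \<tau> \<and> good \<tau> \<and> ip (v \<tau>) (u \<tau>) < \<delta> / 2 + ip (v \<tau>) c" for n
    proof -
      have "0 < 1 / real (Suc n)" by simp
      then have "\<not> (\<forall>\<tau>. t0 - 1 / real (Suc n) < \<tau> \<longrightarrow> \<tau> < t0 \<longrightarrow> 0 < \<tau> \<longrightarrow> good \<tau> \<longrightarrow> \<delta> / 2 + ip (v \<tau>) c \<le> ip (v \<tau>) (u \<tau>))"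
        using neg by blast
      then show ?thesis by (simp only: not_all not_imp not_le)
    qed
    then have "\<exists>tn. \<forall>n. t0 - 1 / real (Suc n) < tn n \<and> tn n < t0 \<and> 0 < tn n \<and> good (tn n)
      \<and> ip (v (tn n)) (u (tn n)) < \<delta> / 2 + ip (v (tn n)) c" by (intro choice allI)
    then obtain tn where tn: "\<And>n. t0 - 1 / real (Suc n) < tn n" "\<And>n. tn n < t0" "\<And>n. 0 < tn n" "\<And>n. good (tn n)"
      "\<And>n. ip (v (tn n)) (u (tn n)) < \<delta> / 2 + ip (v (tn n)) c" by blast
    have lim: "tn \<longlonglongrightarrow> t0"
    proof (rule tendsto_if_dist_le_inverse)
      show "\<bar>tn n - t0\<bar> \<le> 1 / real (Suc n)" for n using tn(1,2)[of n] by (simp del: of_nat_Suc)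
    qed
    have tnT: "0 \<le> tn n \<and> tn n < T" for n using tn(2,3)[of n] t0 by simp
    obtain r :: "nat \<Rightarrow> nat" where "strict_mono r" and r: "AE x in lebesgue. (\<lambda>n. u (tn (r n)) x) \<longlonglongrightarrow> u t0 x"
      by (rule u_subseq[OF tnT t0 lim])
    define \<rho> where "\<rho> n = tn (r n)" for n
    have \<rho>: "0 \<le> \<rho> n" "\<rho> n < T" "\<rho> n < t0" "good (\<rho> n)" "ip (v (\<rho> n)) (u (\<rho> n)) < \<delta> / 2 + ip (v (\<rho> n)) c" for n
      using tn(2-5)[of "r n"] t0 by (auto simp: \<rho>_def)
    have lim: "AE x in lebesgue. (\<lambda>n. u (\<rho> n) x) \<longlonglongrightarrow> c x" using r by (simp add: \<rho>_def c_def)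
    have un: "u (\<rho> n) \<in> W0 s \<Omega> g" "admissible (u (\<rho> n))" for n using u_W0 u_admissible \<rho> by auto
    have G: "(\<lambda>n. LINT z|\<mu>. g_pair z (Ds s (u (\<rho> n)) z) * Ds s c z) \<longlonglongrightarrow> (LINT z|\<mu>. g_pair z (Ds s c z) * Ds s c z)"
      by (rule pairing_conv_coeff[OF Ds_finite_modular[OF un(1)] Ds_finite_modular[OF cW(1)] Ds_finite_modular[OF cW(1)] Ds_tendsto[OF lim] grad_energy_le[unfolded grad_energy_def]])
        (use \<rho> in auto)
    have evG: "\<forall>\<^sub>F n in sequentially. (LINT z|\<mu>. g_pair z (Ds s c z) * Ds s c z) - \<delta> / 4 < (LINT z|\<mu>. g_pair z (Ds s (u (\<rho> n)) z) * Ds s c z)"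
      by (rule order_tendstoD(1)[OF G]) (use \<delta> in simp)
    have evF: "\<forall>\<^sub>F n in sequentially. (LINT x|lebesgue_on \<Omega>. f x (u (\<rho> n) x) * c x) \<le> (LINT x|lebesgue_on \<Omega>. f x (c x) * c x) + \<delta> / 4"
    proof (rule integral_limsup_le[where e = "\<lambda>n x. f x (u (\<rho> n) x) * u (\<rho> n) x" and C = "h2_sup * (grad_energy_sup - E (u 0) + dissipation T)"])
      show "integrable (lebesgue_on \<Omega>) (\<lambda>x. f x (u (\<rho> n) x) * c x)" for n using \<rho>(4)[of n] by (simp add: good_def tested_def)
      show "integrable (lebesgue_on \<Omega>) (\<lambda>x. f x (c x) * c x)" by (rule admissible_f_int[OF cW(2)])
      show "integrable (lebesgue_on \<Omega>) (\<lambda>x. f x (u (\<rho> n) x) * u (\<rho> n) x)" for n by (rule admissible_f_int[OF un(2)])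
      have "AE x in lebesgue_on \<Omega>. x \<in> \<Omega>" by (rule AE_I2) simp
      then show "AE x in lebesgue_on \<Omega>. (\<lambda>n. f x (u (\<rho> n) x) * c x) \<longlonglongrightarrow> f x (c x) * c x"
        using AE_on_if_AE_lebesgue[OF lim]
      proof eventually_elim
        fix x assume x: "x \<in> \<Omega>" and l: "(\<lambda>n. u (\<rho> n) x) \<longlonglongrightarrow> c x"
        have "(\<lambda>n. f x (u (\<rho> n) x)) \<longlonglongrightarrow> f x (c x)"
          using source_term.f_cont[OF f_source[OF x]] l
          by (metis continuous_on_eq_continuous_at isCont_tendsto_compose open_UNIV UNIV_I)
        then show "(\<lambda>n. f x (u (\<rho> n) x) * c x) \<longlonglongrightarrow> f x (c x) * c x" by (intro tendsto_intros)
      qed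
      show "AE x in lebesgue_on \<Omega>. 0 \<le> f x (u (\<rho> n) x) * u (\<rho> n) x" for n by (rule AE_I2) (simp add: ft_nonneg)
      show "(LINT x|lebesgue_on \<Omega>. f x (u (\<rho> n) x) * u (\<rho> n) x) \<le> h2_sup * (grad_energy_sup - E (u 0) + dissipation T)" for n
        using f_int_le[OF un(2)[of n]] mult_left_mono[OF source_energy_bound[OF \<rho>(1,2)[of n]], of h2_sup] h2_sup(2) by linarith
      show "0 < \<delta> / 4" using \<delta> by simp
      fix \<epsilon> :: real assume \<epsilon>: "0 < \<epsilon>"
      show "\<exists>H. integrable (lebesgue_on \<Omega>) H \<and> (\<forall>n. AE x in lebesgue_on \<Omega>. f x (u (\<rho> n) x) * c x \<le> H x + \<epsilon> * (f x (u (\<rho> n) x) * u (\<rho> n) x))"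
      proof (intro exI[of _ "\<lambda>x. f x (c x / \<epsilon>) * c x"] conjI allI AE_I2)
        have "admissible (\<lambda>x. (1/\<epsilon>) * c x)" by (rule admissible_multiple[OF cW(2)]) (use \<epsilon> in simp)
        then have "integrable (lebesgue_on \<Omega>) (\<lambda>x. \<epsilon> * (f x ((1/\<epsilon>) * c x) * ((1/\<epsilon>) * c x)))"
          by (intro integrable_mult_right admissible_f_int)
        then show "integrable (lebesgue_on \<Omega>) (\<lambda>x. f x (c x / \<epsilon>) * c x)" using \<epsilon> by simp
        fix n x assume "x \<in> space (lebesgue_on \<Omega>)"
        then have x: "x \<in> \<Omega>" by simp
        show "f x (u (\<rho> n) x) * c x \<le> f x (c x / \<epsilon>) * c x + \<epsilon> * (f x (u (\<rho> n) x) * u (\<rho> n) x)"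
          using mono_mult_young[OF source_term.mono[OF f_source[OF x]] source_term.zero(2)[OF f_source[OF x]] \<epsilon>, of "u (\<rho> n) x" "c x"]
          by simp
      qed
    qed
    obtain n where n: "(LINT z|\<mu>. g_pair z (Ds s c z) * Ds s c z) - \<delta> / 4 < (LINT z|\<mu>. g_pair z (Ds s (u (\<rho> n)) z) * Ds s c z)"
      "(LINT x|lebesgue_on \<Omega>. f x (u (\<rho> n) x) * c x) \<le> (LINT x|lebesgue_on \<Omega>. f x (c x) * c x) + \<delta> / 4"
      using eventually_happens'[OF sequentially_bot eventually_conj[OF evG evF]] by auto
    have "\<delta> \<le> - I (u (\<rho> n))"
    proof -
      have "\<alpha> * d \<le> \<alpha> * E (u (\<rho> n)) - I (u (\<rho> n))" by (rule depth_le_defect[OF un(2) below]) (use \<rho> in auto)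
      moreover have "\<alpha> * E (u (\<rho> n)) \<le> \<alpha> * E u0" using energy_le[OF \<rho>(1,2)] \<alpha> by (intro mult_left_mono) auto
      ultimately show ?thesis by (simp add: \<delta>_def right_diff_distrib)
    qed
    moreover have "ip (v (\<rho> n)) c + (LINT z|\<mu>. g_pair z (Ds s (u (\<rho> n)) z) * Ds s c z) = (LINT x|lebesgue_on \<Omega>. f x (u (\<rho> n) x) * c x)"
      "ip (v (\<rho> n)) (u (\<rho> n)) = - I (u (\<rho> n))"
      using \<rho>(4)[of n] by (auto simp: good_def tested_def)
    moreover have "0 \<le> (LINT z|\<mu>. g_pair z (Ds s c z) * Ds s c z) - (LINT x|lebesgue_on \<Omega>. f x (c x) * c x)"
      using I0 by (simp add: I_eq c_def)
    ultimately show False using \<rho>(5)[of n] n by linarith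
  qed
  then obtain \<eta> where \<eta>: "0 < \<eta>" "\<And>\<tau>. t0 - \<eta> < \<tau> \<Longrightarrow> \<tau> < t0 \<Longrightarrow> 0 < \<tau> \<Longrightarrow> good \<tau> \<Longrightarrow> \<delta> / 2 + ip (v \<tau>) c \<le> ip (v \<tau>) (u \<tau>)"
    by blast
  define r where "r = max (t0 / 2) (t0 - \<eta> / 2)"
  have r: "0 < r" "r < t0" "t0 - \<eta> < r" using t0p \<eta>(1) by (auto simp: r_def)
  have vc: "(\<lambda>\<tau>. ip (v \<tau>) c) absolutely_integrable_on {r..t0}"
    by (rule set_integrable_subset[OF v_pairing_integrable[OF cW(3)]]) (use r t0 in auto)
  have k: "(\<lambda>\<tau>. \<delta> / 2 + ip (v \<tau>) c) absolutely_integrable_on {r..t0}"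
    by (intro set_integral_add vc absolutely_integrable_continuous_real continuous_intros)
  have net0: "AE \<tau> in lebesgue. \<tau> \<noteq> t0" by (rule AE_I'[of "{t0}"]) auto
  have "2 * integral {r..t0} (\<lambda>\<tau>. \<delta> / 2 + ip (v \<tau>) c) \<le> 1 * ((L2_norm \<Omega> (u t0))\<^sup>2 - (L2_norm \<Omega> (u r))\<^sup>2)"
  proof (rule norm_sq_increment_ge[OF _ _ _ _ k])
    show "AE \<tau> in lebesgue. \<tau> \<in> {r..t0} \<longrightarrow> \<delta> / 2 + ip (v \<tau>) c \<le> 1 * ip (v \<tau>) (u \<tau>)"
      using goodAE net0 by eventually_elim (use \<eta>(2) r t0 in auto)
  qed (use r t0 in auto)
  moreover have "integral {r..t0} (\<lambda>\<tau>. \<delta> / 2 + ip (v \<tau>) c) = \<delta> / 2 * (t0 - r) + (ip (u t0) c - ip (u r) c)"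
  proof -
    have "integral {r..t0} (\<lambda>\<tau>. \<delta> / 2 + ip (v \<tau>) c) = integral {r..t0} (\<lambda>\<tau>. \<delta> / 2) + integral {r..t0} (\<lambda>\<tau>. ip (v \<tau>) c)"
      by (rule Henstock_Kurzweil_Integration.integral_add) (use set_lebesgue_integral_eq_integral(1)[OF vc] in auto)
    then show ?thesis using increment[OF cW(3), of r t0] r t0 by (simp add: mult.commute)
  qed
  moreover have "(L2_norm \<Omega> (u t0))\<^sup>2 - (L2_norm \<Omega> (u r))\<^sup>2 \<le> 2 * (ip (u t0) c - ip (u r) c)"
  proof -
    have ur: "u r \<in> L2_space \<Omega>" using u_L2[of r] r t0 by simp
    have "ip (u t0) c = (L2_norm \<Omega> (u t0))\<^sup>2" unfolding L2_norm_sq c_def by (simp only: power2_eq_square)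
    moreover have "2 * ip (u r) c \<le> (L2_norm \<Omega> (u r))\<^sup>2 + (L2_norm \<Omega> (u t0))\<^sup>2"
      using L2_young[OF ur cW(3), of 1] by (simp add: c_def)
    ultimately show ?thesis by simp
  qed
  ultimately have "\<delta> * (t0 - r) \<le> 0" by simp
  then show False using \<delta> r by (simp add: mult_le_0_iff)
qed

end

section \<open>Levine's concavity argument\<close>

text \<open>Levine's argument without second derivatives. Here \<open>w\<close> stands for \<open>\<parallel>u\<parallel>\<^sup>2\<close> and \<open>V\<close> for the integral of
  \<open>\<parallel>u\<^sub>t\<parallel>\<^sup>2\<close>. The function \<open>M\<close> has derivative \<open>2 K\<close>, and \<open>K\<close> lies above the continuously differentiable
  function \<open>L\<close> with derivative \<open>\<alpha> (V + \<beta>) \<ge> \<alpha> K\<^sup>2 / M\<close>. Therefore \<open>L M powr (- \<alpha> / 2)\<close> is nondecreasing,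
  which bounds the derivative of \<open>M powr (- \<gamma>)\<close> by its value at \<open>0\<close>. The hypothesis \<open>upper\<close>, required for
  every \<open>\<epsilon>\<close>, is a Cauchy--Schwarz inequality in time.\<close>

lemma concavity_lower_bound:
  fixes w V :: "real \<Rightarrow> real"
  assumes t: "0 \<le> t" "t < Ts"
    and wc: "continuous_on {0..t} w" and Vc: "continuous_on {0..t} V"
    and w0: "w 0 = a" and pos: "0 < a" "0 < \<beta>" "2 < \<alpha>"
    and wn: "\<And>\<tau>. \<tau> \<in> {0..t} \<Longrightarrow> 0 \<le> w \<tau>" and Vn: "\<And>\<tau>. \<tau> \<in> {0..t} \<Longrightarrow> 0 \<le> V \<tau>"
    and Ts: "Ts = 4 * a / ((\<alpha> - 2)\<^sup>2 * \<beta>)"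
    and lower: "\<And>\<tau>. \<tau> \<in> {0..t} \<Longrightarrow> 2 * integral {0..\<tau>} (\<lambda>r. \<alpha> * (V r + \<beta>)) - 2 * \<beta> * \<tau> \<le> w \<tau> - a"
    and upper: "\<And>\<tau> \<epsilon>. \<tau> \<in> {0..t} \<Longrightarrow> 0 < \<epsilon> \<Longrightarrow> w \<tau> - a \<le> \<epsilon> * integral {0..\<tau>} w + V \<tau> / \<epsilon>"
  shows "2 * a * Ts * (1 - t / Ts) powr (- 2 / (\<alpha> - 2))
    \<le> integral {0..t} w + (Ts - t) * a + \<beta> * (t + (\<alpha> - 2) / 2 * Ts)\<^sup>2"
proof -
  define \<gamma> where "\<gamma> = (\<alpha> - 2) / 2"
  have \<gamma>: "0 < \<gamma>" "\<alpha> / 2 = \<gamma> + 1" "\<alpha> - 2 = 2 * \<gamma>" using pos by (simp_all add: \<gamma>_def field_simps)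
  have Ts': "Ts = a / (\<gamma>\<^sup>2 * \<beta>)" unfolding Ts \<gamma>(3) by (simp add: power_mult_distrib)
  have Tp: "0 < Ts" using t by simp
  define \<sigma> where "\<sigma> = \<gamma> * Ts"
  have \<sigma>: "0 < \<sigma>" using \<gamma> Tp by (simp add: \<sigma>_def)
  \<comment> \<open>The shift \<open>\<sigma>\<close> minimises the zero of the tangent to \<open>M powr (- \<gamma>)\<close> at \<open>0\<close>, and the minimum is \<open>Ts\<close>.\<close>
  have \<beta>\<sigma>: "\<gamma> * \<beta> * \<sigma> = a" "\<beta> * \<sigma>\<^sup>2 = a * Ts"
    using \<gamma> pos by (simp_all add: \<sigma>_def Ts' power2_eq_square field_simps)
  define M where "M \<tau> = integral {0..\<tau>} w + (Ts - \<tau>) * a + \<beta> * (\<tau> + \<sigma>)\<^sup>2" for \<tau>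
  define K where "K \<tau> = (w \<tau> - a) / 2 + \<beta> * (\<tau> + \<sigma>)" for \<tau>
  define L where "L \<tau> = \<beta> * \<sigma> + integral {0..\<tau>} (\<lambda>r. \<alpha> * (V r + \<beta>))" for \<tau>
  have M0: "M 0 = 2 * a * Ts" by (simp add: M_def \<beta>\<sigma> mult.commute)
  have L0: "L 0 = \<beta> * \<sigma>" by (simp add: L_def)
  have kc: "continuous_on {0..t} (\<lambda>r. \<alpha> * (V r + \<beta>))" by (intro continuous_intros Vc)
  have kn: "0 \<le> \<alpha> * (V r + \<beta>)" if "r \<in> {0..t}" for r using Vn[OF that] pos by simp
  have ii: "w integrable_on {0..\<tau>}" "(\<lambda>r. \<alpha> * (V r + \<beta>)) integrable_on {0..\<tau>}" if "\<tau> \<in> {0..t}" for \<tau>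
    using that by (auto intro!: integrable_continuous_real intro: continuous_on_subset[OF wc] continuous_on_subset[OF kc])
  have dW: "((\<lambda>\<tau>. integral {0..\<tau>} w) has_real_derivative w \<tau>) (at \<tau> within {0..t})" if "\<tau> \<in> {0..t}" for \<tau>
    by (rule integral_has_real_derivative[OF wc that])
  have dM: "(M has_real_derivative 2 * K \<tau>) (at \<tau> within {0..t})" if "\<tau> \<in> {0..t}" for \<tau>
    unfolding M_def[abs_def] K_def
    by (auto intro!: derivative_eq_intros dW[OF that] simp: field_simps)
  have dL: "(L has_real_derivative \<alpha> * (V \<tau> + \<beta>)) (at \<tau> within {0..t})" if "\<tau> \<in> {0..t}" for \<tau>
    unfolding L_def[abs_def]
    using DERIV_add[OF DERIV_const integral_has_real_derivative[OF kc that]] by (simp only: add_0)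
  have Mpos: "0 < M \<tau>" if "\<tau> \<in> {0..t}" for \<tau>
  proof -
    have "0 \<le> integral {0..\<tau>} w"
      by (rule Henstock_Kurzweil_Integration.integral_nonneg[OF ii(1)[OF that]]) (use that wn in auto)
    moreover have "0 < (Ts - \<tau>) * a" using that t pos by simp
    moreover have "0 \<le> \<beta> * (\<tau> + \<sigma>)\<^sup>2" using pos by simp
    ultimately show ?thesis unfolding M_def by linarith
  qed
  have KL: "L \<tau> \<le> K \<tau>" if "\<tau> \<in> {0..t}" for \<tau>
  proof -
    have "2 * X - 2 * b * r \<le> y \<Longrightarrow> b * c + X \<le> y / 2 + b * (r + c)" for X b r c y :: real
      by (simp add: field_simps)
    then show ?thesis using lower[OF that] unfolding L_def K_def by blast
  qed
  have Lpos: "0 < L \<tau>" if "\<tau> \<in> {0..t}" for \<tau>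
  proof -
    have "0 \<le> integral {0..\<tau>} (\<lambda>r. \<alpha> * (V r + \<beta>))"
      by (rule Henstock_Kurzweil_Integration.integral_nonneg[OF ii(2)[OF that]]) (use that kn in auto)
    then show ?thesis using pos \<sigma> by (simp add: L_def add_pos_nonneg)
  qed
  \<comment> \<open>the Cauchy--Schwarz inequality in space and time\<close>
  have CS: "(K \<tau>)\<^sup>2 \<le> M \<tau> * (V \<tau> + \<beta>)" if \<tau>: "\<tau> \<in> {0..t}" for \<tau>
  proof -
    have Kp: "0 < K \<tau>" using KL[OF \<tau>] Lpos[OF \<tau>] by simp
    define \<epsilon> where "\<epsilon> = K \<tau> / M \<tau>"
    have \<epsilon>: "0 < \<epsilon>" using Kp Mpos[OF \<tau>] by (simp add: \<epsilon>_def)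
    have "2 * (\<tau> + \<sigma>) \<le> \<epsilon> * (\<tau> + \<sigma>)\<^sup>2 + 1 / \<epsilon>"
    proof -
      have "0 \<le> (\<epsilon> * (\<tau> + \<sigma>) - 1)\<^sup>2 / \<epsilon>" using \<epsilon> by simp
      also have "\<dots> = \<epsilon> * (\<tau> + \<sigma>)\<^sup>2 + 1 / \<epsilon> - 2 * (\<tau> + \<sigma>)"
        using \<epsilon> by (simp add: power2_diff field_simps power2_eq_square)
      finally show ?thesis by simp
    qed
    then have "\<beta> * (2 * (\<tau> + \<sigma>)) \<le> \<beta> * (\<epsilon> * (\<tau> + \<sigma>)\<^sup>2 + 1 / \<epsilon>)" using pos by (intro mult_left_mono) auto
    moreover have "0 \<le> \<epsilon> * ((Ts - \<tau>) * a)" using \<epsilon> \<tau> t pos by simp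
    ultimately have "2 * K \<tau> \<le> \<epsilon> * M \<tau> + (V \<tau> + \<beta>) / \<epsilon>"
    proof -
      have K2: "2 * K \<tau> = (w \<tau> - a) + \<beta> * (2 * (\<tau> + \<sigma>))" by (simp add: K_def field_simps)
      have M2: "\<epsilon> * M \<tau> + (V \<tau> + \<beta>) / \<epsilon> = (\<epsilon> * integral {0..\<tau>} w + V \<tau> / \<epsilon>)
        + \<epsilon> * ((Ts - \<tau>) * a) + \<beta> * (\<epsilon> * (\<tau> + \<sigma>)\<^sup>2 + 1 / \<epsilon>)"
        by (simp add: M_def distrib_left add_divide_distrib)
      show ?thesis unfolding K2 M2
        using add_mono[OF add_mono[OF upper[OF \<tau> \<epsilon>] \<open>0 \<le> \<epsilon> * ((Ts - \<tau>) * a)\<close>]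
          \<open>\<beta> * (2 * (\<tau> + \<sigma>)) \<le> \<beta> * (\<epsilon> * (\<tau> + \<sigma>)\<^sup>2 + 1 / \<epsilon>)\<close>] by simp
    qed
    also have "\<epsilon> * M \<tau> = K \<tau>" using Mpos[OF \<tau>] by (simp add: \<epsilon>_def)
    finally have "K \<tau> \<le> (V \<tau> + \<beta>) / \<epsilon>" by simp
    then have "K \<tau> * \<epsilon> \<le> V \<tau> + \<beta>" using \<epsilon> by (simp add: le_divide_eq)
    then have "M \<tau> * (K \<tau> * \<epsilon>) \<le> M \<tau> * (V \<tau> + \<beta>)" using Mpos[OF \<tau>] by (intro mult_left_mono) auto
    moreover have "M \<tau> * (K \<tau> * \<epsilon>) = (K \<tau>)\<^sup>2" using Mpos[OF \<tau>] by (simp add: \<epsilon>_def power2_eq_square)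
    ultimately show ?thesis by simp
  qed
  have int: "at \<tau> within {0..t} = at \<tau>" if "0 < \<tau>" "\<tau> < t" for \<tau>
    by (rule at_within_interior) (use that in auto)
  have Mc: "continuous_on {0..t} M" and Lc: "continuous_on {0..t} L"
    using dM dL by (meson DERIV_continuous_on)+
  have Z: "L 0 * M 0 powr (- (\<alpha> / 2)) \<le> L \<tau> * M \<tau> powr (- (\<alpha> / 2))" if \<tau>: "\<tau> \<in> {0..t}" for \<tau>
  proof (rule DERIV_nonneg_imp_increasing_open[where a = 0 and b = \<tau> and f = "\<lambda>\<tau>. L \<tau> * M \<tau> powr (- (\<alpha> / 2))"])
    show "continuous_on {0..\<tau>} (\<lambda>\<tau>. L \<tau> * M \<tau> powr (- (\<alpha> / 2)))"
      using \<tau> Mpos by (intro continuous_intros continuous_on_subset[OF Lc] continuous_on_subset[OF Mc]) force+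
    fix x assume x: "0 < x" "x < \<tau>"
    have xt: "x \<in> {0..t}" "x < t" using x \<tau> by auto
    have d: "(M has_real_derivative 2 * K x) (at x)" "(L has_real_derivative \<alpha> * (V x + \<beta>)) (at x)"
      using dM[OF xt(1)] dL[OF xt(1)] int[OF x(1) xt(2)] by simp_all
    have "((\<lambda>\<tau>. M \<tau> powr (- (\<alpha> / 2))) has_real_derivative (- (\<alpha> / 2)) * M x powr (- (\<alpha> / 2) - 1) * (2 * K x)) (at x)"
      using DERIV_fun_powr[OF d(1) Mpos[OF xt(1)], of "- (\<alpha> / 2)"] by simp
    from DERIV_mult[OF d(2) this]
    have "((\<lambda>\<tau>. L \<tau> * M \<tau> powr (- (\<alpha> / 2))) has_real_derivative
        \<alpha> * (V x + \<beta>) * M x powr (- (\<alpha> / 2)) + (- (\<alpha> / 2)) * M x powr (- (\<alpha> / 2) - 1) * (2 * K x) * L x) (at x)" .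
    moreover have "\<alpha> * (V x + \<beta>) * M x powr (- (\<alpha> / 2)) + (- (\<alpha> / 2)) * M x powr (- (\<alpha> / 2) - 1) * (2 * K x) * L x
      = \<alpha> * M x powr (- (\<alpha> / 2) - 1) * (M x * (V x + \<beta>) - K x * L x)"
    proof -
      have "M x powr (- (\<alpha> / 2)) = M x * M x powr (- (\<alpha> / 2) - 1)"
        using Mpos[OF xt(1)] by (simp add: powr_diff)
      then show ?thesis by (simp only:) (simp add: algebra_simps)
    qed
    moreover have "0 \<le> \<alpha> * M x powr (- (\<alpha> / 2) - 1) * (M x * (V x + \<beta>) - K x * L x)"
    proof -
      have "K x * L x \<le> K x * K x" using KL[OF xt(1)] Lpos[OF xt(1)] by (intro mult_left_mono) auto
      then have "K x * L x \<le> M x * (V x + \<beta>)" using CS[OF xt(1)] by (simp add: power2_eq_square)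
      then show ?thesis using pos by simp
    qed
    ultimately show "\<exists>y. ((\<lambda>\<tau>. L \<tau> * M \<tau> powr (- (\<alpha> / 2))) has_real_derivative y) (at x) \<and> y \<ge> 0"
      by metis
  qed (use \<tau> in simp)
  define c where "c = 2 * \<gamma> * (\<beta> * \<sigma> * M 0 powr (- (\<alpha> / 2)))"
  have "- (M 0 powr (- \<gamma>)) - c * 0 \<le> - (M t powr (- \<gamma>)) - c * t"
  proof (rule DERIV_nonneg_imp_increasing_open[where a = 0 and b = t and f = "\<lambda>\<tau>. - (M \<tau> powr (- \<gamma>)) - c * \<tau>"])
    show "continuous_on {0..t} (\<lambda>\<tau>. - (M \<tau> powr (- \<gamma>)) - c * \<tau>)"
      using Mpos by (intro continuous_intros Mc) force
    fix x assume x: "0 < x" "x < t"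
    have xt: "x \<in> {0..t}" using x by simp
    have d: "(M has_real_derivative 2 * K x) (at x)" using dM[OF xt] int[OF x] by simp
    have "((\<lambda>\<tau>. M \<tau> powr (- \<gamma>)) has_real_derivative (- \<gamma>) * M x powr (- \<gamma> - 1) * (2 * K x)) (at x)"
      using DERIV_fun_powr[OF d Mpos[OF xt], of "- \<gamma>"] by simp
    then have "((\<lambda>\<tau>. - (M \<tau> powr (- \<gamma>)) - c * \<tau>) has_real_derivative - ((- \<gamma>) * M x powr (- \<gamma> - 1) * (2 * K x)) - c) (at x)"
      using DERIV_diff[OF DERIV_minus DERIV_cmult[OF DERIV_ident]] by fastforce
    moreover have "- \<gamma> - 1 = - (\<alpha> / 2)" using \<gamma>(2) by linarith
    ultimately have "((\<lambda>\<tau>. - (M \<tau> powr (- \<gamma>)) - c * \<tau>) has_real_derivative 2 * \<gamma> * (K x * M x powr (- (\<alpha> / 2))) - c) (at x)"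
      by (simp add: mult_ac)
    moreover have "0 \<le> 2 * \<gamma> * (K x * M x powr (- (\<alpha> / 2))) - c"
    proof -
      have "\<beta> * \<sigma> * M 0 powr (- (\<alpha> / 2)) \<le> L x * M x powr (- (\<alpha> / 2))" using Z[OF xt] by (simp add: L0)
      also have "\<dots> \<le> K x * M x powr (- (\<alpha> / 2))" using KL[OF xt] by (intro mult_right_mono) auto
      finally show ?thesis using \<gamma>(1) by (simp add: c_def)
    qed
    ultimately show "\<exists>y. ((\<lambda>\<tau>. - (M \<tau> powr (- \<gamma>)) - c * \<tau>) has_real_derivative y) (at x) \<and> y \<ge> 0"
      by blast
  qed (use t in simp)
  then have Y: "M t powr (- \<gamma>) \<le> M 0 powr (- \<gamma>) - c * t" by simp
  have M0p: "0 < M 0" using Mpos[of 0] t by simp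
  have "c = M 0 powr (- \<gamma>) / Ts"
  proof -
    have "- (\<alpha> / 2) = - \<gamma> - 1" using \<gamma>(2) by linarith
    then have "c = 2 * (\<gamma> * \<beta> * \<sigma>) * M 0 powr (- \<gamma> - 1)" unfolding c_def by simp
    also have "\<dots> = 2 * a * (M 0 powr (- \<gamma>) / M 0)" using M0p by (simp add: \<beta>\<sigma> powr_diff)
    also have "\<dots> = M 0 powr (- \<gamma>) / Ts"
    proof -
      have "2 * a * (y / (2 * a * Ts)) = y / Ts" for y using pos by simp
      then show ?thesis using M0 by metis
    qed
    finally show ?thesis .
  qed
  then have "M t powr (- \<gamma>) \<le> M 0 powr (- \<gamma>) * (1 - t / Ts)" using Y by (simp add: algebra_simps)
  moreover have "0 < M t powr (- \<gamma>)" using Mpos[of t] t by simp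
  moreover have q: "0 < 1 - t / Ts" using t Tp by simp
  ultimately have "(M 0 powr (- \<gamma>) * (1 - t / Ts)) powr (- (1 / \<gamma>)) \<le> (M t powr (- \<gamma>)) powr (- (1 / \<gamma>))"
    using \<gamma>(1) by (intro powr_mono2') auto
  also have "(M t powr (- \<gamma>)) powr (- (1 / \<gamma>)) = M t" using \<gamma>(1) Mpos[of t] t by (simp add: powr_powr)
  also have "(M 0 powr (- \<gamma>) * (1 - t / Ts)) powr (- (1 / \<gamma>)) = M 0 * (1 - t / Ts) powr (- (1 / \<gamma>))"
    using q \<gamma>(1) M0p by (simp add: powr_mult powr_powr)
  finally have "2 * a * Ts * (1 - t / Ts) powr (- (1 / \<gamma>)) \<le> M t" by (simp add: M0)
  moreover have "- (1 / \<gamma>) = - 2 / (\<alpha> - 2)" by (simp add: \<gamma>_def)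
  ultimately show ?thesis by (simp add: M_def \<sigma>_def \<gamma>_def)
qed

lemma blowup_rate_at_left:
  fixes Ts p C c :: real
  assumes "0 < Ts" "0 < p" "0 < c"
  shows "filterlim (\<lambda>t. c * (1 - t / Ts) powr (- p) - C) at_top (at_left Ts)"
proof -
  have 1: "filterlim (\<lambda>t. (1 - t / Ts) powr p) (at_right 0) (at_left Ts)"
    unfolding filterlim_at
  proof
    have "((\<lambda>t. (1 - t / Ts) powr p) \<longlongrightarrow> (1 - Ts / Ts) powr p) (at_left Ts)"
      by (intro tendsto_powr2 tendsto_intros) (use assms in \<open>auto simp: eventually_at_filter\<close>)
    then show "((\<lambda>t. (1 - t / Ts) powr p) \<longlongrightarrow> 0) (at_left Ts)" using assms by simp
    show "\<forall>\<^sub>F t in at_left Ts. (1 - t / Ts) powr p \<in> {0<..} \<and> (1 - t / Ts) powr p \<noteq> 0"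
      using assms by (auto simp: eventually_at_filter)
  qed
  have "filterlim (\<lambda>t. inverse ((1 - t / Ts) powr p)) at_top (at_left Ts)"
    by (rule filterlim_compose[OF filterlim_inverse_at_top_right 1])
  then have "filterlim (\<lambda>t. c * (1 - t / Ts) powr (- p)) at_top (at_left Ts)"
    by (intro filterlim_tendsto_pos_mult_at_top[OF tendsto_const assms(3)]) (simp add: powr_minus)
  then have "filterlim (\<lambda>t. - C + c * (1 - t / Ts) powr (- p)) at_top (at_left Ts)"
    by (rule filterlim_tendsto_add_at_top[OF tendsto_const])
  then show ?thesis by simp
qed

context nonlocal_problem begin

text \<open>A function that vanishes almost everywhere has \<open>I = 0\<close>.\<close>

lemma L2_norm_pos_if_I_neg:
  assumes w: "w \<in> W0 s \<Omega> g" "w \<in> L2_space \<Omega>" and neg: "I w < 0"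
  shows "0 < (L2_norm \<Omega> w)\<^sup>2"
proof (rule ccontr)
  assume "\<not> ?thesis"
  then have "(LINT x|lebesgue_on \<Omega>. (w x)\<^sup>2) = 0" by (simp add: L2_norm_sq[symmetric])
  then have "AE x in lebesgue_on \<Omega>. (w x)\<^sup>2 = 0"
    by (subst (asm) integral_nonneg_eq_0_iff_AE) (use L2_spaceD[OF w(2)] in auto)
  then have "AE x in lebesgue_on \<Omega>. w x = 0" by simp
  then have "AE x in lebesgue. w x = 0" by (rule AE_lebesgue_if_AE_on[OF _ W0_D(2)[OF w(1)]])
  then show False using I_nonneg_if_zero[OF w(1)] neg by simp
qed
end

context strong_flow begin

lemma norm_u_0: "L2_norm \<Omega> (u 0) = L2_norm \<Omega> u0"
proof -
  have "(LINT x|lebesgue_on \<Omega>. (u 0 x)\<^sup>2) = (LINT x|lebesgue_on \<Omega>. (u0 x)\<^sup>2)"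
  proof (rule integral_cong_AE)
    show "(\<lambda>x. (u 0 x)\<^sup>2) \<in> borel_measurable (lebesgue_on \<Omega>)"
      using L2_spaceD(2)[OF u_L2[of 0]] T by auto
    show "(\<lambda>x. (u0 x)\<^sup>2) \<in> borel_measurable (lebesgue_on \<Omega>)"
      using W0_on[OF u0(1)] by measurable
    show "AE x in lebesgue_on \<Omega>. (u 0 x)\<^sup>2 = (u0 x)\<^sup>2"
      using AE_on_if_AE_lebesgue[OF u_0_AE] by eventually_elim simp
  qed
  then show ?thesis by (simp add: L2_norm_def)
qed

text \<open>The potential well and the energy identity supply the hypothesis \<open>lower\<close> of the concavity argument,
  Young's inequality for \<open>(v, u)\<close> the hypothesis \<open>upper\<close>.\<close>

lemma mass_lower_bound:
  fixes \<beta> Ts a :: real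
  defines "a \<equiv> (L2_norm \<Omega> u0)\<^sup>2" and "\<beta> \<equiv> \<alpha> * (d - E u0) / (\<alpha> - 1)"
  assumes t: "0 \<le> t" "t < T" "t < Ts" and a: "0 < a" and Ts: "Ts = 4 * a / ((\<alpha> - 2)\<^sup>2 * \<beta>)"
  shows "2 * a * Ts * (1 - t / Ts) powr (- 2 / (\<alpha> - 2))
    \<le> integral {0..t} (\<lambda>\<tau>. (L2_norm \<Omega> (u \<tau>))\<^sup>2) + (Ts - t) * a + \<beta> * (t + (\<alpha> - 2) / 2 * Ts)\<^sup>2"
proof (rule concavity_lower_bound[where V = dissipation])
  have \<beta>: "\<alpha> * (d - E u0) = (\<alpha> - 1) * \<beta>" using \<alpha> by (simp add: \<beta>_def)
  show "0 < \<beta>" using \<alpha> u0(2) by (simp add: \<beta>_def)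
  have Wc: "continuous_on {0..T} (\<lambda>\<tau>. (L2_norm \<Omega> (u \<tau>))\<^sup>2)" by (intro continuous_intros norm_cont)
  then show "continuous_on {0..t} (\<lambda>\<tau>. (L2_norm \<Omega> (u \<tau>))\<^sup>2)" by (rule continuous_on_subset) (use t in auto)
  show "continuous_on {0..t} dissipation" by (rule continuous_on_subset[OF dissipation_cont]) (use t in auto)
  show "(L2_norm \<Omega> (u 0))\<^sup>2 = a" by (simp add: a_def norm_u_0)
  show "0 \<le> dissipation \<tau>" if "\<tau> \<in> {0..t}" for \<tau> using dissipation_nonneg[of \<tau>] that t by auto
  fix \<tau> assume \<tau>: "\<tau> \<in> {0..t}"
  have ne0: "AE r in lebesgue. r \<noteq> (0::real)" by (rule AE_I'[of "{0}"]) auto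
  have Vc: "continuous_on {0..\<tau>} dissipation" by (rule continuous_on_subset[OF dissipation_cont]) (use \<tau> t in auto)
  have kc: "continuous_on {0..\<tau>} (\<lambda>r. \<alpha> * (dissipation r + \<beta>))" by (intro continuous_intros Vc)
  have "2 * integral {0..\<tau>} (\<lambda>r. \<alpha> * (dissipation r + \<beta>) - \<beta>) \<le> 1 * ((L2_norm \<Omega> (u \<tau>))\<^sup>2 - (L2_norm \<Omega> (u 0))\<^sup>2)"
  proof (rule norm_sq_increment_ge)
    show "(\<lambda>r. \<alpha> * (dissipation r + \<beta>) - \<beta>) absolutely_integrable_on {0..\<tau>}"
      by (intro absolutely_integrable_continuous_real continuous_intros Vc)
    show "AE r in lebesgue. r \<in> {0..\<tau>} \<longrightarrow> \<alpha> * (dissipation r + \<beta>) - \<beta> \<le> 1 * ip (v r) (u r)"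
      using tested_self ne0
    proof (eventually_elim, intro impI)
      fix r assume *: "r \<in> {0<..<T} \<longrightarrow> v r \<in> L2_space \<Omega> \<and> ip (v r) (u r) = - I (u r)" "r \<noteq> 0" "r \<in> {0..\<tau>}"
      then have r: "0 \<le> r" "r < T" "r \<in> {0<..<T}" using \<tau> t by auto
      have "\<alpha> * d \<le> \<alpha> * E (u r) - I (u r)" by (rule depth_le_defect[OF u_admissible invariant]) (use r in auto)
      moreover have "\<alpha> * E (u r) \<le> \<alpha> * (E u0 - dissipation r)"
        using energy[OF r(1,2)] energy_0 \<alpha> by (intro mult_left_mono) auto
      ultimately have "\<alpha> * (d - E u0) + \<alpha> * dissipation r \<le> - I (u r)" by (simp add: right_diff_distrib)
      then show "\<alpha> * (dissipation r + \<beta>) - \<beta> \<le> 1 * ip (v r) (u r)"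
        using * r(3) unfolding \<beta> by (simp add: algebra_simps)
    qed
  qed (use \<tau> t in auto)
  moreover have "integral {0..\<tau>} (\<lambda>r. \<alpha> * (dissipation r + \<beta>) - \<beta>) = integral {0..\<tau>} (\<lambda>r. \<alpha> * (dissipation r + \<beta>)) - \<beta> * \<tau>"
    using \<tau> by (subst Henstock_Kurzweil_Integration.integral_diff)
      (auto intro!: integrable_continuous_real kc simp: mult.commute)
  ultimately show "2 * integral {0..\<tau>} (\<lambda>r. \<alpha> * (dissipation r + \<beta>)) - 2 * \<beta> * \<tau> \<le> (L2_norm \<Omega> (u \<tau>))\<^sup>2 - a"
    by (simp add: a_def norm_u_0)
  fix \<epsilon> :: real assume \<epsilon>: "0 < \<epsilon>"
  have Wi: "(\<lambda>r. (L2_norm \<Omega> (u r))\<^sup>2) absolutely_integrable_on {0..\<tau>}"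
    by (rule absolutely_integrable_continuous_real, rule continuous_on_subset[OF Wc]) (use \<tau> t in auto)
  have Ni: "(\<lambda>r. (L2_norm \<Omega> (v r))\<^sup>2) absolutely_integrable_on {0..\<tau>}"
    by (rule set_integrable_subset[OF v_norm_sq_integrable]) (use \<tau> t in auto)
  have ki: "(\<lambda>r. (- \<epsilon> / 2) * (L2_norm \<Omega> (u r))\<^sup>2 + (- 1 / (2 * \<epsilon>)) * (L2_norm \<Omega> (v r))\<^sup>2) absolutely_integrable_on {0..\<tau>}"
    by (intro set_integral_add set_integrable_mult_right Wi Ni)
  have "2 * integral {0..\<tau>} (\<lambda>r. (- \<epsilon> / 2) * (L2_norm \<Omega> (u r))\<^sup>2 + (- 1 / (2 * \<epsilon>)) * (L2_norm \<Omega> (v r))\<^sup>2)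
    \<le> - 1 * ((L2_norm \<Omega> (u \<tau>))\<^sup>2 - (L2_norm \<Omega> (u 0))\<^sup>2)"
  proof (rule norm_sq_increment_ge[OF _ _ _ _ ki])
    show "AE r in lebesgue. r \<in> {0..\<tau>} \<longrightarrow>
        (- \<epsilon> / 2) * (L2_norm \<Omega> (u r))\<^sup>2 + (- 1 / (2 * \<epsilon>)) * (L2_norm \<Omega> (v r))\<^sup>2 \<le> - 1 * ip (v r) (u r)"
      using v_AE ne0
    proof (eventually_elim, intro impI)
      fix r assume *: "r \<in> {0<..<T} \<longrightarrow> v r \<in> L2_space \<Omega>" "r \<noteq> 0" "r \<in> {0..\<tau>}"
      then have "v r \<in> L2_space \<Omega>" "u r \<in> L2_space \<Omega>" using \<tau> t by (auto intro!: u_L2)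
      from L2_young[OF this(2,1) \<epsilon>] show "(- \<epsilon> / 2) * (L2_norm \<Omega> (u r))\<^sup>2 + (- 1 / (2 * \<epsilon>)) * (L2_norm \<Omega> (v r))\<^sup>2 \<le> - 1 * ip (v r) (u r)"
        using \<epsilon> by (simp add: mult.commute[of "v r _"] field_simps)
    qed
  qed (use \<tau> t in auto)
  moreover have "integral {0..\<tau>} (\<lambda>r. (- \<epsilon> / 2) * (L2_norm \<Omega> (u r))\<^sup>2 + (- 1 / (2 * \<epsilon>)) * (L2_norm \<Omega> (v r))\<^sup>2)
    = (- \<epsilon> / 2) * integral {0..\<tau>} (\<lambda>r. (L2_norm \<Omega> (u r))\<^sup>2) + (- 1 / (2 * \<epsilon>)) * dissipation \<tau>"
    unfolding dissipation_def
    by (subst Henstock_Kurzweil_Integration.integral_add[OF integrable_on_mult_right integrable_on_mult_right])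
      (simp_all only: set_lebesgue_integral_eq_integral(1)[OF Wi] set_lebesgue_integral_eq_integral(1)[OF Ni] integral_mult_right)
  ultimately show "(L2_norm \<Omega> (u \<tau>))\<^sup>2 - a \<le> \<epsilon> * integral {0..\<tau>} (\<lambda>r. (L2_norm \<Omega> (u r))\<^sup>2) + dissipation \<tau> / \<epsilon>"
    using \<epsilon> by (simp add: a_def norm_u_0 algebra_simps)
qed (use t a Ts \<alpha> in auto)

lemma norm_sq_integral: "(LINT \<tau>:{0..t}|lebesgue. (L2_norm \<Omega> (u \<tau>))\<^sup>2) = integral {0..t} (\<lambda>\<tau>. (L2_norm \<Omega> (u \<tau>))\<^sup>2)"
  if "t \<le> T"
proof (rule set_lebesgue_integral_eq_integral(2), rule absolutely_integrable_continuous_real)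
  show "continuous_on {0..t} (\<lambda>\<tau>. (L2_norm \<Omega> (u \<tau>))\<^sup>2)"
    by (intro continuous_intros continuous_on_subset[OF norm_cont]) (use that in auto)
qed
end

section \<open>Blow-up\<close>

theorem theorem4p4:
  fixes \<Omega> :: "'a::euclidean_space set"
    and g :: "'a \<Rightarrow> 'a \<Rightarrow> real \<Rightarrow> real"
    and f :: "'a \<Rightarrow> real \<Rightarrow> real"
    and h1 h2 :: "'a \<Rightarrow> real"
    and u0 :: "'a \<Rightarrow> real"
    and u :: "real \<Rightarrow> 'a \<Rightarrow> real"
    and s gm gp \<alpha> Tstar :: real
  assumes s: "0 < s" "s < 1"
    and domain: "smooth_bounded_domain \<Omega>"
    and g_meas: "\<And>t. (\<lambda>(x, y). g x y t) \<in> borel_measurable lebesgue"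
    and g_nonneg: "\<And>x y t. t \<ge> 0 \<Longrightarrow> g x y t \<ge> 0"
    and g_odd: "\<And>x y t. g x y (- t) = - g x y t"
    and g1: "\<And>x y. (g x y \<longlongrightarrow> 0) (at_right 0)" "\<And>x y. filterlim (g x y) at_top at_top"
    and g2: "\<And>x y. g x y differentiable_on {0<..}" "\<And>x y. continuous_on {0<..} (deriv (g x y))"
      "\<And>x y. mono_on {0<..} (g x y)"
    and g3: "1 < gm" "gm \<le> gp" "ereal gp < crit_exp DIM('a) s gm"
      "\<And>x y t. t > 0 \<Longrightarrow> gm \<le> g x y t * t / G_fun g x y t \<and> g x y t * t / G_fun g x y t \<le> gp"
      "\<And>x y t. t > 0 \<Longrightarrow>
         gm - 1 \<le> deriv (g x y) t * t / g x y t \<and> deriv (g x y) t * t / g x y t \<le> gp - 1"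
      "real DIM('a) \<ge> s * gm"
    and g4: "\<And>x. x \<in> \<Omega> \<Longrightarrow> (\<integral>\<^sup>+\<tau>\<in>{0..1}. ennreal (conj_integrand s g x \<tau>) \<partial>lborel) < \<infinity>"
      "\<And>x. x \<in> \<Omega> \<Longrightarrow> (\<integral>\<^sup>+\<tau>\<in>{1..}. ennreal (conj_integrand s g x \<tau>) \<partial>lborel) = \<infinity>"
    and f_meas: "\<And>t. (\<lambda>x. f x t) \<in> borel_measurable (lebesgue_on \<Omega>)"
    and fa: "\<And>x. x \<in> \<Omega> \<Longrightarrow> f x differentiable_on UNIV"
      "\<And>x. x \<in> \<Omega> \<Longrightarrow> continuous_on UNIV (deriv (f x))"
      "\<And>x. x \<in> \<Omega> \<Longrightarrow> f x 0 = 0 \<and> deriv (f x) 0 = 0"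
      "\<exists>B>0. \<forall>x\<in>\<Omega>. min (F_fun f x 1) (F_fun f x (-1)) \<ge> B"
    and fb: "\<And>x. x \<in> \<Omega> \<Longrightarrow> convex_on {0<..} (f x)" "\<And>x. x \<in> \<Omega> \<Longrightarrow> concave_on {..<0} (f x)"
    and h_reg: "h1 \<in> borel_measurable (lebesgue_on \<Omega>)" "h2 \<in> borel_measurable (lebesgue_on \<Omega>)"
      "bounded (h1 ` \<Omega>)" "bounded (h2 ` \<Omega>)" "\<And>x. x \<in> \<Omega> \<Longrightarrow> h1 x > 1 \<and> h2 x > 1"
    and fc: "\<And>x t. x \<in> \<Omega> \<Longrightarrow> h1 x * F_fun f x t \<le> t * f x t \<and> t * f x t \<le> h2 x * F_fun f x t"
      "\<And>k. k > 0 \<Longrightarrow>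
         uniform_limit \<Omega> (\<lambda>t x. Phi_fun h2 x (k * t) / G_star s g x t) (\<lambda>x. 0) at_top"
    and alpha: "if gp > 2 then \<alpha> = gp else \<alpha> > 2"
    and fd: "\<And>x t. x \<in> \<Omega> \<Longrightarrow> t \<noteq> 0 \<Longrightarrow> t * (deriv (f x) t * t - (\<alpha> - 1) * f x t) > 0"
    and h_range: "max 2 gp < min (INF x\<in>\<Omega>. h1 x) (INF x\<in>\<Omega>. h2 x)"
      "ereal (SUP x\<in>\<Omega>. h2 x) \<le> crit_exp DIM('a) s gm / 2 + 1"
    and embedding: "compactly_embedded (W0 s \<Omega> g) (W0_norm s \<Omega> g) (L_Phi \<Omega> h2) (L_Phi_norm \<Omega> h2)"
    and u0: "u0 \<in> W0 s \<Omega> g" "energy_E s \<Omega> g f u0 < depth_d s \<Omega> g f" "nehari_I s \<Omega> g f u0 < 0"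
    and Tstar: "Tstar = 4 * (L2_norm \<Omega> u0)\<^sup>2 * (\<alpha> - 1) /
                  (\<alpha> * (\<alpha> - 2)\<^sup>2 * (depth_d s \<Omega> g f - energy_E s \<Omega> g f u0))"
    and sol: "\<And>T. 0 < T \<Longrightarrow> T < Tstar \<Longrightarrow> strong_solution s \<Omega> g f h2 u0 (ereal T) u"
  shows "filterlim (\<lambda>t. LINT \<tau>:{0..t}|lebesgue. (L2_norm \<Omega> (u \<tau>))\<^sup>2) at_top (at_left Tstar)"
proof -
  have open_bdd: "open \<Omega>" "bounded \<Omega>" "\<Omega> \<noteq> {}" using domain by (auto simp: smooth_bounded_domain_def)
  have \<alpha>: "2 < \<alpha>" "gp \<le> \<alpha>" using alpha by (auto split: if_splits)
  have N: "N_function (g x y) (G_fun g x y) gm gp" for x y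
  proof
    show "G_fun g x y t = (LBINT \<tau>=0..ereal \<bar>t\<bar>. g x y \<tau>)" for t by (simp add: G_fun_def)
  qed (use g_nonneg g_odd g1 g2 g3 in auto)
  have src: "source_term (f x) (F_fun f x) (deriv (f x)) (h1 x) (h2 x) \<alpha>" if x: "x \<in> \<Omega>" for x
  proof
    show df: "(f x has_real_derivative deriv (f x) t) (at t)" for t
      using fa(1)[OF x] by (simp add: differentiable_on_eq_differentiable_at DERIV_deriv_iff_real_differentiable)
    have "continuous_on UNIV (f x)" using fa(1)[OF x] by (rule differentiable_imp_continuous_on)
    then show "(F_fun f x has_real_derivative f x t) (at t)" for t
      unfolding F_fun_def[abs_def] by (rule interval_integral_has_derivative)
    show "F_fun f x 0 = 0" by (simp add: F_fun_def zero_ereal_def)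
    show "convex_on {0<..} (\<lambda>t. - f x (- t))"
    proof (rule convex_onI)
      fix t a b :: real assume t: "0 < t" "t < 1" and ab: "a \<in> {0<..}" "b \<in> {0<..}"
      have "- f x ((1 - t) *\<^sub>R (- a) + t *\<^sub>R (- b)) \<le> (1 - t) * - f x (- a) + t * - f x (- b)"
        using convex_onD[OF fb(2)[OF x, unfolded concave_on_def], of t "- a" "- b"] t ab by simp
      moreover have "(1 - t) *\<^sub>R (- a) + t *\<^sub>R (- b) = - ((1 - t) *\<^sub>R a + t *\<^sub>R b)" by simp
      ultimately show "- f x (- ((1 - t) *\<^sub>R a + t *\<^sub>R b)) \<le> (1 - t) * - f x (- a) + t * - f x (- b)" by simp
    qed simp
  qed (use x fa(3) fb h_reg(5) fc(1) fd \<alpha> in auto)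
  interpret nonlocal_problem \<Omega> g f h1 h2 s gm gp \<alpha>
  proof (rule nonlocal_problem.intro)
    show "2 < (INF x\<in>\<Omega>. h2 x)" "gp < (INF x\<in>\<Omega>. h1 x)" using h_range(1) by auto
  qed (use open_bdd g_meas N f_meas src h_reg \<alpha> in auto)
  define a \<beta> where "a = (L2_norm \<Omega> u0)\<^sup>2" and "\<beta> = \<alpha> * (d - E u0) / (\<alpha> - 1)"
  have "u0 \<in> L_Phi \<Omega> h2" using embedding u0(1) by (auto simp: compactly_embedded_def)
  then have a: "0 < a" unfolding a_def by (intro L2_norm_pos_if_I_neg u0 L_Phi_L2)
  have \<beta>: "0 < \<beta>" using u0(2) \<alpha> by (simp add: \<beta>_def)
  have Ts: "Tstar = 4 * a / ((\<alpha> - 2)\<^sup>2 * \<beta>)"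
    unfolding Tstar a_def \<beta>_def using \<alpha> u0(2) by (simp add: field_simps)
  have Tp: "0 < Tstar" unfolding Ts using a \<beta> \<alpha> by simp
  \<comment> \<open>an upper bound for the terms of \<open>M\<close> other than the integral of \<open>\<parallel>u\<parallel>\<^sup>2\<close>\<close>
  define C where "C = Tstar * a + \<beta> * (Tstar + (\<alpha> - 2) / 2 * Tstar)\<^sup>2"
  have bound: "2 * a * Tstar * (1 - t / Tstar) powr (- (2 / (\<alpha> - 2))) - C \<le> (LINT \<tau>:{0..t}|lebesgue. (L2_norm \<Omega> (u \<tau>))\<^sup>2)"
    if t: "0 < t" "t < Tstar" for t
  proof -
    \<comment> \<open>any time strictly between \<open>t\<close> and \<open>Tstar\<close>, so that \<open>t\<close> lies inside an interval of existence\<close>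
    define T where "T = (t + Tstar) / 2"
    have T: "0 < T" "t < T" "T < Tstar" using t by (auto simp: T_def)
    obtain v where v: "weak_solution_with s \<Omega> g f h2 u0 (ereal T) u v"
      "\<And>t. 0 \<le> t \<Longrightarrow> t < T \<Longrightarrow> u t \<in> W0 s \<Omega> g \<and> integrable (lebesgue_on \<Omega>) (\<lambda>x. F_fun f x (u t x)) \<and>
        (LINT \<tau>:{0..t}|lebesgue. (L2_norm \<Omega> (v \<tau>))\<^sup>2) + energy_E s \<Omega> g f (u t) = energy_E s \<Omega> g f (u 0)"
      using sol[OF T(1,3)] unfolding strong_solution_def by auto
    interpret flow: strong_flow \<Omega> g f h1 h2 s gm gp \<alpha> u0 u v T
      by unfold_locales (use T(1) v u0 in auto)
    have "2 * a * Tstar * (1 - t / Tstar) powr (- 2 / (\<alpha> - 2))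
      \<le> integral {0..t} (\<lambda>\<tau>. (L2_norm \<Omega> (u \<tau>))\<^sup>2) + (Tstar - t) * a + \<beta> * (t + (\<alpha> - 2) / 2 * Tstar)\<^sup>2"
      unfolding a_def \<beta>_def
      by (rule flow.mass_lower_bound) (use t T a Ts in \<open>auto simp: a_def \<beta>_def\<close>)
    moreover have "(Tstar - t) * a \<le> Tstar * a" using t a by (intro mult_right_mono) auto
    moreover have "\<beta> * (t + (\<alpha> - 2) / 2 * Tstar)\<^sup>2 \<le> \<beta> * (Tstar + (\<alpha> - 2) / 2 * Tstar)\<^sup>2"
      using t \<beta> \<alpha> by (intro mult_left_mono power_mono) auto
    ultimately show ?thesis using flow.norm_sq_integral[of t] T by (simp add: C_def)
  qed
  have rate: "filterlim (\<lambda>t. 2 * a * Tstar * (1 - t / Tstar) powr (- (2 / (\<alpha> - 2))) - C) at_top (at_left Tstar)"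
    by (rule blowup_rate_at_left) (use Tp a \<alpha> in auto)
  show ?thesis
  proof (rule filterlim_at_top_mono[OF rate])
    have "\<forall>\<^sub>F t in at_left Tstar. t \<in> {0<..<Tstar}" using Tp by (rule eventually_at_left_real)
    then show "\<forall>\<^sub>F t in at_left Tstar. 2 * a * Tstar * (1 - t / Tstar) powr (- (2 / (\<alpha> - 2))) - C
        \<le> (LINT \<tau>:{0..t}|lebesgue. (L2_norm \<Omega> (u \<tau>))\<^sup>2)"
      by eventually_elim (use bound in auto)
  qed
qed

end
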